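(* Let $\delta\in[0,1]$, let $P_d$ be any probability distribution on $\mathbb{Z}_+=\{0,1,2,\dots\}$, and let $\mu_s\neq\delta_0$ be a non-trivial symmetric probability distribution on $(-\infty,+\infty]$. Let $\mathcal{Q}_s$ be the associated BP operator. Then there is exactly one non-trivial symmetric BP fixed point $\mu^*$, and for all symmetric $\mu$ (including the trivial one) the sequence $\mathcal{Q}_s^h\mu$ converges weakly to $\mu^*$ as $h\to\infty$.
   Context: A probability distribution $\mu$ on $(-\infty,+\infty]$ is called symmetric if $\mu[E]=\int e^{-r}\mathbf{1}\{-r\in E\}\,d\mu(r)$ for every measurable $E\subseteq(-\infty,+\infty)$ (an atom at $+\infty$ is allowed). The trivial distribution is $\delta_0$, the unit mass at $0$. Weak convergence is that of probability measures on $(-\infty,+\infty]$ (test functions: bounded functions continuous on $(-\infty,+\infty]$). BP operator: for symmetric $\mu$, $\mathcal{Q}_s\mu$ is the law of $$R=\sum_{u=1}^d Z_uF_\delta(\tilde R_u)+S,\qquad F_\delta(x)=\ln\frac{(1-\delta)e^x+\delta}{\delta e^x+1-\delta},$$ where $d\sim P_d$, $\tilde R_u\sim\mu$ i.i.d., $Z_u$ i.i.d. with $\mathbb{P}[Z_u=-1]=\delta$, $\mathbb{P}[Z_u=1]=1-\delta$, $S\sim\mu_s$, all jointly independent, with $F_\delta(+\infty)$ defined by continuity. A symmetric $\mu$ is a BP fixed point if $\mathcal{Q}_s\mu=\mu$. *)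

theory Defs
  imports "HOL-Probability.Probability"
begin

text \<open>
  Probability distributions on \<open>(-\<infinity>, +\<infinity>]\<close> are represented as Borel probability measures on
  \<^typ>\<open>ereal\<close> that give no mass to \<open>-\<infinity>\<close>.
\<close>

definition llr_dist :: "ereal measure \<Rightarrow> bool" where
  "llr_dist \<mu> \<longleftrightarrow> prob_space \<mu> \<and> sets \<mu> = sets borel \<and> emeasure \<mu> {-\<infinity>} = 0"

text \<open>
  Since \<open>E\<close> contains only finite numbers, the integrand vanishes at \<open>r = +\<infinity>\<close>; the value
  \<open>real_of_ereal \<infinity> = 0\<close> plays no role.
\<close>

definition symmetric_dist :: "ereal measure \<Rightarrow> bool" where
  "symmetric_dist \<mu> \<longleftrightarrow> llr_dist \<mu> \<and>
     (\<forall>E\<in>sets borel. E \<subseteq> {-\<infinity><..<\<infinity>} \<longrightarrow>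
        emeasure \<mu> E = (\<integral>\<^sup>+ r. ennreal (exp (- real_of_ereal r)) * indicator E (- r) \<partial>\<mu>))"

definition trivial_dist :: "ereal measure" where
  "trivial_dist = return borel 0"

text \<open>Test functions live on \<open>(-\<infinity>, +\<infinity>]\<close>: no continuity is required at \<open>-\<infinity>\<close>.\<close>

definition weakly_converges :: "(nat \<Rightarrow> ereal measure) \<Rightarrow> ereal measure \<Rightarrow> bool" where
  "weakly_converges M \<mu> \<longleftrightarrow>
     (\<forall>f :: ereal \<Rightarrow> real. continuous_on {-\<infinity><..} f \<longrightarrow> bounded (f ` {-\<infinity><..}) \<longrightarrow>
        (\<lambda>h. \<integral>r. f r \<partial>(M h)) \<longlonglongrightarrow> (\<integral>r. f r \<partial>\<mu>))"

definition F_real :: "real \<Rightarrow> real \<Rightarrow> real" where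
  "F_real \<delta> x = ln (((1 - \<delta>) * exp x + \<delta>) / (\<delta> * exp x + 1 - \<delta>))"

text \<open>
  The extension by continuity takes values in \<^typ>\<open>ereal\<close>, because the limit at \<open>+\<infinity>\<close> is \<open>+\<infinity>\<close> for
  \<open>\<delta> = 0\<close> and \<open>-\<infinity>\<close> for \<open>\<delta> = 1\<close>. The value at \<open>-\<infinity>\<close> is only ever used on a null set.
\<close>

definition F_ext :: "real \<Rightarrow> ereal \<Rightarrow> ereal" where
  "F_ext \<delta> x = (case x of
       ereal r \<Rightarrow> ereal (F_real \<delta> r)
     | PInfty \<Rightarrow> Lim at_top (\<lambda>r. ereal (F_real \<delta> r))
     | MInfty \<Rightarrow> Lim at_bot (\<lambda>r. ereal (F_real \<delta> r)))"

definition sign_pmf :: "real \<Rightarrow> ereal pmf" where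
  "sign_pmf \<delta> = map_pmf (\<lambda>flip. if flip then -1 else 1) (bernoulli_pmf \<delta>)"

text \<open>
  Joint independence is expressed by the product measure. For \<open>\<delta> = 0\<close> the signs are almost surely
  \<open>1\<close>, for \<open>\<delta> = 1\<close> almost surely \<open>-1\<close>, so that almost surely no summand is \<open>-\<infinity>\<close> and the sum is
  well defined.
\<close>

definition BP_operator ::
    "nat pmf \<Rightarrow> real \<Rightarrow> ereal measure \<Rightarrow> ereal measure \<Rightarrow> ereal measure" where
  "BP_operator P \<delta> \<mu>s \<mu> =
     distr
       (measure_pmf P \<Otimes>\<^sub>M (\<Pi>\<^sub>M u\<in>(UNIV :: nat set). measure_pmf (sign_pmf \<delta>)) \<Otimes>\<^sub>M
          (\<Pi>\<^sub>M u\<in>(UNIV :: nat set). \<mu>) \<Otimes>\<^sub>M \<mu>s)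
       borel
       (\<lambda>(d, Z, R, S). (\<Sum>u=1..d. Z u * F_ext \<delta> (R u)) + S)"

definition BP_fixed_point ::
    "nat pmf \<Rightarrow> real \<Rightarrow> ereal measure \<Rightarrow> ereal measure \<Rightarrow> bool" where
  "BP_fixed_point P \<delta> \<mu>s \<mu> \<longleftrightarrow> symmetric_dist \<mu> \<and> BP_operator P \<delta> \<mu>s \<mu> = \<mu>"

lemma F_ext_PInfty:
  assumes "0 \<le> \<delta>" "\<delta> \<le> 1"
  shows "F_ext \<delta> \<infinity> = (if \<delta> = 0 then \<infinity> else if \<delta> = 1 then -\<infinity> else ereal (ln ((1 - \<delta>) / \<delta>)))"
proof -
  have "((\<lambda>r. ereal (F_real \<delta> r)) \<longlongrightarrow>
      (if \<delta> = 0 then \<infinity> else if \<delta> = 1 then -\<infinity> else ereal (ln ((1 - \<delta>) / \<delta>)))) at_top"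
  proof (cases "\<delta> = 0 \<or> \<delta> = 1")
    case True
    have F0: "F_real 0 = (\<lambda>r. r)"
      by (simp add: F_real_def fun_eq_iff)
    have F1: "F_real 1 = (\<lambda>r. - r)"
      by (simp add: F_real_def fun_eq_iff flip: exp_minus inverse_eq_divide)
    have "((\<lambda>r. ereal r) \<longlongrightarrow> \<infinity>) at_top"
      by (simp add: tendsto_PInfty eventually_gt_at_top)
    moreover have "((\<lambda>r. ereal (- r)) \<longlongrightarrow> -\<infinity>) at_top"
      unfolding tendsto_MInfty
    proof
      fix r :: real
      show "eventually (\<lambda>x. ereal (- x) < ereal r) at_top"
        using eventually_gt_at_top[of "-r"] by eventually_elim auto
    qed
    ultimately show ?thesis
      using True by (elim disjE) (simp_all add: F0 F1)
  next
    case False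
    hence d: "0 < \<delta>" "\<delta> < 1" using assms by auto
    have "((\<lambda>r :: real. exp (- r)) \<longlongrightarrow> 0) at_top"
      by (rule filterlim_compose[OF exp_at_bot filterlim_uminus_at_bot_at_top])
    hence "((\<lambda>r. ((1 - \<delta>) + \<delta> * exp (- r)) / (\<delta> + (1 - \<delta>) * exp (- r))) \<longlongrightarrow>
        ((1 - \<delta>) + \<delta> * 0) / (\<delta> + (1 - \<delta>) * 0)) at_top"
      using d by (intro tendsto_intros) simp_all
    hence "((\<lambda>r. ln (((1 - \<delta>) + \<delta> * exp (- r)) / (\<delta> + (1 - \<delta>) * exp (- r)))) \<longlongrightarrow>
        ln ((1 - \<delta>) / \<delta>)) at_top"
      using d by (intro tendsto_ln) auto
    moreover have "((1 - \<delta>) + \<delta> * exp (- r)) / (\<delta> + (1 - \<delta>) * exp (- r)) =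
        ((1 - \<delta>) * exp r + \<delta>) / (\<delta> * exp r + 1 - \<delta>)" for r
    proof -
      have "((1 - \<delta>) * exp r + \<delta>) / (\<delta> * exp r + 1 - \<delta>) =
          (((1 - \<delta>) + \<delta> * exp (- r)) * exp r) / ((\<delta> + (1 - \<delta>) * exp (- r)) * exp r)"
        by (simp add: distrib_right mult.assoc add.commute flip: exp_add)
      thus ?thesis
        by simp
    qed
    ultimately show ?thesis
      using d by (simp add: F_real_def)
  qed
  thus ?thesis
    by (simp add: F_ext_def tendsto_Lim)
qed

lemma F_ext_measurable [measurable]: "F_ext \<delta> \<in> borel_measurable borel"
proof -
  have [measurable]: "(\<lambda>r. F_real \<delta> r) \<in> borel_measurable borel"
    unfolding F_real_def by measurable
  have "F_ext \<delta> = (\<lambda>x. if x = \<infinity> then F_ext \<delta> \<infinity> else if x = -\<infinity> then F_ext \<delta> (-\<infinity>)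
      else ereal (F_real \<delta> (real_of_ereal x)))"
  proof
    fix x show "F_ext \<delta> x = (if x = \<infinity> then F_ext \<delta> \<infinity> else if x = -\<infinity> then F_ext \<delta> (-\<infinity>)
      else ereal (F_real \<delta> (real_of_ereal x)))"
      by (cases x) (auto simp: F_ext_def)
  qed
  also have "\<dots> \<in> borel_measurable borel"
    by measurable
  finally show ?thesis .
qed

lemma BP_operator_measurable:
  assumes "sets \<mu> = sets borel" "sets \<mu>s = sets borel"
  shows "(\<lambda>(d, Z, R, S). (\<Sum>u=1..d. Z u * F_ext \<delta> (R u)) + S) \<in>
    (measure_pmf P \<Otimes>\<^sub>M (\<Pi>\<^sub>M u\<in>(UNIV :: nat set). measure_pmf (sign_pmf \<delta>)) \<Otimes>\<^sub>M
      (\<Pi>\<^sub>M u\<in>(UNIV :: nat set). \<mu>) \<Otimes>\<^sub>M \<mu>s) \<rightarrow>\<^sub>M borel"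
proof -
  let ?M = "measure_pmf P \<Otimes>\<^sub>M (\<Pi>\<^sub>M u\<in>(UNIV :: nat set). measure_pmf (sign_pmf \<delta>)) \<Otimes>\<^sub>M
      (\<Pi>\<^sub>M u\<in>(UNIV :: nat set). \<mu>) \<Otimes>\<^sub>M \<mu>s"
  have [measurable]: "(\<lambda>w. fst (snd w) u) \<in> borel_measurable ?M" for u
  proof -
    have "(\<lambda>w. fst (snd w) u) \<in> ?M \<rightarrow>\<^sub>M measure_pmf (sign_pmf \<delta>)"
      by measurable
    thus ?thesis
      by (rule measurable_compose) simp
  qed
  have [measurable]: "(\<lambda>w. fst (snd (snd w)) u) \<in> borel_measurable ?M" for u
  proof -
    have "(\<lambda>w. fst (snd (snd w)) u) \<in> ?M \<rightarrow>\<^sub>M \<mu>"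
      by measurable
    thus ?thesis
      by (simp add: measurable_cong_sets[OF refl assms(1)])
  qed
  have [measurable]: "(\<lambda>w. snd (snd (snd w))) \<in> borel_measurable ?M"
  proof -
    have "(\<lambda>w. snd (snd (snd w))) \<in> ?M \<rightarrow>\<^sub>M \<mu>s"
      by measurable
    thus ?thesis
      by (simp add: measurable_cong_sets[OF refl assms(2)])
  qed
  have [measurable]: "fst \<in> ?M \<rightarrow>\<^sub>M count_space UNIV"
    by (rule measurable_compose[OF measurable_fst]) simp
  have "(\<lambda>w. (\<lambda>d w. (\<Sum>u=1..d. fst (snd w) u * F_ext \<delta> (fst (snd (snd w)) u))
      + snd (snd (snd w))) (fst w) w) \<in> borel_measurable ?M"
    by (rule measurable_compose_countable) measurable
  thus ?thesis
    by (simp add: case_prod_beta)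
qed

end

theory Submission
  imports Defs
begin

text \<open>
  Put \<open>x = tanh (r / 2)\<close> and test symmetric distributions with \<open>g\<^sub>q x = x\<^sup>2 / (1 - q\<^sup>2 x\<^sup>2)\<close>, \<open>\<bar>q\<bar> < 1\<close>.
  Adding an independent symmetric message turns \<open>g\<^sub>q\<close> into a constant plus a nonnegative combination of other
  \<open>g\<^sub>q\<close>, so the BP operator is monotone for the order \<open>\<mu> \<le> \<nu> \<longleftrightarrow> \<forall>q. \<integral>g\<^sub>q d\<mu> \<le> \<integral>g\<^sub>q d\<nu>\<close>.
  Write \<open>t\<mu>\<close> for \<open>\<mu>\<close> degraded by a binary symmetric channel of correlation \<open>t\<close>. By the stringy tree inequality
  \<open>t\<mu> \<le> \<nu>\<close> is inherited by the images under the BP operator, and the non-trivial survey, which is not degraded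
  on the right, leaves room to replace \<open>t < 1\<close> by a larger \<open>t'\<close> that depends on \<open>t\<close> and the survey only.
  Starting from \<open>t = 0\<close>, iteration drives \<open>t\<close> to \<open>1\<close>, so any two orbits merge. The orbit of the trivial
  distribution increases, hence converges; its limit is a fixed point by monotonicity alone. Finally, the integrals of the
  \<open>g\<^sub>q\<close> determine all even moments of \<open>x\<close>, and with them weak convergence of symmetric distributions.
\<close>

section \<open>Test functions\<close>

text \<open>A whole family of tests is forced: adding a message with \<open>tanh (r / 2) = b\<close>
  turns x^2, the test at q = 0, into a constant plus a multiple of the test at q = b, so no single
  moment obeys a closed comparison. The family closes up because g_q splits into simple poles at 1/q
  and -1/q, and adding a message moves a pole by a Moebius map that keeps q in (-1, 1). Expanding
  g_q in powers of q^2 shows that it carries all even moments of x; symmetry recovers the law of the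
  sign from the modulus.

  The obstacle is uniformity in q. A larger correlation t has to be reached for all q by the same
  step, although g_q loses its bound as q tends to 1. The gain from the survey is at least (1 -
  t^2)^3 / 8 times its second moment for every q. Raising t costs at most the increase of v = t^2 /
  (1 - t^2), again for every q, since 1 - q^2 t^2 x^2 is at least 1 - t^2. Balancing the two gives
  increments of order (1 + v)^(-3), and these still drive v to infinity.\<close>

definition gker :: "real \<Rightarrow> real \<Rightarrow> real" where
  "gker q x = x\<^sup>2 / (1 - q\<^sup>2 * x\<^sup>2)"

text \<open>
  For even \<open>f\<close> and independent symmetric log-likelihood ratios whose \<open>tanh (r / 2)\<close> have moduli \<open>a\<close> and \<open>b\<close>,
  \<open>comb f a b\<close> is the expectation of \<open>f (tanh (r / 2))\<close> at their sum: the signs agree with probability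
  \<open>(1 + a * b) / 2\<close>.
\<close>

definition comb :: "(real \<Rightarrow> real) \<Rightarrow> real \<Rightarrow> real \<Rightarrow> real" where
  "comb f a b = ((1 + a * b) * f ((a + b) / (1 + a * b)) + (1 - a * b) * f ((a - b) / (1 - a * b))) / 2"

lemma mult_sq_less_one:
  fixes q x :: real
  assumes "\<bar>q\<bar> < 1" "\<bar>x\<bar> \<le> 1"
  shows "q\<^sup>2 * x\<^sup>2 < 1" and "q\<^sup>2 * x\<^sup>2 \<le> q\<^sup>2" and "\<bar>q * x\<bar> < 1"
proof -
  show *: "q\<^sup>2 * x\<^sup>2 \<le> q\<^sup>2"
    using assms(2) by (simp add: abs_square_le_1 mult_left_le)
  have "q\<^sup>2 < 1"
    using assms(1) by (simp add: abs_square_less_1)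
  with * show "q\<^sup>2 * x\<^sup>2 < 1" by linarith
  thus "\<bar>q * x\<bar> < 1"
    by (simp add: abs_square_less_1 flip: power_mult_distrib)
qed

lemma gker_0 [simp]: "gker q 0 = 0"
  by (simp add: gker_def)

lemma gker_minus [simp]: "gker q (- x) = gker q x" "gker (- q) x = gker q x"
  by (simp_all add: gker_def)

lemma gker_nonneg: "\<bar>q\<bar> < 1 \<Longrightarrow> \<bar>x\<bar> \<le> 1 \<Longrightarrow> 0 \<le> gker q x"
  using mult_sq_less_one[of q x] by (simp add: gker_def)

lemma gker_le: "\<bar>q\<bar> < 1 \<Longrightarrow> \<bar>x\<bar> \<le> 1 \<Longrightarrow> gker q x \<le> 1 / (1 - q\<^sup>2)"
  unfolding gker_def using mult_sq_less_one[of q x]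
  by (intro frac_le) (auto simp: abs_square_le_1 abs_square_less_1)

text \<open>A binary symmetric channel of correlation t multiplies x by t; the tests stay within the
  family, with q replaced by t q.\<close>

lemma gker_scale: "gker q (t * x) = t\<^sup>2 * gker (t * q) x"
  by (simp add: gker_def power_mult_distrib mult_ac)

lemma gker_diff:
  assumes "\<bar>q\<bar> < 1" "\<bar>x\<bar> \<le> 1" "\<bar>y\<bar> \<le> 1"
  shows "gker q x - gker q y = (x\<^sup>2 - y\<^sup>2) / ((1 - q\<^sup>2 * x\<^sup>2) * (1 - q\<^sup>2 * y\<^sup>2))"
proof -
  have "1 - q\<^sup>2 * x\<^sup>2 \<noteq> 0" "1 - q\<^sup>2 * y\<^sup>2 \<noteq> 0"
    using mult_sq_less_one[of q x] mult_sq_less_one[of q y] assms by auto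
  thus ?thesis
    by (simp add: gker_def diff_frac_eq) (simp add: algebra_simps)
qed

lemma add_le_one_plus_mult:
  fixes a b :: real
  assumes "\<bar>a\<bar> \<le> 1" "\<bar>b\<bar> \<le> 1"
  shows "\<bar>a + b\<bar> \<le> 1 + a * b" "\<bar>a - b\<bar> \<le> 1 - a * b"
proof -
  have "0 \<le> (1 - a) * (1 - b)" "0 \<le> (1 + a) * (1 + b)" "0 \<le> (1 - a) * (1 + b)" "0 \<le> (1 + a) * (1 - b)"
    using assms by (auto intro!: mult_nonneg_nonneg)
  thus "\<bar>a + b\<bar> \<le> 1 + a * b" "\<bar>a - b\<bar> \<le> 1 - a * b"
    by (auto simp: algebra_simps)
qed

lemma mult_pos_of_strict:
  fixes q x y :: real
  assumes "\<bar>q\<bar> < 1" "\<bar>x\<bar> \<le> y" "0 < y"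
  shows "0 < y - q * x" "0 < y + q * x"
proof -
  have "\<bar>q * x\<bar> < y"
  proof (cases "x = 0")
    case False
    hence "\<bar>q\<bar> * \<bar>x\<bar> < 1 * \<bar>x\<bar>"
      using assms by (intro mult_strict_right_mono) auto
    thus ?thesis
      using assms(2) by (simp add: abs_mult)
  qed (use assms in auto)
  thus "0 < y - q * x" "0 < y + q * x"
    by linarith+
qed

text \<open>\<open>comb\<close> consists of terms y * g (z / y) with y = 1 + a b or 1 - a b. Partial
  fractions leave denominators linear in y and z, hence affine in each of a and b. At y = 0 also z =
  0, so both sides vanish.\<close>

lemma persp_gker:
  fixes q y z :: real
  assumes "\<bar>q\<bar> < 1" "\<bar>z\<bar> \<le> y"
  shows "y * gker q (z / y) = z\<^sup>2 / 2 * (1 / (y - q * z) + 1 / (y + q * z))"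
proof (cases "y = 0")
  case False
  hence y: "0 < y" using assms by linarith
  note p = mult_pos_of_strict[OF assms y]
  have "y\<^sup>2 - q\<^sup>2 * z\<^sup>2 = (y - q * z) * (y + q * z)"
    by (simp add: algebra_simps power2_eq_square)
  hence "y * gker q (z / y) = z\<^sup>2 * y / ((y - q * z) * (y + q * z))"
    using y by (simp add: gker_def power_divide power2_eq_square field_simps)
  thus ?thesis
    using p by (simp add: field_simps)
qed (use assms in auto)

lemma comb_gker_eq:
  assumes "\<bar>q\<bar> < 1" "\<bar>a\<bar> \<le> 1" "\<bar>b\<bar> \<le> 1"
  shows "comb (gker q) a b =
    ((a + b)\<^sup>2 * (1 / (1 + a * b - q * (a + b)) + 1 / (1 + a * b + q * (a + b))) +
     (a - b)\<^sup>2 * (1 / (1 - a * b - q * (a - b)) + 1 / (1 - a * b + q * (a - b)))) / 4"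
  using add_le_one_plus_mult[OF assms(2,3)] assms(1)
  by (simp add: comb_def persp_gker)

lemma comb_commute:
  assumes "\<And>x. f (- x) = f x"
  shows "comb f a b = comb f b a"
proof -
  have "f ((b - a) / (1 - a * b)) = f ((a - b) / (1 - a * b))"
    using assms[of "(a - b) / (1 - a * b)"] by (simp add: minus_divide_left)
  thus ?thesis
    by (simp add: comb_def mult.commute add.commute)
qed

lemma comb_minus:
  assumes "\<And>x. f (- x) = f x"
  shows "comb f a (- b) = comb f a b" "comb f (- a) b = comb f a b"
proof -
  show *: "comb f a (- b) = comb f a b" for a b
    by (simp add: comb_def add.commute)
  show "comb f (- a) b = comb f a b"
    using *[of b a] comb_commute[of f a b, OF assms] comb_commute[of f "- a" b, OF assms] by simp
qed

text \<open>A message of modulus 1 is absorbing: each value of the sum has modulus 1 or weight 0.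
  This boundary case is treated apart because at \<open>\<bar>b\<bar> = 1\<close> the Moebius image
  of q has modulus 1 and leaves the family.\<close>

lemma comb_gker_abs_1:
  assumes "\<bar>b\<bar> = 1" "\<bar>a\<bar> \<le> 1"
  shows "comb (gker q) a b = gker q b"
proof -
  consider "a = 1" | "a = -1" | "-1 < a" "a < 1" using assms by linarith
  moreover have "b = 1 \<or> b = -1" using assms by linarith
  moreover have "gker q ((a - 1) / (1 - a)) = gker q 1" "gker q ((1 + a) / (1 + a)) = gker q 1"
      if "-1 < a" "a < 1"
  proof -
    have "(a - 1) / (1 - a) = -1" "(1 + a) / (1 + a) = 1"
      using that by (auto simp: field_simps)
    thus "gker q ((a - 1) / (1 - a)) = gker q 1" "gker q ((1 + a) / (1 + a)) = gker q 1"
      by simp_all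
  qed
  ultimately show ?thesis
    by (cases; elim disjE) (simp_all add: comb_def add.commute add_divide_distrib[symmetric] diff_divide_distrib distrib_right[symmetric])
qed

section \<open>Adding a fixed message: Moebius action on the kernels\<close>

lemma mobius_abs_less:
  fixes q b :: real
  assumes "\<bar>q\<bar> < 1" "\<bar>b\<bar> < 1"
  shows "\<bar>(q - b) / (1 - q * b)\<bar> < 1"
proof -
  have "0 < (1 - q) * (1 + b)" "0 < (1 + q) * (1 - b)" "0 < (1 - q) * (1 - b)" "0 < (1 + q) * (1 + b)"
    using assms by auto
  hence "\<bar>q - b\<bar> < 1 - q * b" by (auto simp: algebra_simps)
  moreover from this have "0 < 1 - q * b" by linarith
  ultimately show ?thesis by (simp add: abs_divide)
qed

text \<open>Equals (1 + b r)^2 / (1 - q b) for r = (q - b) / (1 - q b): the weight of the kernel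
  with parameter r once b is added. Its nonnegativity is what makes adding a message
  monotone.\<close>

definition mcoef :: "real \<Rightarrow> real \<Rightarrow> real" where
  "mcoef q b = (1 - b\<^sup>2)\<^sup>2 / (1 - q * b) ^ 3"

lemma mcoef_nonneg: "\<bar>q\<bar> < 1 \<Longrightarrow> \<bar>b\<bar> \<le> 1 \<Longrightarrow> 0 \<le> mcoef q b"
  using mult_sq_less_one(3)[of q b] by (simp add: mcoef_def abs_less_iff)

text \<open>The two denominators are D (1 - r a) and D (1 + r a) with D = 1 - q b, so adding b moves
  the pole parameter from q to r = (q - b) / D. Pairing a pole of the a + b term with the opposite
  pole of the a - b term makes the sum even in a.\<close>

lemma comb_expand_aux:
  fixes q a b :: real
  assumes "\<bar>q\<bar> < 1" "\<bar>a\<bar> \<le> 1" "\<bar>b\<bar> < 1"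
  shows "(a + b)\<^sup>2 / (1 + a * b - q * (a + b)) + (a - b)\<^sup>2 / (1 - a * b + q * (a - b)) =
    2 * (b\<^sup>2 / (1 - q * b) + mcoef q b * gker ((q - b) / (1 - q * b)) a)"
proof -
  define D where "D = 1 - q * b"
  define r where "r = (q - b) / D"
  have D: "D > 0" using mult_sq_less_one(3)[of q b] assms by (simp add: D_def abs_less_iff)
  have r: "\<bar>r\<bar> < 1" using mobius_abs_less[of q b] assms by (simp add: r_def D_def)
  hence ra: "\<bar>r * a\<bar> < 1" "1 - r\<^sup>2 * a\<^sup>2 > 0"
    using mult_sq_less_one[of r a] assms by auto
  have rD: "r * D = q - b" using D by (simp add: r_def)
  have e1: "1 + a * b - q * (a + b) = D * (1 - r * a)"
  proof -
    have "D * (1 - r * a) = D - (r * D) * a" by (simp add: algebra_simps)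
    thus ?thesis unfolding rD by (simp add: D_def algebra_simps)
  qed
  have e2: "1 - a * b + q * (a - b) = D * (1 + r * a)"
  proof -
    have "D * (1 + r * a) = D + (r * D) * a" by (simp add: algebra_simps)
    thus ?thesis unfolding rD by (simp add: D_def algebra_simps)
  qed
  have e3: "1 + b * r = (1 - b\<^sup>2) / D"
    using D by (simp add: r_def field_simps) (simp add: D_def algebra_simps power2_eq_square)
  have f: "(1 - r * a) * (1 + r * a) = 1 - r\<^sup>2 * a\<^sup>2"
    by (simp add: algebra_simps power2_eq_square)
  have n: "1 - r * a \<noteq> 0" "1 + r * a \<noteq> 0" using ra by auto
  have "(a + b)\<^sup>2 / (D * (1 - r * a)) + (a - b)\<^sup>2 / (D * (1 + r * a)) =
      ((a + b)\<^sup>2 * (1 + r * a) + (a - b)\<^sup>2 * (1 - r * a)) / (D * ((1 - r * a) * (1 + r * a)))"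
    using n D by (simp add: add_frac_eq) (simp add: divide_simps, simp add: algebra_simps)
  \<comment> \<open>The numerator is arranged so that a multiple of 1 - r^2 a^2 cancels against the
    denominator; this produces the constant b^2 / D, and the rest is a kernel in a.\<close>
  also have "(a + b)\<^sup>2 * (1 + r * a) + (a - b)\<^sup>2 * (1 - r * a) =
      2 * (b\<^sup>2 * (1 - r\<^sup>2 * a\<^sup>2) + a\<^sup>2 * (1 + b * r)\<^sup>2)"
    by (simp add: algebra_simps power2_eq_square)
  also have "(2 * (b\<^sup>2 * (1 - r\<^sup>2 * a\<^sup>2) + a\<^sup>2 * (1 + b * r)\<^sup>2)) / (D * ((1 - r * a) * (1 + r * a))) =
      2 * (b\<^sup>2 / D + (1 + b * r)\<^sup>2 / D * (a\<^sup>2 / (1 - r\<^sup>2 * a\<^sup>2)))"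
    unfolding f using D ra(2) by (simp add: field_simps)
  also have "(1 + b * r)\<^sup>2 / D = mcoef q b"
    unfolding e3 using D by (simp add: mcoef_def D_def power_divide power2_eq_square power3_eq_cube)
  finally show ?thesis
    unfolding e1 e2 by (simp add: gker_def r_def D_def)
qed

text \<open>Of the four partial fractions of \<open>comb\<close>, those whose denominators mirror
  each other under a -> -a are paired; the two pairs are the preceding identity at b and at -b.
  Their constants recombine to \<open>gker q b\<close>.\<close>

lemma comb_expand:
  fixes q a b :: real
  assumes "\<bar>q\<bar> < 1" "\<bar>a\<bar> \<le> 1" "\<bar>b\<bar> < 1"
  shows "comb (gker q) a b = gker q b +
    (mcoef q b * gker ((q - b) / (1 - q * b)) a + mcoef q (- b) * gker ((q + b) / (1 + q * b)) a) / 2"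
proof -
  have qb: "\<bar>q * b\<bar> < 1" "q\<^sup>2 * b\<^sup>2 < 1" using mult_sq_less_one[of q b] assms by auto
  have n: "1 - q * b \<noteq> 0" "1 + q * b \<noteq> 0" using qb by auto
  have "gker q b = b\<^sup>2 / ((1 - q * b) * (1 + q * b))"
    by (simp add: gker_def algebra_simps power2_eq_square)
  hence g: "gker q b = (b\<^sup>2 / (1 - q * b) + b\<^sup>2 / (1 + q * b)) / 2"
  proof -
    have *: "b\<^sup>2 / (D * E) = (b\<^sup>2 / D + b\<^sup>2 / E) / 2" if "D \<noteq> 0" "E \<noteq> 0" "D + E = 2" for D E :: real
    proof -
      have "b\<^sup>2 / D + b\<^sup>2 / E = b\<^sup>2 * (D + E) / (D * E)"
        using that(1,2) by (simp add: field_simps)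
      thus ?thesis using that(3) by simp
    qed
    show ?thesis
      unfolding \<open>gker q b = _\<close> by (rule *) (use n in auto)
  qed
  have 1: "4 * comb (gker q) a b =
     ((a + b)\<^sup>2 / (1 + a * b - q * (a + b)) + (a - b)\<^sup>2 / (1 - a * b + q * (a - b))) +
     ((a + - b)\<^sup>2 / (1 + a * (- b) - q * (a + - b)) + (a - - b)\<^sup>2 / (1 - a * (- b) + q * (a - - b)))"
  proof -
    have *: "4 * u = (x / d1 + y / d4) + (y / d3 + x / d2)"
      if "u = (x * (1 / d1 + 1 / d2) + y * (1 / d3 + 1 / d4)) / 4" for u x y d1 d2 d3 d4 :: real
      using that by (simp add: distrib_left)
    show ?thesis using *[OF comb_gker_eq[of q a b]] assms by simp
  qed
  have 2: "u = G + (M1 + M2) / 2" if "4 * u = X + Y" "X = 2 * (B1 + M1)" "Y = 2 * (B2 + M2)" "G = (B1 + B2) / 2"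
    for u G M1 M2 X Y B1 B2 :: real
    using that by (simp add: field_simps)
  show ?thesis
    by (rule 2[OF 1 comb_expand_aux[OF assms] trans[OF comb_expand_aux]]) (use assms g in auto)
qed

section \<open>The stringy tree inequality for the kernels\<close>

lemma stringy_aux_mono:
  fixes q x y x' y' :: real
  assumes "\<bar>q\<bar> < 1" "0 \<le> x" "x \<le> x'" "x' \<le> 1" "0 \<le> y" "y \<le> y'" "y' \<le> 1"
  shows "x * y * (1 / ((1 - q * x) * (1 - q * y)) + 1 / ((1 + q * x) * (1 + q * y))) \<le>
    x' * y' * (1 / ((1 - q * x') * (1 - q * y')) + 1 / ((1 + q * x') * (1 + q * y')))"
proof -
  \<comment> \<open>Over a common denominator the terms odd in q cancel; the numerator that remains
    increases in x and y and the denominator decreases, whatever the sign of q.\<close>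
  have eq: "x * y * (1 / ((1 - q * x) * (1 - q * y)) + 1 / ((1 + q * x) * (1 + q * y))) =
      2 * (x * y) * (1 + q\<^sup>2 * (x * y)) / ((1 - q\<^sup>2 * x\<^sup>2) * (1 - q\<^sup>2 * y\<^sup>2))"
    if xy: "0 \<le> x" "x \<le> 1" "0 \<le> y" "y \<le> 1" for x y
  proof -
    have n: "1 - q * x \<noteq> 0" "1 + q * x \<noteq> 0" "1 - q * y \<noteq> 0" "1 + q * y \<noteq> 0"
      using mult_sq_less_one(3)[of q x] mult_sq_less_one(3)[of q y] xy assms(1) by auto
    have f: "1 - q\<^sup>2 * x\<^sup>2 = (1 - q * x) * (1 + q * x)" "1 - q\<^sup>2 * y\<^sup>2 = (1 - q * y) * (1 + q * y)"
      by (simp_all add: algebra_simps power2_eq_square)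
    have "1 / (A * C) + 1 / (B * D) = (A * C + B * D) / (A * B * (C * D))"
      if "A \<noteq> 0" "B \<noteq> 0" "C \<noteq> 0" "D \<noteq> 0" for A B C D :: real
      using that by (simp add: field_simps)
    note this[OF n]
    moreover have "(1 - q * x) * (1 - q * y) + (1 + q * x) * (1 + q * y) = 2 * (1 + q\<^sup>2 * (x * y))"
      by (simp add: algebra_simps power2_eq_square)
    ultimately show ?thesis
      unfolding f by (simp add: mult_ac)
  qed
  have m: "x * y \<le> x' * y'" "0 \<le> x * y" using assms by (auto intro!: mult_mono)
  have s: "x\<^sup>2 \<le> x'\<^sup>2" "y\<^sup>2 \<le> y'\<^sup>2" using assms by (auto intro!: power_mono)
  have l: "q\<^sup>2 * x'\<^sup>2 < 1" "q\<^sup>2 * y'\<^sup>2 < 1"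
    using mult_sq_less_one(1)[of q x'] mult_sq_less_one(1)[of q y'] assms by auto
  have "2 * (x * y) * (1 + q\<^sup>2 * (x * y)) / ((1 - q\<^sup>2 * x\<^sup>2) * (1 - q\<^sup>2 * y\<^sup>2)) \<le>
      2 * (x' * y') * (1 + q\<^sup>2 * (x' * y')) / ((1 - q\<^sup>2 * x'\<^sup>2) * (1 - q\<^sup>2 * y'\<^sup>2))"
  proof (rule frac_le)
    show "2 * (x * y) * (1 + q\<^sup>2 * (x * y)) \<le> 2 * (x' * y') * (1 + q\<^sup>2 * (x' * y'))"
      using m by (intro mult_mono[of "2 * (x * y)"] add_left_mono mult_left_mono[of "x * y"]) auto
    show "(1 - q\<^sup>2 * x'\<^sup>2) * (1 - q\<^sup>2 * y'\<^sup>2) \<le> (1 - q\<^sup>2 * x\<^sup>2) * (1 - q\<^sup>2 * y\<^sup>2)"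
      using s l mult_left_mono[OF s(1), of "q\<^sup>2"] mult_left_mono[OF s(2), of "q\<^sup>2"]
      by (intro mult_mono diff_left_mono) auto
    show "0 \<le> 2 * (x' * y') * (1 + q\<^sup>2 * (x' * y'))"
      using m by simp
    show "0 < (1 - q\<^sup>2 * x'\<^sup>2) * (1 - q\<^sup>2 * y'\<^sup>2)"
      using l by simp
  qed
  thus ?thesis
    using assms by (subst (1 2) eq) auto
qed

text \<open>Written in the ratios z / y and z / y', the effect of changing y at fixed z becomes
  comparable, through \<open>stringy_aux_mono\<close>, with the effect of a change of the same size
  at another z.\<close>

lemma inv_diff_scaled:
  fixes y y' z q :: real
  assumes "\<bar>q\<bar> < 1" "\<bar>z\<bar> \<le> y" "\<bar>z\<bar> \<le> y'" "0 < y" "0 < y'"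
  shows "z\<^sup>2 * (1 / (y - q * z) + 1 / (y + q * z)) - z\<^sup>2 * (1 / (y' - q * z) + 1 / (y' + q * z)) =
    (y' - y) * (z / y * (z / y') * (1 / ((1 - q * (z / y)) * (1 - q * (z / y'))) +
       1 / ((1 + q * (z / y)) * (1 + q * (z / y')))))"
proof -
  have *: "0 < y - q * z" "0 < y + q * z" "0 < y' - q * z" "0 < y' + q * z"
    using mult_pos_of_strict[OF assms(1,2,4)] mult_pos_of_strict[OF assms(1,3,5)] by auto
  have r: "1 - q * (z / y) = (y - q * z) / y" "1 + q * (z / y) = (y + q * z) / y"
    "1 - q * (z / y') = (y' - q * z) / y'" "1 + q * (z / y') = (y' + q * z) / y'"
    using assms by (simp_all add: field_simps)
  have "(1 / (y - q * z) + 1 / (y + q * z)) - (1 / (y' - q * z) + 1 / (y' + q * z)) =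
    (y' - y) * (1 / ((y - q * z) * (y' - q * z)) + 1 / ((y + q * z) * (y' + q * z)))"
  proof -
    have "1 / (y - q * z) - 1 / (y' - q * z) = (y' - y) * (1 / ((y - q * z) * (y' - q * z)))"
      using * by (simp add: field_simps)
    moreover have "1 / (y + q * z) - 1 / (y' + q * z) = (y' - y) * (1 / ((y + q * z) * (y' + q * z)))"
      using * by (simp add: field_simps)
    ultimately show ?thesis
      by (simp add: distrib_left)
  qed
  hence "z\<^sup>2 * (1 / (y - q * z) + 1 / (y + q * z)) - z\<^sup>2 * (1 / (y' - q * z) + 1 / (y' + q * z)) =
    (y' - y) * (z\<^sup>2 * (1 / ((y - q * z) * (y' - q * z)) + 1 / ((y + q * z) * (y' + q * z))))"
    by (simp add: right_diff_distrib[symmetric])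
  also have "z\<^sup>2 * (1 / ((y - q * z) * (y' - q * z)) + 1 / ((y + q * z) * (y' + q * z))) =
     z / y * (z / y') * (1 / ((1 - q * (z / y)) * (1 - q * (z / y'))) +
       1 / ((1 + q * (z / y)) * (1 + q * (z / y'))))"
    unfolding r using * assms(4,5) by (simp add: power2_eq_square distrib_left)
  finally show ?thesis .
qed

text \<open>Both sides involve the same y = t (a + b) and z = t (a - b); degrading after the
  addition weights them by 1 + p and 1 - p with p = a b, degrading before it by 1 + r and 1 - r with
  r = t^2 p. Passing from p to r raises the y term and lowers the z term, both with the factor p -
  r, and the y term wins because y / (1 + x) dominates z / (1 - x) for all x from 0 to p.\<close>

lemma stringy_ordered:
  fixes q t a b :: real
  assumes q: "\<bar>q\<bar> < 1" and t: "0 \<le> t" "t \<le> 1" and ab: "0 \<le> b" "b \<le> a" "a \<le> 1"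
  shows "comb (\<lambda>x. gker q (t * x)) a b \<le> comb (gker q) (t * a) (t * b)"
proof -
  define p where "p = a * b"
  define r where "r = t\<^sup>2 * (a * b)"
  define y where "y = t * (a + b)"
  define z where "z = t * (a - b)"
  have t2: "t\<^sup>2 \<le> 1" using t by (simp add: power_le_one)
  have rp: "0 \<le> r" "r \<le> p" using t t2 ab by (auto simp: r_def p_def mult_left_le_one_le)
  have ab1: "a + b \<le> 1 + a * b" "a - b \<le> 1 - a * b"
    using add_le_one_plus_mult[of a b] ab by auto
  have y0: "0 \<le> y" and z0: "0 \<le> z" using t ab by (auto simp: y_def z_def)
  have "y \<le> a + b" "z \<le> a - b" using t ab by (auto simp: y_def z_def mult_left_le_one_le)
  hence yp: "y \<le> 1 + p" and zp: "z \<le> 1 - p" using ab1 by (auto simp: p_def)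
  have "\<bar>t * a\<bar> \<le> 1" "\<bar>t * b\<bar> \<le> 1" using t ab by (auto simp: abs_mult intro!: mult_le_one)
  hence yr: "y \<le> 1 + r" and zr: "z \<le> 1 - r"
    using add_le_one_plus_mult[of "t * a" "t * b"]
    by (auto simp: y_def z_def r_def algebra_simps power2_eq_square)
  define \<Phi> where "\<Phi> x z = z\<^sup>2 * (1 / (x - q * z) + 1 / (x + q * z))" for x z
  have L: "comb (\<lambda>x. gker q (t * x)) a b = (\<Phi> (1 + p) y + \<Phi> (1 - p) z) / 4"
  proof -
    have "comb (\<lambda>x. gker q (t * x)) a b =
        ((1 + p) * gker q (y / (1 + p)) + (1 - p) * gker q (z / (1 - p))) / 2"
      by (simp only: comb_def y_def z_def p_def times_divide_eq_right)
    moreover have "(1 + p) * gker q (y / (1 + p)) = \<Phi> (1 + p) y / 2" "(1 - p) * gker q (z / (1 - p)) = \<Phi> (1 - p) z / 2"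
      using persp_gker[of q y "1 + p"] persp_gker[of q z "1 - p"] q yp zp y0 z0
      by (simp_all add: \<Phi>_def)
    ultimately show ?thesis by (simp add: add_divide_distrib)
  qed
  have R: "comb (gker q) (t * a) (t * b) = (\<Phi> (1 + r) y + \<Phi> (1 - r) z) / 4"
  proof -
    have "t * a + t * b = y" "t * a - t * b = z" "t * a * (t * b) = r"
      by (simp_all add: y_def z_def r_def algebra_simps power2_eq_square)
    hence "comb (gker q) (t * a) (t * b) =
        ((1 + r) * gker q (y / (1 + r)) + (1 - r) * gker q (z / (1 - r))) / 2"
      by (simp add: comb_def)
    moreover have "(1 + r) * gker q (y / (1 + r)) = \<Phi> (1 + r) y / 2" "(1 - r) * gker q (z / (1 - r)) = \<Phi> (1 - r) z / 2"
      using persp_gker[of q y "1 + r"] persp_gker[of q z "1 - r"] q yr zr y0 z0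
      by (simp_all add: \<Phi>_def)
    ultimately show ?thesis by (simp add: add_divide_distrib)
  qed
  have "\<Phi> (1 - p) z - \<Phi> (1 - r) z \<le> \<Phi> (1 + r) y - \<Phi> (1 + p) y"
  proof (cases "p < 1")
    case True
    define u where "u = y / (1 + r)"
    define u' where "u' = y / (1 + p)"
    define v where "v = z / (1 - r)"
    define v' where "v' = z / (1 - p)"
    \<comment> \<open>Clearing denominators leaves x a \<le> b, and x a is at most p = a b \<le>
      b.\<close>
    have *: "z / (1 - x) \<le> y / (1 + x)" if "0 \<le> x" "x \<le> p" for x
    proof -
      have "x * a \<le> p * 1" using that ab by (intro mult_mono) auto
      also have "p \<le> b" using ab by (simp add: p_def mult_left_le_one_le)
      finally have "0 \<le> 2 * t * (b - x * a)" using t by simp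
      also have "\<dots> = y * (1 - x) - z * (1 + x)" by (simp add: y_def z_def algebra_simps)
      finally show ?thesis
        using that True by (simp add: divide_simps)
    qed
    have "v \<le> u" "v' \<le> u'" using *[of r] *[of p] rp by (auto simp: u_def u'_def v_def v'_def)
    moreover have "0 \<le> v" "0 \<le> v'" "u \<le> 1" "u' \<le> 1"
      using rp True yr yp z0 by (auto simp: u_def u'_def v_def v'_def)
    ultimately have "v * v' * (1 / ((1 - q * v) * (1 - q * v')) + 1 / ((1 + q * v) * (1 + q * v'))) \<le>
       u * u' * (1 / ((1 - q * u) * (1 - q * u')) + 1 / ((1 + q * u) * (1 + q * u')))"
      using q by (intro stringy_aux_mono) auto
    hence "(p - r) * (v * v' * (1 / ((1 - q * v) * (1 - q * v')) + 1 / ((1 + q * v) * (1 + q * v')))) \<le>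
       (p - r) * (u * u' * (1 / ((1 - q * u) * (1 - q * u')) + 1 / ((1 + q * u) * (1 + q * u'))))"
      using rp by (intro mult_left_mono) auto
    moreover have "\<Phi> (1 + r) y - \<Phi> (1 + p) y =
        (p - r) * (u * u' * (1 / ((1 - q * u) * (1 - q * u')) + 1 / ((1 + q * u) * (1 + q * u'))))"
      using inv_diff_scaled[of q y "1 + r" "1 + p"] q yr yp y0 rp
      by (simp add: \<Phi>_def u_def u'_def)
    moreover have "\<Phi> (1 - r) z - \<Phi> (1 - p) z =
        - ((p - r) * (v * v' * (1 / ((1 - q * v) * (1 - q * v')) + 1 / ((1 + q * v) * (1 + q * v')))))"
    proof -
      have "1 - p - (1 - r) = - (p - r)" by simp
      thus ?thesis
        unfolding \<Phi>_def v_def v'_def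
        by (subst inv_diff_scaled) (use q zr zp z0 rp True in \<open>auto simp only: mult_minus_left\<close>)
    qed
    ultimately show ?thesis by linarith
  next
    \<comment> \<open>Here a = b = 1 and z = 0, so z / (1 - p) would divide by 0; the z term is
      absent and monotonicity of the y term is enough.\<close>
    case False
    have "z = 0" using zp z0 False by linarith
    moreover have "\<Phi> (1 + p) y \<le> \<Phi> (1 + r) y"
    proof -
      have "0 < 1 + r - q * y" "0 < 1 + r + q * y"
        using mult_pos_of_strict[of q y "1 + r"] q yr y0 rp by auto
      hence "1 / (1 + p - q * y) \<le> 1 / (1 + r - q * y)" "1 / (1 + p + q * y) \<le> 1 / (1 + r + q * y)"
        using rp by (intro frac_le; simp)+
      thus ?thesis
        unfolding \<Phi>_def by (intro mult_left_mono add_mono) auto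
    qed
    ultimately show ?thesis by (simp add: \<Phi>_def)
  qed
  thus ?thesis
    unfolding L R by simp
qed

text \<open>The stringy tree inequality of Evans, Kenyon, Peres and Schulman for the test functions \<open>gker q\<close>.\<close>

lemma stringy:
  fixes q t a b :: real
  assumes q: "\<bar>q\<bar> < 1" and t: "0 \<le> t" "t \<le> 1" and ab: "\<bar>a\<bar> \<le> 1" "\<bar>b\<bar> \<le> 1"
  shows "comb (\<lambda>x. gker q (t * x)) a b \<le> comb (gker q) (t * a) (t * b)"
proof -
  have nonneg: "comb (\<lambda>x. gker q (t * x)) a b \<le> comb (gker q) (t * a) (t * b)"
    if "0 \<le> a" "a \<le> 1" "0 \<le> b" "b \<le> 1" for a b
  proof (cases "b \<le> a")
    case False
    have "comb (\<lambda>x. gker q (t * x)) b a \<le> comb (gker q) (t * b) (t * a)"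
      using False that q t by (intro stringy_ordered) auto
    thus ?thesis
      using comb_commute[of "\<lambda>x. gker q (t * x)" a b] comb_commute[of "gker q" "t * a" "t * b"] by simp
  qed (use that q t in \<open>auto intro: stringy_ordered\<close>)
  have "comb f \<bar>a\<bar> \<bar>b\<bar> = comb f a b" if "\<And>x. f (- x) = f x" for f and a b
    using comb_minus[of f, OF that] by (auto simp: abs_if)
  from this[of "\<lambda>x. gker q (t * x)" a b] this[of "gker q" "t * a" "t * b"] nonneg[of "\<bar>a\<bar>" "\<bar>b\<bar>"]
  show ?thesis
    using ab t by (simp add: abs_mult)
qed

text \<open>The expansion is applied with s in the role of the variable and w fixed, which needs
  \<open>\<bar>w\<bar> < 1\<close>. For every parameter the kernel grows by at least (1 - t^2) s^2
  from t s to s, since its denominators are at most 1; the weights are at least (1 - t^2)^2 / 8,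
  where 8 bounds (1 - q w)^3. Neither bound involves q.\<close>

lemma comb_gker_gain:
  fixes q t w s :: real
  assumes q: "\<bar>q\<bar> < 1" and t: "0 \<le> t" "t < 1" and w: "\<bar>w\<bar> \<le> t" and s: "\<bar>s\<bar> \<le> 1"
  shows "comb (gker q) w (t * s) + (1 - t\<^sup>2) ^ 3 / 8 * s\<^sup>2 \<le> comb (gker q) w s"
proof -
  have w1: "\<bar>w\<bar> < 1" using w t by linarith
  have ts: "\<bar>t * s\<bar> \<le> 1" using t s by (simp add: abs_mult mult_le_one)
  have t2: "0 < 1 - t\<^sup>2" using t by (simp add: abs_square_less_1)
  have g: "(1 - t\<^sup>2) * s\<^sup>2 \<le> gker r s - gker r (t * s)" if "\<bar>r\<bar> < 1" for r
  proof -
    have "0 < (1 - r\<^sup>2 * s\<^sup>2) * (1 - r\<^sup>2 * (t * s)\<^sup>2)" "(1 - r\<^sup>2 * s\<^sup>2) * (1 - r\<^sup>2 * (t * s)\<^sup>2) \<le> 1"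
      using mult_sq_less_one(1)[OF that s] mult_sq_less_one(1)[OF that ts]
      by (auto intro!: mult_le_one)
    hence "(s\<^sup>2 - (t * s)\<^sup>2) / 1 \<le> (s\<^sup>2 - (t * s)\<^sup>2) / ((1 - r\<^sup>2 * s\<^sup>2) * (1 - r\<^sup>2 * (t * s)\<^sup>2))"
      using t2 by (intro divide_left_mono) (auto simp: power_mult_distrib mult_left_le_one_le)
    thus ?thesis
      using gker_diff[OF that s ts] by (simp add: power_mult_distrib algebra_simps)
  qed
  have c: "(1 - t\<^sup>2)\<^sup>2 / 8 \<le> mcoef q x" if "\<bar>x\<bar> \<le> t" for x
  proof -
    have "\<bar>q * x\<bar> < 1" using mult_sq_less_one(3)[of q x] q that t by auto
    hence l: "0 < 1 - q * x" "1 - q * x \<le> 2" by auto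
    hence "(1 - q * x) ^ 3 \<le> 2 ^ 3" by (intro power_mono) auto
    moreover have "x\<^sup>2 \<le> t\<^sup>2" using that t by (simp add: abs_le_square_iff[symmetric])
    ultimately show ?thesis
      unfolding mcoef_def using t2 l by (intro frac_le power_mono) auto
  qed
  have m: "(1 - t\<^sup>2)\<^sup>2 / 8 * ((1 - t\<^sup>2) * s\<^sup>2) \<le> mcoef q x * (gker r s - gker r (t * s))"
    if "\<bar>x\<bar> \<le> t" "\<bar>r\<bar> < 1" for x r
    using c[OF that(1)] g[OF that(2)] t2 that t q
    by (intro mult_mono mcoef_nonneg) auto
  have "\<bar>(q - w) / (1 - q * w)\<bar> < 1" "\<bar>(q + w) / (1 + q * w)\<bar> < 1"
    using mobius_abs_less[of q w] mobius_abs_less[of q "- w"] q w1 by auto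
  note mm = m[OF w this(1)] m[of "- w", OF _ this(2), unfolded abs_minus_cancel, OF w]
  have "comb (gker q) w s - comb (gker q) w (t * s) = comb (gker q) s w - comb (gker q) (t * s) w"
    using comb_commute[of "gker q"] by simp
  also have "\<dots> = (mcoef q w * (gker ((q - w) / (1 - q * w)) s - gker ((q - w) / (1 - q * w)) (t * s)) +
      mcoef q (- w) * (gker ((q + w) / (1 + q * w)) s - gker ((q + w) / (1 + q * w)) (t * s))) / 2"
    using comb_expand[OF q s w1] comb_expand[OF q ts w1]
    by (simp add: right_diff_distrib add_divide_distrib diff_divide_distrib)
  also have "\<dots> \<ge> (1 - t\<^sup>2)\<^sup>2 / 8 * ((1 - t\<^sup>2) * s\<^sup>2)"
  proof -
    have "c \<le> (x + y) / 2" if "c \<le> x" "c \<le> y" for c x y :: real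
      using that by (simp add: field_simps)
    from this[OF mm] show ?thesis .
  qed
  also have "(1 - t\<^sup>2)\<^sup>2 / 8 * ((1 - t\<^sup>2) * s\<^sup>2) = (1 - t\<^sup>2) ^ 3 / 8 * s\<^sup>2"
    by (simp add: power2_eq_square power3_eq_cube)
  finally show ?thesis by simp
qed

section \<open>Symmetric distributions\<close>

text \<open>Posterior mean of a uniform sign with log-likelihood ratio r. Including both infinite
  points makes it a bijection onto [-1, 1].\<close>

definition tau :: "ereal \<Rightarrow> real" where
  "tau r = (case r of ereal x \<Rightarrow> tanh (x / 2) | PInfty \<Rightarrow> 1 | MInfty \<Rightarrow> -1)"

text \<open>Inverse of \<open>tau\<close> on [-1, 1]; the constant continuation outside keeps it
  monotone and continuous on the whole line.\<close>

definition llr :: "real \<Rightarrow> ereal" where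
  "llr x = (if 1 \<le> x then \<infinity> else if x \<le> -1 then -\<infinity> else ereal (2 * artanh x))"

lemma tau_simps [simp]:
  "tau (ereal x) = tanh (x / 2)" "tau \<infinity> = 1" "tau (-\<infinity>) = -1" "tau 0 = 0"
  by (simp_all add: tau_def zero_ereal_def)

lemma tau_minus [simp]: "tau (- r) = - tau r"
  by (cases r) simp_all

lemma abs_tau_le: "\<bar>tau r\<bar> \<le> 1"
  using tanh_real_bounds by (cases r) (auto simp: abs_le_iff less_imp_le minus_le_iff)

lemma tau_bounds: "-1 \<le> tau r" "tau r \<le> 1"
  using abs_tau_le[of r] by auto

lemma tau_lt_1: "r \<noteq> \<infinity> \<Longrightarrow> tau r < 1"
  by (cases r) (auto simp: tanh_real_lt_1)

lemma tanh_artanh_real: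
  assumes "\<bar>x\<bar> < 1"
  shows "tanh (artanh x) = (x::real)"
proof -
  have p: "0 < (1 + x) / (1 - x)" using assms by auto
  have "tanh (ln (sqrt ((1 + x) / (1 - x)))) = x"
    using p assms by (subst tanh_ln_real) (auto simp: field_simps)
  moreover have "ln (sqrt ((1 + x) / (1 - x))) = artanh x"
    using p by (simp add: ln_sqrt artanh_def)
  ultimately show ?thesis by simp
qed

lemma tau_llr [simp]: "\<bar>x\<bar> \<le> 1 \<Longrightarrow> tau (llr x) = x"
  by (auto simp: llr_def tanh_artanh_real)

lemma llr_tau [simp]: "llr (tau r) = r"
  using tanh_real_bounds[of "real_of_ereal r / 2"] by (cases r) (auto simp: llr_def artanh_tanh_real)

lemma llr_minus [simp]: "\<bar>x\<bar> \<le> 1 \<Longrightarrow> llr (- x) = - llr x"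
  using llr_tau[of "- llr x"] by simp

lemma measurable_tau [measurable]: "tau \<in> borel_measurable borel"
proof -
  have [measurable]: "(tanh :: real \<Rightarrow> real) \<in> borel_measurable borel"
    by (intro borel_measurable_continuous_onI continuous_intros) auto
  have *: "tau = (\<lambda>r. if r = \<infinity> then 1 else if r = -\<infinity> then -1 else tanh (real_of_ereal r / 2))"
  proof
    show "tau r = (if r = \<infinity> then 1 else if r = -\<infinity> then -1 else tanh (real_of_ereal r / 2))" for r
      by (cases r) simp_all
  qed
  show ?thesis unfolding * by measurable
qed

lemma measurable_llr [measurable]: "llr \<in> borel_measurable borel"
proof -
  have [measurable]: "(artanh :: real \<Rightarrow> real) \<in> borel_measurable borel"
    unfolding artanh_def[abs_def] by measurable
  show ?thesis
    unfolding llr_def[abs_def] by measurable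
qed

lemma tau_add:
  assumes "\<not> (r = \<infinity> \<and> s = -\<infinity>)" "\<not> (r = -\<infinity> \<and> s = \<infinity>)"
  shows "tau (r + s) = (tau r + tau s) / (1 + tau r * tau s)"
proof (cases r; cases s)
  fix x y assume "r = ereal x" "s = ereal y"
  thus ?thesis by (simp add: add_divide_distrib tanh_add)
next
  have *: "1 + tanh (x / 2) \<noteq> 0" "1 - tanh (x / 2) \<noteq> 0" for x :: real
    using tanh_real_lt_1[of "x / 2"] tanh_real_gt_neg1[of "x / 2"] by auto
  have m: "(tanh (x / 2) - 1) / (1 - tanh (x / 2)) = -1" for x :: real
    using *[of x] by (simp add: field_simps)
  { fix x assume "r = ereal x" "s = \<infinity>" thus ?thesis using *[of x] by (simp add: add.commute) }
  { fix x assume "r = ereal x" "s = -\<infinity>" thus ?thesis using m[of x] by simp }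
  { fix x assume "r = \<infinity>" "s = ereal x" thus ?thesis using *[of x] by simp }
  { fix x assume "r = -\<infinity>" "s = ereal x" thus ?thesis using m[of x] by simp }
qed (use assms in auto)

text \<open>\<open>F_ext \<delta>\<close> is the effect on log-likelihood ratios of flipping the
  sign with probability \<delta>, and such a flip multiplies the posterior mean by 1 - 2 \<delta>.
  The limits at +infinity fit this rule also for \<delta> = 0 and \<delta> = 1.\<close>

lemma tau_F_ext:
  assumes "0 \<le> \<delta>" "\<delta> \<le> 1" "r \<noteq> -\<infinity>"
  shows "tau (F_ext \<delta> r) = (1 - 2 * \<delta>) * tau r"
proof (cases r)
  case (real x)
  define N where "N = (1 - \<delta>) * exp x + \<delta>"
  define D where "D = \<delta> * exp x + 1 - \<delta>"
  have tanh_ln: "tanh (ln z / 2) = (z - 1) / (z + 1)" if "z > 0" for z :: real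
  proof -
    have "ln z / 2 = ln (sqrt z)" using that by (simp add: ln_sqrt)
    thus ?thesis using that by (simp add: tanh_ln_real)
  qed
  have "N > 0"
    using assms by (cases "\<delta> = 1") (auto simp: N_def intro!: add_pos_nonneg mult_pos_pos)
  moreover have "D > 0"
    using assms by (cases "\<delta> = 1") (auto simp: D_def add_diff_eq[symmetric] intro!: add_nonneg_pos)
  moreover have "N / D - 1 = (N - D) / D" "N / D + 1 = (N + D) / D"
    using \<open>D > 0\<close> by (simp_all add: field_simps)
  ultimately have "tau (F_ext \<delta> r) = (N - D) / (N + D)"
    unfolding real F_ext_def F_real_def
    by (simp add: tanh_ln flip: N_def D_def)
  also have "N - D = (1 - 2 * \<delta>) * (exp x - 1)"
    by (simp add: N_def D_def algebra_simps)
  also have "N + D = exp x + 1"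
    by (simp add: N_def D_def algebra_simps)
  also have "(1 - 2 * \<delta>) * (exp x - 1) / (exp x + 1) = (1 - 2 * \<delta>) * tau r"
    using tanh_ln[of "exp x"] by (simp add: real)
  finally show ?thesis .
next
  case PInf
  show ?thesis
  proof (cases "0 < \<delta> \<and> \<delta> < 1")
    case True
    hence "tau (F_ext \<delta> r) = tanh (ln (sqrt ((1 - \<delta>) / \<delta>)))"
      by (simp add: PInf F_ext_PInfty ln_sqrt)
    also have "\<dots> = 1 - 2 * \<delta>"
      using True by (subst tanh_ln_real) (auto simp: field_simps)
    finally show ?thesis by (simp add: PInf)
  next
    case False
    hence "\<delta> = 0 \<or> \<delta> = 1" using assms by auto
    thus ?thesis by (auto simp: PInf F_ext_PInfty)
  qed
qed (use assms in auto)

lemma integrable_bounded: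
  fixes f :: "'a \<Rightarrow> real"
  assumes "prob_space M" "f \<in> borel_measurable M" "\<And>x. \<bar>f x\<bar> \<le> K"
  shows "integrable M f"
proof -
  interpret prob_space M by fact
  show ?thesis using assms(2,3) by (intro integrable_const_bound[of _ K]) auto
qed

lemma symmetric_distD:
  assumes "symmetric_dist \<mu>"
  shows "prob_space \<mu>" "sets \<mu> = sets borel" "AE r in \<mu>. r \<noteq> -\<infinity>"
proof -
  show *: "prob_space \<mu>" "sets \<mu> = sets borel"
    using assms by (auto simp: symmetric_dist_def llr_dist_def)
  show "AE r in \<mu>. r \<noteq> -\<infinity>"
    using assms by (intro AE_I[of _ _ "{-\<infinity>}"]) (auto simp: symmetric_dist_def llr_dist_def)
qed

text \<open>
  In terms of \<open>tanh (r / 2)\<close>, symmetry of a distribution says that the measure \<open>(1 - tanh (r / 2)) d\<mu>(r)\<close>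
  is invariant under reflection.
\<close>

lemma symmetric_dist_odd:
  assumes sym: "symmetric_dist \<mu>" and u [measurable]: "u \<in> borel_measurable borel"
    and odd: "\<And>x. u (- x) = - u x" and bd: "\<And>x. \<bar>x\<bar> \<le> 1 \<Longrightarrow> \<bar>u x\<bar> \<le> K"
  shows "(\<integral>r. (1 - tau r) * u (tau r) \<partial>\<mu>) = 0"
proof -
  note s = symmetric_distD[OF sym]
  note [measurable_cong] = s(2)
  interpret prob_space \<mu> by fact
  define F where "F = {-\<infinity><..<\<infinity>::ereal}"
  have [measurable]: "F \<in> sets borel" by (simp add: F_def)
  have Fm: "- r \<in> F \<longleftrightarrow> r \<in> F" for r
    by (cases r) (auto simp: F_def)
  \<comment> \<open>Symmetry amounts to the equality of these two measures: the finite part of \<mu>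
    and the reflection of its exponentially tilted finite part.\<close>
  define N where "N = density \<mu> (\<lambda>r. ennreal (indicator F r))"
  define N' where "N' = distr (density \<mu> (\<lambda>r. ennreal (exp (- real_of_ereal r) * indicator F r))) borel uminus"
  have "N = N'"
  proof (rule measure_eqI)
    show "sets N = sets N'" by (simp add: N_def N'_def s)
    fix A assume "A \<in> sets N"
    hence A [measurable]: "A \<in> sets borel" by (simp add: N_def s)
    have "emeasure N A = emeasure \<mu> (A \<inter> F)"
    proof -
      have "emeasure N A = (\<integral>\<^sup>+r. ennreal (indicator F r) * indicator A r \<partial>\<mu>)"
        unfolding N_def by (subst emeasure_density) (auto simp: s)
      also have "\<dots> = (\<integral>\<^sup>+r. indicator (A \<inter> F) r \<partial>\<mu>)"
        by (intro nn_integral_cong) (auto split: split_indicator)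
      finally have "emeasure N A = (\<integral>\<^sup>+r. indicator (A \<inter> F) r \<partial>\<mu>)" .
      thus ?thesis by (simp add: s)
    qed
    also have "\<dots> = (\<integral>\<^sup>+ r. ennreal (exp (- real_of_ereal r)) * indicator (A \<inter> F) (- r) \<partial>\<mu>)"
      using sym A by (auto simp: symmetric_dist_def F_def)
    also have "\<dots> = (\<integral>\<^sup>+ r. ennreal (exp (- real_of_ereal r) * indicator F r) * indicator (uminus -` A) r \<partial>\<mu>)"
      using Fm by (intro nn_integral_cong) (auto simp: indicator_def split: if_splits)
    also have "\<dots> = emeasure N' A"
    proof -
      have "uminus -` A \<in> sets \<mu>"
        using measurable_sets[OF _ A, of "uminus :: ereal \<Rightarrow> ereal" borel] by (simp add: s)
      moreover have "space \<mu> = UNIV" using s(2) by (metis sets_eq_imp_space_eq space_borel)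
      ultimately show ?thesis
        unfolding N'_def by (subst emeasure_distr) (auto simp: emeasure_density)
    qed
    finally show "emeasure N A = emeasure N' A" .
  qed
  define g where "g r = (1 - tau r) * u (tau r)" for r
  have [measurable]: "g \<in> borel_measurable borel" unfolding g_def by measurable
  \<comment> \<open>Restricting to finite r loses nothing: \<open>1 - tau r\<close> vanishes at
    +infinity, and -infinity is a null set.\<close>
  have "(\<integral>r. g r \<partial>\<mu>) = (\<integral>r. indicator F r *\<^sub>R g r \<partial>\<mu>)"
    using s(3) by (intro integral_cong_AE) (auto simp: g_def F_def indicator_def)
  also have "\<dots> = (\<integral>r. g r \<partial>N)"
    unfolding N_def by (subst integral_density) auto
  also have "\<dots> = (\<integral>r. (exp (- real_of_ereal r) * indicator F r) *\<^sub>R g (- r) \<partial>\<mu>)"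
    unfolding \<open>N = N'\<close> N'_def by (subst integral_distr, simp, simp, subst integral_density) auto
  also have "\<dots> = (\<integral>r. - g r \<partial>\<mu>)"
  proof (intro integral_cong_AE)
    \<comment> \<open>Reflection turns (1 - tau) u into -(1 + tau) u, and the tilt restores the
      factor 1 - tau.\<close>
    have "exp (- x) * (1 + tanh (x / 2)) = 1 - tanh (x / 2)" for x :: real
    proof -
      have "1 + exp (- x) \<noteq> 0" by (metis add_pos_pos exp_gt_zero less_numeral_extra(1,3))
      thus ?thesis by (simp add: tanh_real_altdef field_simps)
    qed
    hence "exp (- real_of_ereal r) * indicator F r * g (- r) = - g r" if "r \<noteq> -\<infinity>" for r
      using that by (cases r) (auto simp: g_def odd F_def simp flip: mult.assoc)
    thus "AE r in \<mu>. (exp (- real_of_ereal r) * indicator F r) *\<^sub>R g (- r) = - g r"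
      using s(3) by auto
  qed auto
  finally show ?thesis by (simp add: g_def)
qed

text \<open>Differences of the indicators of A and -A are odd, so testing with odd functions already
  gives reflection invariance of (1 - tau) d\<mu>. The weight is 2 at -infinity and 0 at +infinity,
  which excludes an atom at -infinity; at finite points it is positive and can be divided
  out.\<close>

lemma symmetric_distI:
  assumes "prob_space \<mu>" and sets: "sets \<mu> = sets borel"
    and odd: "\<And>u :: real \<Rightarrow> real. u \<in> borel_measurable borel \<Longrightarrow> (\<And>x. u (- x) = - u x) \<Longrightarrow>
      (\<And>x. \<bar>u x\<bar> \<le> 1) \<Longrightarrow> (\<integral>r. (1 - tau r) * u (tau r) \<partial>\<mu>) = 0"
  shows "symmetric_dist \<mu>"
proof -
  interpret prob_space \<mu> by fact
  note [measurable_cong] = sets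
  have sp: "space \<mu> = UNIV" using sets by (metis sets_eq_imp_space_eq space_borel)
  have refl: "(\<integral>r. (1 - tau r) * indicator A r \<partial>\<mu>) = (\<integral>r. (1 - tau r) * indicator A (- r) \<partial>\<mu>)"
    if [measurable]: "A \<in> sets borel" for A :: "ereal set"
  proof -
    define u where "u x = (if \<bar>x\<bar> \<le> 1 then indicator A (llr x) - indicator A (llr (- x)) else 0 :: real)" for x
    have [measurable]: "u \<in> borel_measurable borel" unfolding u_def[abs_def] by measurable
    have b: "\<bar>(1 - tau r) * (indicator A r :: real)\<bar> \<le> 2" "\<bar>(1 - tau r) * (indicator A (- r) :: real)\<bar> \<le> 2" for r
      using tau_bounds[of r] by (auto simp: indicator_def)
    have "(\<integral>r. (1 - tau r) * u (tau r) \<partial>\<mu>) = 0"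
      by (rule odd) (auto simp: u_def indicator_def)
    also have "(\<lambda>r. (1 - tau r) * u (tau r)) =
        (\<lambda>r. (1 - tau r) * indicator A r - (1 - tau r) * indicator A (- r))"
    proof
      show "(1 - tau r) * u (tau r) = (1 - tau r) * indicator A r - (1 - tau r) * indicator A (- r)" for r
        using llr_tau[of "- r"] by (simp add: u_def abs_tau_le right_diff_distrib del: llr_tau)
    qed
    also have "(\<integral>r. (1 - tau r) * indicator A r - (1 - tau r) * indicator A (- r) \<partial>\<mu>) =
      (\<integral>r. (1 - tau r) * indicator A r \<partial>\<mu>) - (\<integral>r. (1 - tau r) * indicator A (- r) \<partial>\<mu>)"
      using b by (intro Bochner_Integration.integral_diff integrable_bounded[OF \<open>prob_space \<mu>\<close>]) auto
    finally show ?thesis by simp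
  qed
  define N where "N = density \<mu> (\<lambda>r. ennreal (1 - tau r))"
  have N: "distr N borel uminus = N"
  proof (rule measure_eqI)
    show "Sigma_Algebra.sets (distr N borel uminus) = Sigma_Algebra.sets N" by (simp add: N_def sets)
    fix A assume "A \<in> Sigma_Algebra.sets (distr N borel uminus)"
    hence A [measurable]: "A \<in> Sigma_Algebra.sets borel" by simp
    have A': "uminus -` A \<in> Sigma_Algebra.sets \<mu>"
      using measurable_sets[OF _ A, of "uminus :: ereal \<Rightarrow> ereal" borel] by (simp add: sets)
    have nn: "(\<integral>\<^sup>+ r. ennreal (1 - tau r) * indicator B r \<partial>\<mu>) = ennreal (\<integral>r. (1 - tau r) * indicator B r \<partial>\<mu>)"
      if [measurable]: "B \<in> Sigma_Algebra.sets borel" for B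
    proof -
      have "(\<integral>\<^sup>+ r. ennreal (1 - tau r) * indicator B r \<partial>\<mu>) = (\<integral>\<^sup>+ r. ennreal ((1 - tau r) * indicator B r) \<partial>\<mu>)"
        using tau_bounds by (intro nn_integral_cong) (auto split: split_indicator)
      also have "\<dots> = ennreal (\<integral>r. (1 - tau r) * indicator B r \<partial>\<mu>)"
      proof (intro nn_integral_eq_integral integrable_bounded[OF \<open>prob_space \<mu>\<close>, of _ 2])
        show "\<bar>(1 - tau r) * indicator B r\<bar> \<le> 2" for r
          using tau_bounds[of r] by (auto simp: indicator_def)
      qed (use tau_bounds in auto)
      finally show ?thesis .
    qed
    have "emeasure (distr N borel uminus) A = (\<integral>\<^sup>+ r. ennreal (1 - tau r) * indicator (uminus -` A) r \<partial>\<mu>)"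
      unfolding N_def using A' sp by (subst emeasure_distr) (auto simp: emeasure_density)
    also have "\<dots> = ennreal (\<integral>r. (1 - tau r) * indicator (uminus -` A) r \<partial>\<mu>)"
      using A' by (intro nn) (simp add: sets)
    also have "(\<integral>r. (1 - tau r) * indicator (uminus -` A) r \<partial>\<mu>) = (\<integral>r. (1 - tau r) * indicator A (- r) \<partial>\<mu>)"
      by (intro Bochner_Integration.integral_cong) (auto simp: indicator_def)
    also have "\<dots> = (\<integral>r. (1 - tau r) * indicator A r \<partial>\<mu>)"
      using refl[OF A] by simp
    also have "ennreal \<dots> = emeasure N A"
      unfolding N_def using A by (simp add: emeasure_density nn sets)
    finally show "emeasure (distr N borel uminus) A = emeasure N A" .
  qed
  have swap: "(\<integral>\<^sup>+ r. ennreal (1 - tau r) * h r \<partial>\<mu>) = (\<integral>\<^sup>+ r. ennreal (1 - tau r) * h (- r) \<partial>\<mu>)"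
    if [measurable]: "h \<in> borel_measurable borel" for h
  proof -
    have [measurable_cong]: "Sigma_Algebra.sets N = Sigma_Algebra.sets borel" by (simp add: N_def sets)
    have "(\<integral>\<^sup>+ r. h r \<partial>N) = (\<integral>\<^sup>+ r. h (- r) \<partial>N)"
      by (subst N[symmetric], subst nn_integral_distr) auto
    thus ?thesis by (simp add: N_def nn_integral_density)
  qed
  have neg: "emeasure \<mu> {-\<infinity>} = 0"
  proof -
    have "(\<integral>\<^sup>+ r. ennreal (1 - tau r) * indicator {-\<infinity>} r \<partial>\<mu>) = (\<integral>\<^sup>+ r. ennreal (1 - tau r) * indicator {-\<infinity>} (- r) \<partial>\<mu>)"
      by (intro swap) auto
    also have "(\<lambda>r. ennreal (1 - tau r) * indicator {-\<infinity>} (- r)) = (\<lambda>r. 0)"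
      by (auto simp: fun_eq_iff indicator_def)
    also have "(\<lambda>r. ennreal (1 - tau r) * indicator {-\<infinity>} r) = (\<lambda>r. 2 * indicator {-\<infinity>} r)"
      by (auto simp: fun_eq_iff indicator_def)
    finally show ?thesis by (simp add: nn_integral_cmult sets)
  qed
  have "emeasure \<mu> E = (\<integral>\<^sup>+ r. ennreal (exp (- real_of_ereal r)) * indicator E (- r) \<partial>\<mu>)"
    if [measurable]: "E \<in> Sigma_Algebra.sets borel" and E: "E \<subseteq> {-\<infinity><..<\<infinity>}" for E
  proof -
    have fin: "r \<noteq> \<infinity>" "r \<noteq> -\<infinity>" if "r \<in> E" for r using that E by auto
    define h where "h r = ennreal (1 / (1 - tau r)) * indicator E r" for r
    have [measurable]: "h \<in> borel_measurable borel" unfolding h_def by measurable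
    have "emeasure \<mu> E = (\<integral>\<^sup>+ r. indicator E r \<partial>\<mu>)" by (simp add: sets)
    also have "\<dots> = (\<integral>\<^sup>+ r. ennreal (1 - tau r) * h r \<partial>\<mu>)"
    proof (intro nn_integral_cong)
      fix r
      show "indicator E r = ennreal (1 - tau r) * h r"
      proof (cases "r \<in> E")
        case True
        hence "tau r < 1" using fin tau_lt_1 by auto
        thus ?thesis using True by (simp add: h_def ennreal_mult''[symmetric])
      qed (simp add: h_def)
    qed
    also have "\<dots> = (\<integral>\<^sup>+ r. ennreal (1 - tau r) * h (- r) \<partial>\<mu>)"
      by (rule swap) simp
    also have "\<dots> = (\<integral>\<^sup>+ r. ennreal (exp (- real_of_ereal r)) * indicator E (- r) \<partial>\<mu>)"
    proof (intro nn_integral_cong)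
      fix r
      show "ennreal (1 - tau r) * h (- r) = ennreal (exp (- real_of_ereal r)) * indicator E (- r)"
      proof (cases "- r \<in> E")
        case True
        then obtain x where r: "r = ereal x" using fin[of "- r"] by (cases r) auto
        have "1 + exp (- x) > 0" by (simp add: add_pos_pos)
        hence "(1 - tanh (x / 2)) * (1 / (1 + tanh (x / 2))) = exp (- x)"
          by (simp add: tanh_real_altdef field_simps)
        moreover have "1 + tanh (x / 2) > 0" using tanh_real_gt_neg1[of "x / 2"] by simp
        ultimately show ?thesis using True by (simp add: h_def r ennreal_mult''[symmetric])
      qed (simp add: h_def)
    qed
    finally show ?thesis .
  qed
  thus ?thesis
    using assms(1) sets neg by (simp add: symmetric_dist_def llr_dist_def)
qed

section \<open>Sums of independent log-likelihood ratios\<close>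

text \<open>Given the modulus a of \<open>tau r\<close>, a symmetric distribution makes the sign
  positive with probability (1 + a) / 2. The proof subtracts the vanishing integral of (1 - tau)
  times the odd part of k. The new integrand is even in \<open>tau r\<close>, so even moments can
  control it.\<close>

lemma symmetric_expand:
  assumes sym: "symmetric_dist \<mu>" and k [measurable]: "k \<in> borel_measurable borel"
    and bd: "\<And>x. \<bar>x\<bar> \<le> 1 \<Longrightarrow> \<bar>k x\<bar> \<le> K"
  shows "(\<integral>r. k (tau r) \<partial>\<mu>) = (\<integral>r. ((1 + tau r) * k (tau r) + (1 - tau r) * k (- tau r)) / 2 \<partial>\<mu>)"
proof -
  note s = symmetric_distD[OF sym]
  note [measurable_cong] = s(2)
  have "(\<integral>r. (1 - tau r) * ((k (tau r) - k (- tau r)) / 2) \<partial>\<mu>) = 0"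
  proof (rule symmetric_dist_odd[OF sym, where u = "\<lambda>x. (k x - k (- x)) / 2" and K = K])
    show "\<bar>(k x - k (- x)) / 2\<bar> \<le> K" if "\<bar>x\<bar> \<le> 1" for x
      using bd[of x] bd[of "- x"] that by auto
  qed (auto simp: field_simps)
  hence "(\<integral>r. k (tau r) \<partial>\<mu>) = (\<integral>r. k (tau r) \<partial>\<mu>) - (\<integral>r. (1 - tau r) * ((k (tau r) - k (- tau r)) / 2) \<partial>\<mu>)"
    by simp
  also have "\<dots> = (\<integral>r. k (tau r) - (1 - tau r) * ((k (tau r) - k (- tau r)) / 2) \<partial>\<mu>)"
  proof (rule Bochner_Integration.integral_diff[symmetric])
    show "integrable \<mu> (\<lambda>r. k (tau r))"
      using bd abs_tau_le by (intro integrable_bounded[OF s(1), of _ K]) auto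
    have "\<bar>(1 - tau r) * ((k (tau r) - k (- tau r)) / 2)\<bar> \<le> 2 * K" for r
    proof -
      have "\<bar>(k (tau r) - k (- tau r)) / 2\<bar> \<le> K"
        using bd[of "tau r"] bd[of "- tau r"] abs_tau_le[of r] by auto
      thus ?thesis
        unfolding abs_mult using tau_bounds[of r] by (intro mult_mono) auto
    qed
    thus "integrable \<mu> (\<lambda>r. (1 - tau r) * ((k (tau r) - k (- tau r)) / 2))"
      by (intro integrable_bounded[OF s(1), of _ "2 * K"]) auto
  qed
  also have "\<dots> = (\<integral>r. ((1 + tau r) * k (tau r) + (1 - tau r) * k (- tau r)) / 2 \<partial>\<mu>)"
    by (intro Bochner_Integration.integral_cong) (auto simp: field_simps)
  finally show ?thesis .
qed

definition conv :: "ereal measure \<Rightarrow> ereal measure \<Rightarrow> ereal measure" where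
  "conv A B = distr (A \<Otimes>\<^sub>M B) borel (\<lambda>(x, y). x + y)"

text \<open>Addition law of tanh. At a b = -1 the value is 0 because division by 0 yields 0; such
  points have zero weight in the expansions below, or zero mass.\<close>

definition tplus :: "real \<Rightarrow> real \<Rightarrow> real" where
  "tplus a b = (a + b) / (1 + a * b)"

lemma abs_tplus_le: "\<bar>a\<bar> \<le> 1 \<Longrightarrow> \<bar>b\<bar> \<le> 1 \<Longrightarrow> \<bar>tplus a b\<bar> \<le> 1"
  using add_le_one_plus_mult(1)[of a b]
  by (cases "1 + a * b = 0") (auto simp: tplus_def abs_divide)

lemma tplus_minus: "tplus (- a) (- b) = - tplus a b"
  unfolding tplus_def minus_divide_left by simp

lemma sets_conv [simp, measurable_cong]: "sets (conv A B) = sets borel"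
  by (simp add: conv_def)

lemma prob_space_conv:
  assumes "prob_space A" "prob_space B" "sets A = sets borel" "sets B = sets borel"
  shows "prob_space (conv A B)"
proof -
  note [measurable_cong] = assms(3,4)
  interpret A: prob_space A by fact
  interpret B: prob_space B by fact
  interpret pair_prob_space A B ..
  show ?thesis unfolding conv_def by (intro prob_space_distr) measurable
qed

lemma integral_conv:
  fixes f :: "ereal \<Rightarrow> real"
  assumes "prob_space A" "prob_space B" "sets A = sets borel" "sets B = sets borel"
    and f [measurable]: "f \<in> borel_measurable borel" and bd: "\<And>x. \<bar>f x\<bar> \<le> K"
  shows "(\<integral>r. f r \<partial>conv A B) = (\<integral>x. (\<integral>y. f (x + y) \<partial>B) \<partial>A)"
proof -
  note [measurable_cong] = assms(3,4)
  interpret A: prob_space A by fact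
  interpret B: prob_space B by fact
  interpret pair_prob_space A B ..
  have "(\<integral>r. f r \<partial>conv A B) = (\<integral>z. f (fst z + snd z) \<partial>(A \<Otimes>\<^sub>M B))"
    unfolding conv_def by (subst integral_distr) (auto simp: case_prod_beta)
  also have "\<dots> = (\<integral>x. (\<integral>y. f (x + y) \<partial>B) \<partial>A)"
    by (subst integral_fst'[symmetric]) (auto intro!: integrable_bounded[of _ _ K] bd prob_space_axioms)
  finally show ?thesis .
qed

lemma integral_swap:
  fixes f :: "ereal \<Rightarrow> ereal \<Rightarrow> real"
  assumes "prob_space A" "prob_space B" "sets A = sets borel" "sets B = sets borel"
    and f: "case_prod f \<in> borel_measurable (borel \<Otimes>\<^sub>M borel)" and bd: "\<And>x y. \<bar>f x y\<bar> \<le> K"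
  shows "(\<integral>y. (\<integral>x. f x y \<partial>A) \<partial>B) = (\<integral>x. (\<integral>y. f x y \<partial>B) \<partial>A)"
proof -
  note [measurable_cong] = assms(3,4)
  note [measurable] = f
  interpret A: prob_space A by fact
  interpret B: prob_space B by fact
  interpret pair_prob_space A B ..
  show ?thesis
    by (intro Fubini_integral integrable_bounded[of _ _ K] prob_space_axioms) (auto simp: bd)
qed

text \<open>Both summands are averaged over their signs given the moduli. The four sign patterns are
  grouped into pairs with opposite sums, so that for an even test each pair merges and in a test of
  symmetry each pair cancels.\<close>

lemma integral_conv_tau:
  assumes A: "symmetric_dist A" and B: "symmetric_dist B"
    and k [measurable]: "k \<in> borel_measurable borel"
    and bd: "\<And>x. \<bar>x\<bar> \<le> 1 \<Longrightarrow> \<bar>k x\<bar> \<le> K"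
  shows "(\<integral>r. k (tau r) \<partial>conv A B) = (\<integral>x. (\<integral>y.
    ((1 + tau x) * (1 + tau y) * k (tplus (tau x) (tau y)) + (1 - tau x) * (1 - tau y) * k (- tplus (tau x) (tau y)) +
     ((1 + tau x) * (1 - tau y) * k (tplus (tau x) (- tau y)) + (1 - tau x) * (1 + tau y) * k (- tplus (tau x) (- tau y)))) / 4
     \<partial>B) \<partial>A)"
proof -
  note a = symmetric_distD[OF A] and b = symmetric_distD[OF B]
  note [measurable_cong] = a(2) b(2)
  interpret A: prob_space A by (rule a)
  interpret B: prob_space B by (rule b)
  interpret pair_prob_space A B ..
  have [measurable]: "(\<lambda>z. tplus (f z) (g z)) \<in> borel_measurable N"
    if "f \<in> borel_measurable N" "g \<in> borel_measurable N" for f g and N :: "'z measure"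
    using that unfolding tplus_def by measurable
  define h where "h a b = ((1 + a) * k (tplus a b) + (1 - a) * k (- tplus a (- b))) / 2" for a b
  have [measurable]: "(\<lambda>z. h (f z) (g z)) \<in> borel_measurable N"
    if "f \<in> borel_measurable N" "g \<in> borel_measurable N" for f g and N :: "'z measure"
    using that unfolding h_def by measurable
  have bd': "\<bar>k (tplus a b)\<bar> \<le> K" "\<bar>k (- tplus a b)\<bar> \<le> K" if "\<bar>a\<bar> \<le> 1" "\<bar>b\<bar> \<le> 1" for a b
    using abs_tplus_le[OF that] by (auto intro!: bd)
  have bh: "\<bar>h a b\<bar> \<le> 2 * K" if "\<bar>a\<bar> \<le> 1" "\<bar>b\<bar> \<le> 1" for a b
  proof -
    have "\<bar>(1 + a) * k (tplus a b)\<bar> \<le> 2 * K" "\<bar>(1 - a) * k (- tplus a (- b))\<bar> \<le> 2 * K"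
      unfolding abs_mult using that bd'[of a b] bd'[of a "- b"] by (auto intro!: mult_mono)
    thus ?thesis by (auto simp: h_def)
  qed
  have "(\<integral>r. k (tau r) \<partial>conv A B) = (\<integral>x. (\<integral>y. k (tau (x + y)) \<partial>B) \<partial>A)"
    using bd abs_tau_le by (intro integral_conv[of _ _ _ K] a b) auto
  also have "\<dots> = (\<integral>x. (\<integral>y. k (tplus (tau x) (tau y)) \<partial>B) \<partial>A)"
  proof (rule integral_cong_AE)
    show "AE x in A. (\<integral>y. k (tau (x + y)) \<partial>B) = (\<integral>y. k (tplus (tau x) (tau y)) \<partial>B)"
      using a(3)
    proof eventually_elim
      case (elim x)
      have "AE y in B. k (tau (x + y)) = k (tplus (tau x) (tau y))"
        using b(3) by eventually_elim (use elim in \<open>auto simp: tau_add tplus_def\<close>)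
      thus ?case by (intro integral_cong_AE) auto
    qed
  qed measurable
  \<comment> \<open>\<open>symmetric_expand\<close> is applied to the inner variable, hence Fubini
    before and after the expansion in x.\<close>
  also have "\<dots> = (\<integral>y. (\<integral>x. k (tplus (tau x) (tau y)) \<partial>A) \<partial>B)"
    by (rule integral_swap[symmetric, of _ _ _ K]) (auto intro!: a b bd' abs_tau_le)
  also have "\<dots> = (\<integral>y. (\<integral>x. h (tau x) (tau y) \<partial>A) \<partial>B)"
  proof (rule Bochner_Integration.integral_cong[OF refl])
    fix y
    show "(\<integral>x. k (tplus (tau x) (tau y)) \<partial>A) = (\<integral>x. h (tau x) (tau y) \<partial>A)"
      using symmetric_expand[OF A, of "\<lambda>a. k (tplus a (tau y))" K] bd' abs_tau_le
        tplus_minus[of _ "- tau y"] by (simp add: h_def)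
  qed
  also have "\<dots> = (\<integral>x. (\<integral>y. h (tau x) (tau y) \<partial>B) \<partial>A)"
    by (rule integral_swap[of _ _ _ "2 * K"]) (auto intro!: a b bh abs_tau_le)
  also have "\<dots> = (\<integral>x. (\<integral>y. ((1 + tau y) * h (tau x) (tau y) + (1 - tau y) * h (tau x) (- tau y)) / 2 \<partial>B) \<partial>A)"
  proof (rule Bochner_Integration.integral_cong[OF refl])
    fix x
    show "(\<integral>y. h (tau x) (tau y) \<partial>B) = (\<integral>y. ((1 + tau y) * h (tau x) (tau y) + (1 - tau y) * h (tau x) (- tau y)) / 2 \<partial>B)"
      by (rule symmetric_expand[OF B, of "\<lambda>b. h (tau x) b" "2 * K"]) (auto intro!: bh abs_tau_le)
  qed
  finally have **: "(\<integral>r. k (tau r) \<partial>conv A B) =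
    (\<integral>x. (\<integral>y. ((1 + tau y) * h (tau x) (tau y) + (1 - tau y) * h (tau x) (- tau y)) / 2 \<partial>B) \<partial>A)" .
  have *: "((1 + b) * h a b + (1 - b) * h a (- b)) / 2 =
     ((1 + a) * (1 + b) * k (tplus a b) + (1 - a) * (1 - b) * k (- tplus a b) +
     ((1 + a) * (1 - b) * k (tplus a (- b)) + (1 - a) * (1 + b) * k (- tplus a (- b)))) / 4" for a b
  proof -
    have "((1 + b) * ((P + Q) / 2) + (1 - b) * ((R + S) / 2)) / 2 =
      ((1 + b) * P + (1 - b) * S + ((1 - b) * R + (1 + b) * Q)) / 4" for P Q R S :: real
      by (simp add: field_simps)
    from this[of "(1 + a) * k (tplus a b)" "(1 - a) * k (- tplus a (- b))"
        "(1 + a) * k (tplus a (- b))" "(1 - a) * k (- tplus a b)"]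
    show ?thesis by (simp add: h_def mult_ac)
  qed
  show ?thesis unfolding ** by (simp only: *)
qed

lemma comb_eq_tplus: "comb f a b = ((1 + a * b) * f (tplus a b) + (1 - a * b) * f (tplus a (- b))) / 2"
  by (simp add: comb_def tplus_def)

text \<open>For even k the weights of opposite patterns add up: (1 + a) (1 + b) + (1 - a) (1 - b) =
  2 (1 + a b). This is the origin of the weights in \<open>comb\<close>.\<close>

lemma integral_conv_even:
  assumes A: "symmetric_dist A" and B: "symmetric_dist B"
    and k: "k \<in> borel_measurable borel"
    and bd: "\<And>x. \<bar>x\<bar> \<le> 1 \<Longrightarrow> \<bar>k x\<bar> \<le> K" and even: "\<And>x. k (- x) = k x"
  shows "(\<integral>r. k (tau r) \<partial>conv A B) = (\<integral>x. (\<integral>y. comb k (tau x) (tau y) \<partial>B) \<partial>A)"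
proof (subst integral_conv_tau[OF A B k, of K])
  show "(\<integral>x. (\<integral>y.
    ((1 + tau x) * (1 + tau y) * k (tplus (tau x) (tau y)) + (1 - tau x) * (1 - tau y) * k (- tplus (tau x) (tau y)) +
     ((1 + tau x) * (1 - tau y) * k (tplus (tau x) (- tau y)) + (1 - tau x) * (1 + tau y) * k (- tplus (tau x) (- tau y)))) / 4
     \<partial>B) \<partial>A) = (\<integral>x. (\<integral>y. comb k (tau x) (tau y) \<partial>B) \<partial>A)"
  proof -
    have "((1 + a) * (1 + b) * X + (1 - a) * (1 - b) * X + ((1 + a) * (1 - b) * Y + (1 - a) * (1 + b) * Y)) / 4 =
        ((1 + a * b) * X + (1 - a * b) * Y) / 2" for a b X Y :: real
    proof -
      have "(1 + a) * (1 + b) * X + (1 - a) * (1 - b) * X + ((1 + a) * (1 - b) * Y + (1 - a) * (1 + b) * Y) =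
          2 * ((1 + a * b) * X + (1 - a * b) * Y)" by (simp add: algebra_simps)
      thus ?thesis by simp
    qed
    thus ?thesis
      by (simp only: comb_eq_tplus even)
  qed
qed (use bd in auto)

text \<open>With c = \<open>tplus a b\<close>, 1 - c is (1 - a) (1 - b) / (1 + a b) and 1 + c is (1
  + a) (1 + b) / (1 + a b), so opposite patterns carry the same weight in a test of symmetry and the
  odd function cancels them. Where 1 + a b = 0, c is 0 by default and u 0 = 0.\<close>

lemma symmetric_conv:
  assumes A: "symmetric_dist A" and B: "symmetric_dist B"
  shows "symmetric_dist (conv A B)"
proof (rule symmetric_distI)
  note a = symmetric_distD[OF A] and b = symmetric_distD[OF B]
  show "prob_space (conv A B)" by (intro prob_space_conv a b)
  fix u :: "real \<Rightarrow> real" assume u [measurable]: "u \<in> borel_measurable borel"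
    and odd: "\<And>x. u (- x) = - u x" and bd: "\<And>x. \<bar>u x\<bar> \<le> 1"
  have bk: "\<bar>(1 - x) * u x\<bar> \<le> 2 * 1" if "\<bar>x\<bar> \<le> 1" for x
    unfolding abs_mult using that bd[of x] by (intro mult_mono) auto
  have *: "(1 + a) * (1 + b) * ((1 - tplus a b) * u (tplus a b)) +
     (1 - a) * (1 - b) * ((1 - - tplus a b) * u (- tplus a b)) = 0" for a b
  proof (cases "1 + a * b = 0")
    case True
    thus ?thesis using odd[of 0] by (simp add: tplus_def)
  next
    case False
    hence "(1 - tplus a b) = (1 - a) * (1 - b) / (1 + a * b)" "(1 - - tplus a b) = (1 + a) * (1 + b) / (1 + a * b)"
      by (auto simp: tplus_def field_simps)
    thus ?thesis by (simp add: odd)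
  qed
  have **: "(1 + a) * (1 - b) * ((1 - tplus a (- b)) * u (tplus a (- b))) +
     (1 - a) * (1 + b) * ((1 - - tplus a (- b)) * u (- tplus a (- b))) = 0" for a b
    using *[of a "- b"] by simp
  show "(\<integral>r. (1 - tau r) * u (tau r) \<partial>conv A B) = 0"
    by (subst integral_conv_tau[OF A B, of "\<lambda>x. (1 - x) * u x" "2 * 1"])
      (use bk in \<open>simp_all only: * **, simp_all\<close>)
qed simp

section \<open>The degradation order and its behaviour under sums\<close>

text \<open>
  \<open>degraded t A B\<close> says that \<open>A\<close>, passed through a binary symmetric channel of correlation \<open>t\<close>, is
  dominated by \<open>B\<close>, as far as the test functions \<open>gker q\<close> can tell.
\<close>

definition degraded :: "real \<Rightarrow> ereal measure \<Rightarrow> ereal measure \<Rightarrow> bool" where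
  "degraded t A B \<longleftrightarrow> (\<forall>q. \<bar>q\<bar> < 1 \<longrightarrow> (\<integral>r. gker q (t * tau r) \<partial>A) \<le> (\<integral>r. gker q (tau r) \<partial>B))"

lemma measurable_gker [measurable (raw)]:
  assumes [measurable]: "f \<in> borel_measurable M"
  shows "(\<lambda>x. gker q (f x)) \<in> borel_measurable M"
  unfolding gker_def by measurable

lemma measurable_comb [measurable (raw)]:
  assumes [measurable]: "f \<in> borel_measurable M" "g \<in> borel_measurable M" "k \<in> borel_measurable borel"
  shows "(\<lambda>x. comb k (f x) (g x)) \<in> borel_measurable M"
  unfolding comb_def by measurable

lemma abs_gker_le: "\<bar>q\<bar> < 1 \<Longrightarrow> \<bar>x\<bar> \<le> 1 \<Longrightarrow> \<bar>gker q x\<bar> \<le> 1 / (1 - q\<^sup>2)"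
  using gker_nonneg gker_le by simp

lemma abs_comb_le:
  assumes "\<And>x. \<bar>x\<bar> \<le> 1 \<Longrightarrow> \<bar>f x\<bar> \<le> K" "\<bar>a\<bar> \<le> 1" "\<bar>b\<bar> \<le> 1"
  shows "\<bar>comb f a b\<bar> \<le> K"
proof -
  have t: "\<bar>f (tplus a b)\<bar> \<le> K" "\<bar>f (tplus a (- b))\<bar> \<le> K"
    using assms abs_tplus_le[of a b] abs_tplus_le[of a "- b"] by auto
  have "\<bar>a * b\<bar> \<le> 1" using assms unfolding abs_mult by (intro mult_le_one) auto
  hence "0 \<le> 1 + a * b" "0 \<le> 1 - a * b" by linarith+
  hence "\<bar>(1 + a * b) * f (tplus a b)\<bar> \<le> (1 + a * b) * K" "\<bar>(1 - a * b) * f (tplus a (- b))\<bar> \<le> (1 - a * b) * K"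
    unfolding abs_mult using t by (auto intro!: mult_mono)
  hence "\<bar>comb f a b\<bar> \<le> ((1 + a * b) * K + (1 - a * b) * K) / 2"
    unfolding comb_eq_tplus by (auto simp: abs_le_iff)
  thus ?thesis by (simp add: algebra_simps)
qed

lemma abs_scaled_tau_le: "0 \<le> t \<Longrightarrow> t \<le> 1 \<Longrightarrow> \<bar>t * tau r\<bar> \<le> 1"
  using abs_tau_le[of r] by (simp add: abs_mult mult_le_one)

lemma integrable_gker:
  assumes "prob_space A" "sets A = sets borel" "\<bar>q\<bar> < 1" "0 \<le> t" "t \<le> 1"
  shows "integrable A (\<lambda>r. gker q (t * tau r))"
proof -
  note [measurable_cong] = assms(2)
  show ?thesis
    using assms by (intro integrable_bounded[of _ _ "1 / (1 - q\<^sup>2)"] abs_gker_le abs_scaled_tau_le) auto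
qed

text \<open>By \<open>comb_expand\<close> both sides are the same constant plus the same nonnegative
  combination of tests, taken at Moebius images of q. This is why \<open>degraded\<close> quantifies
  over all q.\<close>

lemma degraded_comb:
  assumes A: "prob_space A" "sets A = sets borel" and A': "prob_space A'" "sets A' = sets borel"
    and t: "0 \<le> t" "t \<le> 1" and deg: "degraded t A A'" and q: "\<bar>q\<bar> < 1" and b: "\<bar>b\<bar> \<le> 1"
  shows "(\<integral>r. comb (gker q) (t * tau r) b \<partial>A) \<le> (\<integral>r. comb (gker q) (tau r) b \<partial>A')"
proof (cases "\<bar>b\<bar> = 1")
  case True
  interpret A: prob_space A by fact
  interpret A': prob_space A' by fact
  show ?thesis
    using t by (simp add: comb_gker_abs_1[OF True] abs_scaled_tau_le abs_tau_le A.prob_space A'.prob_space)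
next
  case False
  hence b: "\<bar>b\<bar> < 1" using b by simp
  interpret A: prob_space A by fact
  interpret A': prob_space A' by fact
  define r where "r = (q - b) / (1 - q * b)"
  define r' where "r' = (q + b) / (1 + q * b)"
  have r: "\<bar>r\<bar> < 1" "\<bar>r'\<bar> < 1"
    using mobius_abs_less[of q b] mobius_abs_less[of q "- b"] q b by (auto simp: r_def r'_def)
  have e: "comb (gker q) x b = gker q b + (mcoef q b * gker r x + mcoef q (- b) * gker r' x) / 2"
    if "\<bar>x\<bar> \<le> 1" for x
    using comb_expand[of q x b] q b that by (simp add: r_def r'_def)
  have i: "integrable A (\<lambda>x. gker r (t * tau x))" "integrable A (\<lambda>x. gker r' (t * tau x))"
    using A t r by (auto intro!: integrable_gker)
  have i': "integrable A' (\<lambda>x. gker r (tau x))" "integrable A' (\<lambda>x. gker r' (tau x))"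
    using integrable_gker[OF A', of r 1] integrable_gker[OF A', of r' 1] r by auto
  have "(\<integral>x. comb (gker q) (t * tau x) b \<partial>A) = gker q b +
      (mcoef q b * (\<integral>x. gker r (t * tau x) \<partial>A) + mcoef q (- b) * (\<integral>x. gker r' (t * tau x) \<partial>A)) / 2"
    using t i by (simp add: e abs_scaled_tau_le A.prob_space)
  also have "\<dots> \<le> gker q b +
      (mcoef q b * (\<integral>x. gker r (tau x) \<partial>A') + mcoef q (- b) * (\<integral>x. gker r' (tau x) \<partial>A')) / 2"
    using deg r q b
    by (intro add_left_mono divide_right_mono add_mono mult_left_mono mcoef_nonneg) (auto simp: degraded_def)
  also have "\<dots> = (\<integral>x. comb (gker q) (tau x) b \<partial>A')"
    using i' by (simp add: e abs_tau_le A'.prob_space)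
  finally show ?thesis .
qed

lemma degraded_half:
  assumes A: "prob_space A" "sets A = sets borel" and A': "prob_space A'" "sets A' = sets borel"
    and B: "prob_space B" "sets B = sets borel"
    and t: "0 \<le> t" "t \<le> 1" and s: "0 \<le> s" "s \<le> 1" and deg: "degraded t A A'" and q: "\<bar>q\<bar> < 1"
  shows "(\<integral>x. (\<integral>y. comb (gker q) (t * tau x) (s * tau y) \<partial>B) \<partial>A) \<le>
    (\<integral>x. (\<integral>y. comb (gker q) (tau x) (s * tau y) \<partial>B) \<partial>A')"
proof -
  note [measurable_cong] = A(2) A'(2) B(2)
  interpret A: prob_space A by fact
  interpret A': prob_space A' by fact
  interpret B: prob_space B by fact
  let ?K = "1 / (1 - q\<^sup>2)"
  have bd: "\<bar>comb (gker q) (t * tau x) (s * tau y)\<bar> \<le> ?K" if "0 \<le> t" "t \<le> 1" for t x y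
    using that s q by (intro abs_comb_le abs_gker_le abs_scaled_tau_le)
  have i: "integrable B (\<lambda>y. \<integral>x. comb (gker q) (t * tau x) (s * tau y) \<partial>C)"
    if C: "prob_space C" "sets C = sets borel" and t: "0 \<le> t" "t \<le> 1" for C t
  proof (rule integrable_bounded[OF B(1), of _ ?K])
    note [measurable_cong] = C(2)
    interpret C: prob_space C by fact
    show "(\<lambda>y. \<integral>x. comb (gker q) (t * tau x) (s * tau y) \<partial>C) \<in> borel_measurable B"
      by measurable
    show "\<bar>\<integral>x. comb (gker q) (t * tau x) (s * tau y) \<partial>C\<bar> \<le> ?K" for y
    proof -
      have "integrable C (\<lambda>x. comb (gker q) (t * tau x) (s * tau y))"
        using bd[OF t] by (intro integrable_bounded[OF C(1), of _ ?K]) auto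
      hence "\<bar>\<integral>x. comb (gker q) (t * tau x) (s * tau y) \<partial>C\<bar> \<le> (\<integral>x. ?K \<partial>C)"
        using bd[OF t] by (intro order.trans[OF integral_abs_bound] integral_mono) auto
      thus ?thesis by (simp add: C.prob_space)
    qed
  qed
  have "(\<integral>x. (\<integral>y. comb (gker q) (t * tau x) (s * tau y) \<partial>B) \<partial>A) =
      (\<integral>y. (\<integral>x. comb (gker q) (t * tau x) (s * tau y) \<partial>A) \<partial>B)"
    by (rule integral_swap[symmetric, of _ _ _ ?K]) (auto intro!: A B bd t)
  also have "\<dots> \<le> (\<integral>y. (\<integral>x. comb (gker q) (tau x) (s * tau y) \<partial>A') \<partial>B)"
    using i[OF A t] i[OF A', of 1] degraded_comb[OF A A' t deg q] s
    by (intro integral_mono) (auto simp: abs_scaled_tau_le)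
  also have "\<dots> = (\<integral>x. (\<integral>y. comb (gker q) (tau x) (s * tau y) \<partial>B) \<partial>A')"
    using bd[of 1] by (intro integral_swap[of _ _ _ ?K]) (auto intro!: A' B)
  finally show ?thesis .
qed

lemma integral_comb_commute:
  assumes A: "prob_space A" "sets A = sets borel" and B: "prob_space B" "sets B = sets borel"
    and t: "0 \<le> t" "t \<le> 1" and s: "0 \<le> s" "s \<le> 1" and q: "\<bar>q\<bar> < 1"
  shows "(\<integral>x. (\<integral>y. comb (gker q) (t * tau x) (s * tau y) \<partial>B) \<partial>A) =
    (\<integral>y. (\<integral>x. comb (gker q) (s * tau y) (t * tau x) \<partial>A) \<partial>B)"
proof -
  have bd: "\<bar>comb (gker q) (s * tau y) (t * tau x)\<bar> \<le> 1 / (1 - q\<^sup>2)" for x y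
    using t s q by (intro abs_comb_le abs_gker_le abs_scaled_tau_le)
  have "comb (gker q) (t * tau x) (s * tau y) = comb (gker q) (s * tau y) (t * tau x)" for x y
    by (rule comb_commute) simp
  thus ?thesis
    by (simp only:) (rule integral_swap[symmetric, of _ _ _ "1 / (1 - q\<^sup>2)"]; auto intro!: A B bd)
qed

lemma integrable_comb_iterated:
  assumes A: "prob_space A" "sets A = sets borel" and B: "prob_space B" "sets B = sets borel"
    and k: "k \<in> borel_measurable borel" and bd: "\<And>x. \<bar>x\<bar> \<le> 1 \<Longrightarrow> \<bar>k x\<bar> \<le> K"
    and t: "0 \<le> t" "t \<le> 1" and s: "0 \<le> s" "s \<le> 1"
  shows "integrable B (\<lambda>y. comb k (t * tau x) (s * tau y))"
    and "integrable A (\<lambda>x. \<integral>y. comb k (t * tau x) (s * tau y) \<partial>B)"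
proof -
  note [measurable_cong] = A(2) B(2)
  note [measurable] = k
  interpret A: prob_space A by fact
  interpret B: prob_space B by fact
  have bd': "\<bar>comb k (t * tau x) (s * tau y)\<bar> \<le> K" for x y
    using t s bd by (intro abs_comb_le abs_scaled_tau_le) auto
  show 1: "integrable B (\<lambda>y. comb k (t * tau x) (s * tau y))" for x
    using bd' by (intro integrable_bounded[OF B(1), of _ K]) auto
  show "integrable A (\<lambda>x. \<integral>y. comb k (t * tau x) (s * tau y) \<partial>B)"
  proof (intro integrable_bounded[OF A(1), of _ K])
    show "(\<lambda>x. \<integral>y. comb k (t * tau x) (s * tau y) \<partial>B) \<in> borel_measurable A"
      by measurable
    show "\<bar>\<integral>y. comb k (t * tau x) (s * tau y) \<partial>B\<bar> \<le> K" for x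
    proof -
      have "\<bar>\<integral>y. comb k (t * tau x) (s * tau y) \<partial>B\<bar> \<le> (\<integral>y. K \<partial>B)"
        using bd' 1 by (intro order.trans[OF integral_abs_bound] integral_mono) auto
      thus ?thesis by (simp add: B.prob_space)
    qed
  qed
qed

lemma integral_conv_gker:
  assumes "symmetric_dist A" "symmetric_dist B" "\<bar>q\<bar> < 1" "0 \<le> t" "t \<le> 1"
  shows "(\<integral>r. gker q (t * tau r) \<partial>conv A B) = (\<integral>x. (\<integral>y. comb (\<lambda>x. gker q (t * x)) (tau x) (tau y) \<partial>B) \<partial>A)"
proof -
  have "\<bar>t * x\<bar> \<le> 1" if "\<bar>x\<bar> \<le> 1" for x
    using that assms by (simp add: abs_mult mult_le_one)
  thus ?thesis
    using assms abs_gker_le by (intro integral_conv_even[where K = "1 / (1 - q\<^sup>2)"]) auto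
qed

text \<open>The stringy inequality degrades both summands separately, \<open>comb_gker_gain\<close>
  then releases B from its degradation and yields the surplus, and finally A is exchanged for A'.
  The condition t < 1 keeps the degraded first message away from modulus 1, where it would absorb B
  and leave no gain.\<close>

lemma degraded_conv_gain:
  assumes A: "symmetric_dist A" and A': "symmetric_dist A'" and B: "symmetric_dist B"
    and t: "0 \<le> t" "t < 1" and deg: "degraded t A A'" and q: "\<bar>q\<bar> < 1"
  shows "(\<integral>r. gker q (t * tau r) \<partial>conv A B) + (1 - t\<^sup>2) ^ 3 / 8 * (\<integral>r. (tau r)\<^sup>2 \<partial>B) \<le>
    (\<integral>r. gker q (tau r) \<partial>conv A' B)"
proof -
  note a = symmetric_distD[OF A] and a' = symmetric_distD[OF A'] and b = symmetric_distD[OF B]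
  note [measurable_cong] = a(2) b(2)
  interpret A: prob_space A by (rule a)
  interpret B: prob_space B by (rule b)
  have t1: "t \<le> 1" using t by simp
  let ?c = "(1 - t\<^sup>2) ^ 3 / 8"
  let ?m = "\<integral>r. (tau r)\<^sup>2 \<partial>B"
  have bt: "\<bar>gker q (t * x)\<bar> \<le> 1 / (1 - q\<^sup>2)" if "\<bar>x\<bar> \<le> 1" for x
  proof -
    have "\<bar>t * x\<bar> \<le> 1" using that t by (simp add: abs_mult mult_le_one)
    thus ?thesis using q by (rule abs_gker_le[rotated])
  qed
  have i1: "integrable B (\<lambda>y. comb (\<lambda>x. gker q (t * x)) (tau x) (tau y))"
    "integrable A (\<lambda>x. \<integral>y. comb (\<lambda>x. gker q (t * x)) (tau x) (tau y) \<partial>B)" for x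
    using integrable_comb_iterated[OF a(1,2) b(1,2), of "\<lambda>x. gker q (t * x)" "1 / (1 - q\<^sup>2)" 1 1] bt by auto
  have i2: "integrable B (\<lambda>y. comb (gker q) (t * tau x) (tau y))"
    "integrable A (\<lambda>x. \<integral>y. comb (gker q) (t * tau x) (tau y) \<partial>B)" for x
    using integrable_comb_iterated[OF a(1,2) b(1,2), of "gker q" "1 / (1 - q\<^sup>2)" t 1] t t1 q abs_gker_le by auto
  have i3: "integrable B (\<lambda>y. (tau y)\<^sup>2)"
    using abs_tau_le by (intro integrable_bounded[OF b(1), of _ 1]) (auto simp: abs_square_le_1)
  have "(\<integral>r. gker q (t * tau r) \<partial>conv A B) + ?c * ?m =
      (\<integral>x. (\<integral>y. comb (\<lambda>x. gker q (t * x)) (tau x) (tau y) \<partial>B) + ?c * ?m \<partial>A)"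
    using i1 t t1 q by (simp add: integral_conv_gker[OF A B] A.prob_space)
  also have "\<dots> = (\<integral>x. (\<integral>y. comb (\<lambda>x. gker q (t * x)) (tau x) (tau y) + ?c * (tau y)\<^sup>2 \<partial>B) \<partial>A)"
    using i1 i3 by simp
  also have "\<dots> \<le> (\<integral>x. (\<integral>y. comb (gker q) (t * tau x) (tau y) \<partial>B) \<partial>A)"
  proof (intro integral_mono)
    show "integrable A (\<lambda>x. \<integral>y. comb (\<lambda>x. gker q (t * x)) (tau x) (tau y) + ?c * (tau y)\<^sup>2 \<partial>B)"
      using i1 i3 by simp
    show "comb (\<lambda>x. gker q (t * x)) (tau x) (tau y) + ?c * (tau y)\<^sup>2 \<le> comb (gker q) (t * tau x) (tau y)" for x y
    proof -
      have "\<bar>t * tau x\<bar> \<le> t" using t abs_tau_le[of x] by (simp add: abs_mult mult_left_le)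
      thus ?thesis
        using stringy[OF q t(1) t1 abs_tau_le abs_tau_le, of x y] comb_gker_gain[OF q t, of "t * tau x" "tau y"]
          abs_tau_le by auto
    qed
  qed (use i1 i2 i3 in auto)
  also have "\<dots> \<le> (\<integral>x. (\<integral>y. comb (gker q) (tau x) (tau y) \<partial>B) \<partial>A')"
    using degraded_half[OF a(1,2) a'(1,2) b(1,2) t(1) t1 _ _ deg q, of 1] by simp
  also have "\<dots> = (\<integral>r. gker q (tau r) \<partial>conv A' B)"
    using integral_conv_gker[OF A' B q, of 1] by simp
  finally show ?thesis .
qed

text \<open>After the stringy inequality the summands are degraded separately and can be replaced
  one at a time, using commutativity of \<open>comb\<close> to bring the second one to the
  front.\<close>

lemma degraded_conv:
  assumes A: "symmetric_dist A" and A': "symmetric_dist A'" and B: "symmetric_dist B" and B': "symmetric_dist B'"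
    and t: "0 \<le> t" "t \<le> 1" and degA: "degraded t A A'" and degB: "degraded t B B'"
  shows "degraded t (conv A B) (conv A' B')"
  unfolding degraded_def
proof safe
  fix q :: real assume q: "\<bar>q\<bar> < 1"
  note a = symmetric_distD[OF A] and a' = symmetric_distD[OF A']
    and b = symmetric_distD[OF B] and b' = symmetric_distD[OF B']
  have bt: "\<bar>gker q (t * x)\<bar> \<le> 1 / (1 - q\<^sup>2)" if "\<bar>x\<bar> \<le> 1" for x
  proof -
    have "\<bar>t * x\<bar> \<le> 1" using that t by (simp add: abs_mult mult_le_one)
    thus ?thesis using q by (rule abs_gker_le[rotated])
  qed
  have "(\<integral>r. gker q (t * tau r) \<partial>conv A B) = (\<integral>x. (\<integral>y. comb (\<lambda>x. gker q (t * x)) (tau x) (tau y) \<partial>B) \<partial>A)"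
    by (rule integral_conv_gker[OF A B q t])
  also have "\<dots> \<le> (\<integral>x. (\<integral>y. comb (gker q) (t * tau x) (t * tau y) \<partial>B) \<partial>A)"
    using integrable_comb_iterated[OF a(1,2) b(1,2), of "\<lambda>x. gker q (t * x)" "1 / (1 - q\<^sup>2)" 1 1] bt
      integrable_comb_iterated[OF a(1,2) b(1,2), of "gker q" "1 / (1 - q\<^sup>2)" t t] t q abs_gker_le
    by (intro integral_mono) (auto intro!: stringy abs_tau_le)
  also have "\<dots> \<le> (\<integral>x. (\<integral>y. comb (gker q) (tau x) (t * tau y) \<partial>B) \<partial>A')"
    by (rule degraded_half[OF a(1,2) a'(1,2) b(1,2) t t degA q])
  also have "\<dots> = (\<integral>y. (\<integral>x. comb (gker q) (t * tau y) (tau x) \<partial>A') \<partial>B)"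
    using integral_comb_commute[OF a'(1,2) b(1,2), of 1 t] t q by simp
  also have "\<dots> \<le> (\<integral>y. (\<integral>x. comb (gker q) (tau y) (tau x) \<partial>A') \<partial>B')"
    using degraded_half[OF b(1,2) b'(1,2) a'(1,2) t _ _ degB q, of 1] by simp
  also have "\<dots> = (\<integral>x. (\<integral>y. comb (gker q) (tau x) (tau y) \<partial>B') \<partial>A')"
    using integral_comb_commute[OF b'(1,2) a'(1,2), of 1 1] q by simp
  also have "\<dots> = (\<integral>r. gker q (tau r) \<partial>conv A' B')"
    using integral_conv_gker[OF A' B' q, of 1] by simp
  finally show "(\<integral>r. gker q (t * tau r) \<partial>conv A B) \<le> (\<integral>r. gker q (tau r) \<partial>conv A' B')" .
qed

lemma symmetric_trivial: "symmetric_dist trivial_dist"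
  unfolding trivial_dist_def
proof (rule symmetric_distI)
  show "prob_space (return borel (0::ereal))" by (intro prob_space_return) auto
  fix u :: "real \<Rightarrow> real" assume [measurable]: "u \<in> borel_measurable borel" and odd: "\<And>x. u (- x) = - u x"
  show "(\<integral>r. (1 - tau r) * u (tau r) \<partial>return borel 0) = 0"
    using odd[of 0] by (subst integral_return) auto
qed simp

lemma integral_trivial [simp]: "f \<in> borel_measurable borel \<Longrightarrow> (\<integral>r. f r \<partial>trivial_dist) = f 0"
  for f :: "ereal \<Rightarrow> real"
  unfolding trivial_dist_def by (rule integral_return) auto

lemma degraded_trivial:
  assumes "prob_space A"
  shows "degraded t trivial_dist A"
  using assms by (auto simp: degraded_def gker_nonneg abs_tau_le intro!: integral_nonneg_AE)

section \<open>Messages passed through the flip channel\<close>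

definition message :: "real \<Rightarrow> ereal measure \<Rightarrow> ereal measure" where
  "message \<delta> \<mu> = distr (measure_pmf (sign_pmf \<delta>) \<Otimes>\<^sub>M \<mu>) borel (\<lambda>(z, r). z * F_ext \<delta> r)"

lemma sets_message [simp, measurable_cong]: "sets (message \<delta> \<mu>) = sets borel"
  by (simp add: message_def)

lemma measurable_message:
  assumes [measurable_cong]: "sets \<mu> = sets borel"
  shows "(\<lambda>(z, r). z * F_ext \<delta> r) \<in> borel_measurable (measure_pmf (sign_pmf \<delta>) \<Otimes>\<^sub>M \<mu>)"
proof -
  have [measurable]: "fst \<in> borel_measurable (measure_pmf (sign_pmf \<delta>) \<Otimes>\<^sub>M \<mu>)"
    by (rule measurable_compose[OF measurable_fst]) simp
  have "(\<lambda>w. fst w * F_ext \<delta> (snd w)) \<in> borel_measurable (measure_pmf (sign_pmf \<delta>) \<Otimes>\<^sub>M \<mu>)"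
    by measurable
  thus ?thesis by (simp add: case_prod_beta)
qed

lemma prob_space_message:
  assumes "prob_space \<mu>" "sets \<mu> = sets borel"
  shows "prob_space (message \<delta> \<mu>)"
proof -
  interpret prob_space \<mu> by fact
  interpret pair_prob_space "measure_pmf (sign_pmf \<delta>)" \<mu> ..
  show ?thesis
    unfolding message_def by (intro prob_space_distr measurable_message assms)
qed

lemma integral_message:
  fixes k :: "real \<Rightarrow> real"
  assumes \<delta>: "0 \<le> \<delta>" "\<delta> \<le> 1" and \<mu>: "symmetric_dist \<mu>"
    and k [measurable]: "k \<in> borel_measurable borel" and bd: "\<And>x. \<bar>x\<bar> \<le> 1 \<Longrightarrow> \<bar>k x\<bar> \<le> K"
  shows "(\<integral>y. k (tau y) \<partial>message \<delta> \<mu>) =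
    (\<integral>r. (1 - \<delta>) * k ((1 - 2 * \<delta>) * tau r) + \<delta> * k (- ((1 - 2 * \<delta>) * tau r)) \<partial>\<mu>)"
proof -
  note s = symmetric_distD[OF \<mu>]
  note [measurable_cong] = s(2)
  note [measurable] = measurable_message[OF s(2)]
  interpret prob_space \<mu> by (rule s)
  interpret P: pair_prob_space "measure_pmf (sign_pmf \<delta>)" \<mu> ..
  have b: "\<bar>k (tau r)\<bar> \<le> K" for r using bd abs_tau_le by auto
  have i: "integrable \<mu> (\<lambda>r. k (tau (z * F_ext \<delta> r)))" for z
    using b by (intro integrable_bounded[OF s(1), of _ K]) auto
  have "(\<integral>y. k (tau y) \<partial>message \<delta> \<mu>) = (\<integral>w. k (tau (case w of (z, r) \<Rightarrow> z * F_ext \<delta> r)) \<partial>(measure_pmf (sign_pmf \<delta>) \<Otimes>\<^sub>M \<mu>))"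
    unfolding message_def by (subst integral_distr) auto
  also have "\<dots> = (\<integral>z. (\<integral>r. k (tau (z * F_ext \<delta> r)) \<partial>\<mu>) \<partial>measure_pmf (sign_pmf \<delta>))"
    by (subst P.integral_fst'[symmetric]) (auto intro!: integrable_bounded[of _ _ K] b P.prob_space_axioms)
  also have "\<dots> = (1 - \<delta>) * (\<integral>r. k (tau (F_ext \<delta> r)) \<partial>\<mu>) + \<delta> * (\<integral>r. k (- tau (F_ext \<delta> r)) \<partial>\<mu>)"
    using \<delta> by (simp add: sign_pmf_def integral_bernoulli_pmf)
  also have "\<dots> = (\<integral>r. (1 - \<delta>) * k (tau (F_ext \<delta> r)) + \<delta> * k (- tau (F_ext \<delta> r)) \<partial>\<mu>)"
    using i[of 1] i[of "-1"] by simp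
  also have "\<dots> = (\<integral>r. (1 - \<delta>) * k ((1 - 2 * \<delta>) * tau r) + \<delta> * k (- ((1 - 2 * \<delta>) * tau r)) \<partial>\<mu>)"
    using s(3) by (intro integral_cong_AE) (auto simp: tau_F_ext \<delta> elim!: eventually_mono)
  finally show ?thesis .
qed

text \<open>Averaging an odd test over the sign gives the weight (1 - \<delta>) (1 - \<theta> x) -
  \<delta> (1 + \<theta> x) = \<theta> (1 - x), so a test for the message is a test for \<mu> with
  the odd function \<theta> u (\<theta> x).\<close>

lemma symmetric_message:
  assumes \<delta>: "0 \<le> \<delta>" "\<delta> \<le> 1" and \<mu>: "symmetric_dist \<mu>"
  shows "symmetric_dist (message \<delta> \<mu>)"
proof (rule symmetric_distI)
  note s = symmetric_distD[OF \<mu>]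
  show "prob_space (message \<delta> \<mu>)" by (intro prob_space_message s)
  fix u :: "real \<Rightarrow> real" assume u [measurable]: "u \<in> borel_measurable borel"
    and odd: "\<And>x. u (- x) = - u x" and bd: "\<And>x. \<bar>u x\<bar> \<le> 1"
  define \<theta> where "\<theta> = 1 - 2 * \<delta>"
  have bk: "\<bar>(1 - x) * u x\<bar> \<le> 2 * 1" if "\<bar>x\<bar> \<le> 1" for x
    unfolding abs_mult using that bd[of x] by (intro mult_mono) auto
  have "(\<integral>y. (1 - tau y) * u (tau y) \<partial>message \<delta> \<mu>) =
      (\<integral>r. (1 - \<delta>) * ((1 - \<theta> * tau r) * u (\<theta> * tau r)) + \<delta> * ((1 - - (\<theta> * tau r)) * u (- (\<theta> * tau r))) \<partial>\<mu>)"
    unfolding \<theta>_def by (rule integral_message[OF \<delta> \<mu>, of "\<lambda>x. (1 - x) * u x" "2 * 1"]) (use bk in auto)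
  also have "(\<lambda>r. (1 - \<delta>) * ((1 - \<theta> * tau r) * u (\<theta> * tau r)) + \<delta> * ((1 - - (\<theta> * tau r)) * u (- (\<theta> * tau r)))) =
      (\<lambda>r. (1 - tau r) * (\<theta> * u (\<theta> * tau r)))"
    by (auto simp: fun_eq_iff odd) (simp add: \<theta>_def algebra_simps)
  also have "(\<integral>r. (1 - tau r) * (\<theta> * u (\<theta> * tau r)) \<partial>\<mu>) = 0"
  proof (rule symmetric_dist_odd[OF \<mu>, of "\<lambda>x. \<theta> * u (\<theta> * x)" 1])
    show "\<bar>\<theta> * u (\<theta> * x)\<bar> \<le> 1" for x
      using \<delta> bd[of "\<theta> * x"] unfolding abs_mult \<theta>_def by (intro mult_le_one) auto
  qed (use odd in auto)
  finally show "(\<integral>y. (1 - tau y) * u (tau y) \<partial>message \<delta> \<mu>) = 0" .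
qed simp

text \<open>The random sign is invisible to an even test, and the scaling by 1 - 2 \<delta> is
  absorbed into q.\<close>

lemma integral_message_gker:
  assumes \<delta>: "0 \<le> \<delta>" "\<delta> \<le> 1" and \<mu>: "symmetric_dist \<mu>" and q: "\<bar>q\<bar> < 1" and t: "0 \<le> t" "t \<le> 1"
  shows "(\<integral>y. gker q (t * tau y) \<partial>message \<delta> \<mu>) = (1 - 2 * \<delta>)\<^sup>2 * (\<integral>r. gker ((1 - 2 * \<delta>) * q) (t * tau r) \<partial>\<mu>)"
proof -
  let ?\<theta> = "1 - 2 * \<delta>"
  have bt: "\<bar>gker q (t * x)\<bar> \<le> 1 / (1 - q\<^sup>2)" if "\<bar>x\<bar> \<le> 1" for x
  proof -
    have "\<bar>t * x\<bar> \<le> 1" using that t by (simp add: abs_mult mult_le_one)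
    thus ?thesis using q by (rule abs_gker_le[rotated])
  qed
  have "gker q (t * (- (?\<theta> * x))) = gker q (t * (?\<theta> * x))" for x
    using gker_minus(1)[of q "t * (?\<theta> * x)"] by (simp only: mult_minus_left mult_minus_right)
  moreover have "gker q (t * (?\<theta> * x)) = ?\<theta>\<^sup>2 * gker (?\<theta> * q) (t * x)" for x
    using gker_scale[of q ?\<theta> "t * x"] by (simp add: mult.left_commute)
  ultimately have "(1 - \<delta>) * gker q (t * (?\<theta> * x)) + \<delta> * gker q (t * (- (?\<theta> * x))) = ?\<theta>\<^sup>2 * gker (?\<theta> * q) (t * x)" for x
    by (simp only: distrib_right[symmetric]) simp
  thus ?thesis
    using bt by (subst integral_message[OF \<delta> \<mu>, of "\<lambda>x. gker q (t * x)" "1 / (1 - q\<^sup>2)"]) (simp_all only: integral_mult_right_zero, simp_all)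
qed

lemma degraded_message:
  assumes \<delta>: "0 \<le> \<delta>" "\<delta> \<le> 1" and \<mu>: "symmetric_dist \<mu>" and \<nu>: "symmetric_dist \<nu>" and t: "0 \<le> t" "t \<le> 1"
    and deg: "degraded t \<mu> \<nu>"
  shows "degraded t (message \<delta> \<mu>) (message \<delta> \<nu>)"
  unfolding degraded_def
proof safe
  fix q :: real assume q: "\<bar>q\<bar> < 1"
  have "\<bar>(1 - 2 * \<delta>) * q\<bar> < 1"
    using mult_sq_less_one(3)[OF q, of "1 - 2 * \<delta>"] \<delta> by (simp add: mult.commute)
  hence "(\<integral>r. gker ((1 - 2 * \<delta>) * q) (t * tau r) \<partial>\<mu>) \<le> (\<integral>r. gker ((1 - 2 * \<delta>) * q) (tau r) \<partial>\<nu>)"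
    using deg by (simp add: degraded_def)
  thus "(\<integral>r. gker q (t * tau r) \<partial>message \<delta> \<mu>) \<le> (\<integral>r. gker q (tau r) \<partial>message \<delta> \<nu>)"
    using integral_message_gker[OF \<delta> \<mu> q t] integral_message_gker[OF \<delta> \<nu> q, of 1]
    by (simp add: mult_left_mono)
qed

section \<open>The BP operator\<close>

primrec branches :: "ereal measure \<Rightarrow> nat \<Rightarrow> ereal measure" where
  "branches \<kappa> 0 = trivial_dist"
| "branches \<kappa> (Suc k) = conv \<kappa> (branches \<kappa> k)"

lemma sets_branches [simp, measurable_cong]: "sets (branches \<kappa> k) = sets borel"
  by (cases k) (simp_all add: trivial_dist_def)

lemma symmetric_branches: "symmetric_dist \<kappa> \<Longrightarrow> symmetric_dist (branches \<kappa> k)"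
  by (induction k) (simp_all add: symmetric_trivial symmetric_conv)

lemma prob_space_branches: "prob_space \<kappa> \<Longrightarrow> sets \<kappa> = sets borel \<Longrightarrow> prob_space (branches \<kappa> k)"
proof (induction k)
  case 0
  show ?case using symmetric_distD(1)[OF symmetric_trivial] by simp
qed (simp add: prob_space_conv)

lemma degraded_branches:
  assumes "symmetric_dist \<kappa>" "symmetric_dist \<kappa>'" "0 \<le> t" "t \<le> 1" "degraded t \<kappa> \<kappa>'"
  shows "degraded t (branches \<kappa> k) (branches \<kappa>' k)"
proof (induction k)
  case 0
  show ?case using symmetric_distD(1)[OF symmetric_trivial] by (simp add: degraded_trivial)
next
  case (Suc k)
  thus ?case using assms by (simp add: degraded_conv symmetric_branches)
qed

lemma nn_integral_conv:
  assumes "prob_space B" "sets A = sets borel" "sets B = sets borel"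
    and [measurable]: "f \<in> borel_measurable borel"
  shows "(\<integral>\<^sup>+r. f r \<partial>conv A B) = (\<integral>\<^sup>+x. (\<integral>\<^sup>+y. f (x + y) \<partial>B) \<partial>A)"
proof -
  note [measurable_cong] = assms(2,3)
  interpret B: prob_space B by fact
  have "(\<integral>\<^sup>+r. f r \<partial>conv A B) = (\<integral>\<^sup>+z. f (fst z + snd z) \<partial>(A \<Otimes>\<^sub>M B))"
    unfolding conv_def by (subst nn_integral_distr) (auto simp: case_prod_beta)
  also have "\<dots> = (\<integral>\<^sup>+x. (\<integral>\<^sup>+y. f (x + y) \<partial>B) \<partial>A)"
    by (subst B.nn_integral_fst[symmetric]) auto
  finally show ?thesis .
qed

lemma nn_integral_message:
  assumes "prob_space \<mu>" "sets \<mu> = sets borel" and [measurable]: "f \<in> borel_measurable borel"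
  shows "(\<integral>\<^sup>+y. f y \<partial>message \<delta> \<mu>) = (\<integral>\<^sup>+z. (\<integral>\<^sup>+r. f (z * F_ext \<delta> r) \<partial>\<mu>) \<partial>measure_pmf (sign_pmf \<delta>))"
proof -
  interpret prob_space \<mu> by fact
  note [measurable] = measurable_message[OF assms(2)]
  have "(\<integral>\<^sup>+y. f y \<partial>message \<delta> \<mu>) =
      (\<integral>\<^sup>+w. f (case w of (z, r) \<Rightarrow> z * F_ext \<delta> r) \<partial>(measure_pmf (sign_pmf \<delta>) \<Otimes>\<^sub>M \<mu>))"
    unfolding message_def by (subst nn_integral_distr) auto
  also have "\<dots> = (\<integral>\<^sup>+z. (\<integral>\<^sup>+r. f (z * F_ext \<delta> r) \<partial>\<mu>) \<partial>measure_pmf (sign_pmf \<delta>))"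
    by (subst nn_integral_fst[symmetric]) auto
  finally show ?thesis .
qed

text \<open>Overwriting one coordinate of an i.i.d. sequence by a fresh sample keeps its law. This
  isolates a single branch while the index set stays UNIV.\<close>

lemma nn_integral_PiM_resample:
  fixes M :: "'a measure" and i :: nat
  assumes "prob_space M" and [measurable]: "g \<in> borel_measurable (\<Pi>\<^sub>M u\<in>UNIV. M)"
  shows "(\<integral>\<^sup>+\<omega>. g \<omega> \<partial>(\<Pi>\<^sub>M u\<in>UNIV. M)) = (\<integral>\<^sup>+x. (\<integral>\<^sup>+\<omega>. g (fun_upd \<omega> i x) \<partial>(\<Pi>\<^sub>M u\<in>UNIV. M)) \<partial>M)"
proof -
  interpret prob_space "\<Pi>\<^sub>M u\<in>(UNIV::nat set). M"
    using assms(1) by (intro prob_space_PiM) auto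
  have [measurable]: "(\<lambda>(x, X). X(i := x)) \<in> M \<Otimes>\<^sub>M (\<Pi>\<^sub>M u\<in>UNIV. M) \<rightarrow>\<^sub>M (\<Pi>\<^sub>M u\<in>UNIV. M)"
  proof -
    have "(\<lambda>w. (snd w)(i := fst w)) \<in> M \<Otimes>\<^sub>M (\<Pi>\<^sub>M u\<in>UNIV. M) \<rightarrow>\<^sub>M (\<Pi>\<^sub>M u\<in>UNIV. M)"
      by (rule measurable_fun_upd[where J = UNIV]) auto
    thus ?thesis by (simp add: case_prod_beta')
  qed
  have "(\<Pi>\<^sub>M u\<in>UNIV. M) = distr (M \<Otimes>\<^sub>M (\<Pi>\<^sub>M u\<in>UNIV. M)) (\<Pi>\<^sub>M u\<in>UNIV. M) (\<lambda>(x, X). X(i := x))"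
    using distr_pair_PiM_eq_PiM[of UNIV "\<lambda>_. M" i] assms(1) by simp
  hence "(\<integral>\<^sup>+\<omega>. g \<omega> \<partial>(\<Pi>\<^sub>M u\<in>UNIV. M)) =
      (\<integral>\<^sup>+\<omega>. g \<omega> \<partial>distr (M \<Otimes>\<^sub>M (\<Pi>\<^sub>M u\<in>UNIV. M)) (\<Pi>\<^sub>M u\<in>UNIV. M) (\<lambda>(x, X). X(i := x)))"
    by simp
  also have "\<dots> = (\<integral>\<^sup>+w. g (case w of (x, X) \<Rightarrow> X(i := x)) \<partial>(M \<Otimes>\<^sub>M (\<Pi>\<^sub>M u\<in>UNIV. M)))"
    by (subst nn_integral_distr) auto
  also have "\<dots> = (\<integral>\<^sup>+x. (\<integral>\<^sup>+\<omega>. g (fun_upd \<omega> i x) \<partial>(\<Pi>\<^sub>M u\<in>UNIV. M)) \<partial>M)"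
    by (subst nn_integral_fst[symmetric]) auto
  finally show ?thesis .
qed

lemma measurable_branch_sum:
  assumes \<mu>: "sets \<mu> = sets borel"
    and a: "a \<in> N \<rightarrow>\<^sub>M (\<Pi>\<^sub>M u\<in>(UNIV::nat set). measure_pmf (sign_pmf \<delta>'))"
    and b: "b \<in> N \<rightarrow>\<^sub>M (\<Pi>\<^sub>M u\<in>(UNIV::nat set). \<mu>)"
  shows "(\<lambda>w. \<Sum>u=1..j. a w u * F_ext \<delta> (b w u)) \<in> borel_measurable N"
proof -
  have [measurable]: "(\<lambda>w. a w u) \<in> borel_measurable N" for u
  proof -
    have "(\<lambda>w. a w u) \<in> N \<rightarrow>\<^sub>M measure_pmf (sign_pmf \<delta>')" using a by measurable
    thus ?thesis by (rule measurable_compose) simp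
  qed
  have [measurable]: "(\<lambda>w. b w u) \<in> borel_measurable N" for u
  proof -
    have "(\<lambda>w. b w u) \<in> N \<rightarrow>\<^sub>M \<mu>" using b by measurable
    thus ?thesis by (simp add: measurable_cong_sets[OF refl \<mu>])
  qed
  show ?thesis by measurable
qed

text \<open>Induction on the number of branches: coordinate \<open>Suc k\<close> is resampled in
  both sequences, the sum over 1..k does not see it, and the fresh sign and ratio together
  contribute one message.\<close>

lemma nn_integral_branches:
  fixes f :: "ereal \<Rightarrow> ennreal"
  assumes \<mu>: "prob_space \<mu>" "sets \<mu> = sets borel" and f: "f \<in> borel_measurable borel"
  shows "(\<integral>\<^sup>+Z. (\<integral>\<^sup>+R. f (\<Sum>u=1..k. Z u * F_ext \<delta> (R u)) \<partial>(\<Pi>\<^sub>M u\<in>(UNIV::nat set). \<mu>))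
      \<partial>(\<Pi>\<^sub>M u\<in>(UNIV::nat set). measure_pmf (sign_pmf \<delta>))) = (\<integral>\<^sup>+r. f r \<partial>branches (message \<delta> \<mu>) k)"
  using f
proof (induction k arbitrary: f)
  case 0
  interpret Z: prob_space "\<Pi>\<^sub>M u\<in>(UNIV::nat set). measure_pmf (sign_pmf \<delta>)"
    by (intro prob_space_PiM) (simp add: prob_space_measure_pmf)
  interpret R: prob_space "\<Pi>\<^sub>M u\<in>(UNIV::nat set). \<mu>"
    using \<mu> by (intro prob_space_PiM)
  show ?case
    using 0 by (simp add: trivial_dist_def nn_integral_return Z.emeasure_space_1 R.emeasure_space_1)
next
  case (Suc k)
  note [measurable] = Suc.prems
  note [measurable_cong] = \<mu>(2)
  let ?P = "measure_pmf (sign_pmf \<delta>)"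
  let ?Z = "\<Pi>\<^sub>M u\<in>(UNIV::nat set). ?P"
  let ?R = "\<Pi>\<^sub>M u\<in>(UNIV::nat set). \<mu>"
  interpret Z: prob_space ?Z by (intro prob_space_PiM) (simp add: prob_space_measure_pmf)
  interpret R: prob_space ?R using \<mu> by (intro prob_space_PiM)
  interpret M: prob_space \<mu> by fact
  interpret ZM: pair_sigma_finite ?Z \<mu> ..
  define h where "h j Z R = (\<Sum>u=1..j. Z u * F_ext \<delta> (R u))" for j :: nat and Z R
  have [measurable]: "(\<lambda>w. h j (a w) (b w)) \<in> borel_measurable N" if "a \<in> N \<rightarrow>\<^sub>M ?Z" "b \<in> N \<rightarrow>\<^sub>M ?R"
    for a b j and N :: "'x measure"
    unfolding h_def by (rule measurable_branch_sum[OF \<mu>(2) that])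
  have hS: "h (Suc k) (fun_upd Z (Suc k) z) (fun_upd R (Suc k) r) = h k Z R + z * F_ext \<delta> r" for Z R z r
  proof -
    have "(\<Sum>u=1..k. (fun_upd Z (Suc k) z) u * F_ext \<delta> ((fun_upd R (Suc k) r) u)) = h k Z R"
      unfolding h_def by (intro sum.cong) auto
    thus ?thesis by (simp add: h_def)
  qed
  have "(\<integral>\<^sup>+Z. (\<integral>\<^sup>+R. f (h (Suc k) Z R) \<partial>?R) \<partial>?Z) =
      (\<integral>\<^sup>+z. (\<integral>\<^sup>+Z. (\<integral>\<^sup>+R. f (h (Suc k) (fun_upd Z (Suc k) z) R) \<partial>?R) \<partial>?Z) \<partial>?P)"
    by (rule nn_integral_PiM_resample) (auto simp: prob_space_measure_pmf)
  also have "\<dots> = (\<integral>\<^sup>+z. (\<integral>\<^sup>+Z. (\<integral>\<^sup>+r. (\<integral>\<^sup>+R. f (h k Z R + z * F_ext \<delta> r) \<partial>?R) \<partial>\<mu>) \<partial>?Z) \<partial>?P)"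
  proof (rule nn_integral_cong, rule nn_integral_cong)
    fix z Z assume [measurable]: "Z \<in> space ?Z"
    have [measurable]: "fun_upd Z (Suc k) z \<in> space ?Z" by (simp add: space_PiM)
    show "(\<integral>\<^sup>+R. f (h (Suc k) (fun_upd Z (Suc k) z) R) \<partial>?R) = (\<integral>\<^sup>+r. (\<integral>\<^sup>+R. f (h k Z R + z * F_ext \<delta> r) \<partial>?R) \<partial>\<mu>)"
      by (subst nn_integral_PiM_resample[OF \<mu>(1), of _ "Suc k"]) (auto simp: hS)
  qed
  \<comment> \<open>The resampled r is moved outside the signs Z, so that the induction hypothesis
    applies to the inner double integral with f shifted by
    \<open>z * F_ext \<delta> r\<close>.\<close>
  also have "\<dots> = (\<integral>\<^sup>+z. (\<integral>\<^sup>+r. (\<integral>\<^sup>+Z. (\<integral>\<^sup>+R. f (h k Z R + z * F_ext \<delta> r) \<partial>?R) \<partial>?Z) \<partial>\<mu>) \<partial>?P)"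
    by (intro nn_integral_cong ZM.Fubini'[symmetric]) measurable
  also have "\<dots> = (\<integral>\<^sup>+z. (\<integral>\<^sup>+r. (\<integral>\<^sup>+s. f (s + z * F_ext \<delta> r) \<partial>branches (message \<delta> \<mu>) k) \<partial>\<mu>) \<partial>?P)"
    unfolding h_def by (intro nn_integral_cong Suc.IH) measurable
  also have "\<dots> = (\<integral>\<^sup>+y. (\<integral>\<^sup>+s. f (s + y) \<partial>branches (message \<delta> \<mu>) k) \<partial>message \<delta> \<mu>)"
  proof (rule nn_integral_message[OF \<mu>, symmetric])
    interpret prob_space "branches (message \<delta> \<mu>) k"
      by (intro prob_space_branches prob_space_message \<mu>) simp
    show "(\<lambda>y. \<integral>\<^sup>+s. f (s + y) \<partial>branches (message \<delta> \<mu>) k) \<in> borel_measurable borel"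
      by measurable
  qed
  also have "\<dots> = (\<integral>\<^sup>+r. f r \<partial>branches (message \<delta> \<mu>) (Suc k))"
    using \<mu> by (simp add: nn_integral_conv prob_space_branches prob_space_message add.commute)
  finally show ?case by (simp add: h_def)
qed

text \<open>Conditioning on the degree presents the law as a mixture of convolutions, so that the
  comparisons for sums can be used for each degree separately.\<close>

lemma nn_integral_BP:
  fixes f :: "ereal \<Rightarrow> ennreal"
  assumes \<mu>: "prob_space \<mu>" "sets \<mu> = sets borel" and \<mu>s: "prob_space \<mu>s" "sets \<mu>s = sets borel"
    and f [measurable]: "f \<in> borel_measurable borel"
  shows "(\<integral>\<^sup>+r. f r \<partial>BP_operator P \<delta> \<mu>s \<mu>) =
    (\<integral>\<^sup>+k. (\<integral>\<^sup>+r. f r \<partial>conv (branches (message \<delta> \<mu>) k) \<mu>s) \<partial>measure_pmf P)"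
proof -
  let ?P = "measure_pmf (sign_pmf \<delta>)"
  let ?Z = "\<Pi>\<^sub>M u\<in>(UNIV::nat set). ?P"
  let ?R = "\<Pi>\<^sub>M u\<in>(UNIV::nat set). \<mu>"
  note [measurable_cong] = \<mu>(2) \<mu>s(2)
  note meas = BP_operator_measurable[OF \<mu>(2) \<mu>s(2), of \<delta> P]
  interpret Z: prob_space ?Z by (intro prob_space_PiM) (simp add: prob_space_measure_pmf)
  interpret R: prob_space ?R using \<mu> by (intro prob_space_PiM)
  interpret S: prob_space \<mu>s by fact
  interpret RS: prob_space "?R \<Otimes>\<^sub>M \<mu>s" by (intro prob_space_pair R.prob_space_axioms \<mu>s)
  interpret ZRS: prob_space "?Z \<Otimes>\<^sub>M ?R \<Otimes>\<^sub>M \<mu>s"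
    by (intro prob_space_pair Z.prob_space_axioms RS.prob_space_axioms)
  define h where "h j Z R = (\<Sum>u=1..j. Z u * F_ext \<delta> (R u))" for j :: nat and Z R
  have [measurable]: "(\<lambda>w. h j (a w) (b w)) \<in> borel_measurable N" if "a \<in> N \<rightarrow>\<^sub>M ?Z" "b \<in> N \<rightarrow>\<^sub>M ?R"
    for a b j and N :: "'x measure"
    unfolding h_def by (rule measurable_branch_sum[OF \<mu>(2) that])
  define T where "T w = (case w of (d, Z, R, S) \<Rightarrow> h d Z R + S)" for w :: "nat \<times> (nat \<Rightarrow> ereal) \<times> (nat \<Rightarrow> ereal) \<times> ereal"
  have T: "T \<in> borel_measurable (measure_pmf P \<Otimes>\<^sub>M ?Z \<Otimes>\<^sub>M ?R \<Otimes>\<^sub>M \<mu>s)"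
    using meas unfolding T_def h_def .
  have "(\<integral>\<^sup>+r. f r \<partial>BP_operator P \<delta> \<mu>s \<mu>) = (\<integral>\<^sup>+r. f r \<partial>distr (measure_pmf P \<Otimes>\<^sub>M ?Z \<Otimes>\<^sub>M ?R \<Otimes>\<^sub>M \<mu>s) borel T)"
    unfolding BP_operator_def T_def h_def ..
  also have "\<dots> = (\<integral>\<^sup>+w. f (T w) \<partial>(measure_pmf P \<Otimes>\<^sub>M ?Z \<Otimes>\<^sub>M ?R \<Otimes>\<^sub>M \<mu>s))"
    by (subst nn_integral_distr[OF T]) simp_all
  also have "\<dots> = (\<integral>\<^sup>+d. (\<integral>\<^sup>+w. f (T (d, w)) \<partial>(?Z \<Otimes>\<^sub>M ?R \<Otimes>\<^sub>M \<mu>s)) \<partial>measure_pmf P)"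
    by (rule ZRS.nn_integral_fst[symmetric]) (rule measurable_compose[OF T f])
  also have "\<dots> = (\<integral>\<^sup>+d. (\<integral>\<^sup>+Z. (\<integral>\<^sup>+R. (\<integral>\<^sup>+S. f (h d Z R + S) \<partial>\<mu>s) \<partial>?R) \<partial>?Z) \<partial>measure_pmf P)"
  proof (rule nn_integral_cong)
    fix d
    have "(\<integral>\<^sup>+w. f (T (d, w)) \<partial>(?Z \<Otimes>\<^sub>M ?R \<Otimes>\<^sub>M \<mu>s)) = (\<integral>\<^sup>+w. f (h d (fst w) (fst (snd w)) + snd (snd w)) \<partial>(?Z \<Otimes>\<^sub>M ?R \<Otimes>\<^sub>M \<mu>s))"
      by (simp add: T_def case_prod_beta)
    also have "\<dots> = (\<integral>\<^sup>+Z. (\<integral>\<^sup>+v. f (h d Z (fst v) + snd v) \<partial>(?R \<Otimes>\<^sub>M \<mu>s)) \<partial>?Z)"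
      by (subst RS.nn_integral_fst[symmetric]) simp_all
    also have "\<dots> = (\<integral>\<^sup>+Z. (\<integral>\<^sup>+R. (\<integral>\<^sup>+S. f (h d Z R + S) \<partial>\<mu>s) \<partial>?R) \<partial>?Z)"
      by (intro nn_integral_cong) (subst S.nn_integral_fst[symmetric], simp_all)
    finally show "(\<integral>\<^sup>+w. f (T (d, w)) \<partial>(?Z \<Otimes>\<^sub>M ?R \<Otimes>\<^sub>M \<mu>s)) =
      (\<integral>\<^sup>+Z. (\<integral>\<^sup>+R. (\<integral>\<^sup>+S. f (h d Z R + S) \<partial>\<mu>s) \<partial>?R) \<partial>?Z)" .
  qed
  also have "\<dots> = (\<integral>\<^sup>+d. (\<integral>\<^sup>+r. (\<integral>\<^sup>+S. f (r + S) \<partial>\<mu>s) \<partial>branches (message \<delta> \<mu>) d) \<partial>measure_pmf P)"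
    unfolding h_def by (intro nn_integral_cong nn_integral_branches[OF \<mu>]) measurable
  also have "\<dots> = (\<integral>\<^sup>+d. (\<integral>\<^sup>+r. f r \<partial>conv (branches (message \<delta> \<mu>) d) \<mu>s) \<partial>measure_pmf P)"
    using \<mu> \<mu>s by (intro nn_integral_cong nn_integral_conv[symmetric]) auto
  finally show ?thesis .
qed

lemma sets_BP [simp, measurable_cong]: "sets (BP_operator P \<delta> \<mu>s \<mu>) = sets borel"
  by (simp add: BP_operator_def)

lemma BP_eq_bind:
  assumes \<mu>: "prob_space \<mu>" "sets \<mu> = sets borel" and \<mu>s: "prob_space \<mu>s" "sets \<mu>s = sets borel"
  shows "BP_operator P \<delta> \<mu>s \<mu> = measure_pmf P \<bind> (\<lambda>k. conv (branches (message \<delta> \<mu>) k) \<mu>s)"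
    and "(\<lambda>k. conv (branches (message \<delta> \<mu>) k) \<mu>s) \<in> measure_pmf P \<rightarrow>\<^sub>M subprob_algebra borel"
proof -
  have p: "prob_space (conv (branches (message \<delta> \<mu>) k) \<mu>s)" for k
    using \<mu> \<mu>s by (intro prob_space_conv prob_space_branches prob_space_message) auto
  show *: "(\<lambda>k. conv (branches (message \<delta> \<mu>) k) \<mu>s) \<in> measure_pmf P \<rightarrow>\<^sub>M subprob_algebra borel"
    by (auto simp: space_subprob_algebra intro!: prob_space_imp_subprob_space p)
  show "BP_operator P \<delta> \<mu>s \<mu> = measure_pmf P \<bind> (\<lambda>k. conv (branches (message \<delta> \<mu>) k) \<mu>s)"
  proof (rule measure_eqI)
    show "sets (BP_operator P \<delta> \<mu>s \<mu>) = sets (measure_pmf P \<bind> (\<lambda>k. conv (branches (message \<delta> \<mu>) k) \<mu>s))"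
      using sets_bind[OF sets_kernel[OF *]] by simp
    fix X assume "X \<in> sets (BP_operator P \<delta> \<mu>s \<mu>)"
    hence X: "X \<in> sets borel" by simp
    hence "emeasure (BP_operator P \<delta> \<mu>s \<mu>) X = (\<integral>\<^sup>+r. indicator X r \<partial>BP_operator P \<delta> \<mu>s \<mu>)"
      by simp
    also have "\<dots> = (\<integral>\<^sup>+k. emeasure (conv (branches (message \<delta> \<mu>) k) \<mu>s) X \<partial>measure_pmf P)"
      using X by (subst nn_integral_BP[OF \<mu> \<mu>s]) auto
    also have "\<dots> = emeasure (measure_pmf P \<bind> (\<lambda>k. conv (branches (message \<delta> \<mu>) k) \<mu>s)) X"
      using X * by (subst emeasure_bind[OF _ *]) auto
    finally show "emeasure (BP_operator P \<delta> \<mu>s \<mu>) X = emeasure (measure_pmf P \<bind> (\<lambda>k. conv (branches (message \<delta> \<mu>) k) \<mu>s)) X" .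
  qed
qed

lemma integral_BP:
  fixes f :: "ereal \<Rightarrow> real"
  assumes \<mu>: "prob_space \<mu>" "sets \<mu> = sets borel" and \<mu>s: "prob_space \<mu>s" "sets \<mu>s = sets borel"
    and f: "f \<in> borel_measurable borel" and bd: "\<And>x. \<bar>f x\<bar> \<le> K"
  shows "(\<integral>r. f r \<partial>BP_operator P \<delta> \<mu>s \<mu>) = (\<integral>k. (\<integral>r. f r \<partial>conv (branches (message \<delta> \<mu>) k) \<mu>s) \<partial>measure_pmf P)"
proof -
  have p: "prob_space (conv (branches (message \<delta> \<mu>) k) \<mu>s)" for k
    using \<mu> \<mu>s by (intro prob_space_conv prob_space_branches prob_space_message) auto
  show ?thesis
    unfolding BP_eq_bind(1)[OF \<mu> \<mu>s]
  proof (rule integral_bind[OF f _ BP_eq_bind(2)[OF \<mu> \<mu>s], where B = K and B' = 1])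
    show "AE k in measure_pmf P. emeasure (conv (branches (message \<delta> \<mu>) k) \<mu>s) (space (conv (branches (message \<delta> \<mu>) k) \<mu>s)) \<le> ennreal 1"
      using prob_space.emeasure_space_1[OF p] by simp
  qed (auto simp: bd measure_pmf.finite_measure_axioms)
qed

lemma prob_space_BP:
  assumes \<mu>: "prob_space \<mu>" "sets \<mu> = sets borel" and \<mu>s: "prob_space \<mu>s" "sets \<mu>s = sets borel"
  shows "prob_space (BP_operator P \<delta> \<mu>s \<mu>)"
proof (rule prob_spaceI)
  have p: "prob_space (conv (branches (message \<delta> \<mu>) k) \<mu>s)" for k
    using \<mu> \<mu>s by (intro prob_space_conv prob_space_branches prob_space_message) auto
  have "(\<integral>\<^sup>+r. 1 \<partial>BP_operator P \<delta> \<mu>s \<mu>) = (\<integral>\<^sup>+k. (\<integral>\<^sup>+r. 1 \<partial>conv (branches (message \<delta> \<mu>) k) \<mu>s) \<partial>measure_pmf P)"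
    by (rule nn_integral_BP[OF \<mu> \<mu>s]) simp
  also have "\<dots> = 1"
    using prob_space.emeasure_space_1[OF p] by (simp add: measure_pmf.emeasure_space_1[simplified])
  finally show "emeasure (BP_operator P \<delta> \<mu>s \<mu>) (space (BP_operator P \<delta> \<mu>s \<mu>)) = 1"
    by simp
qed

lemma abs_integral_le:
  fixes f :: "'a \<Rightarrow> real"
  assumes "prob_space M" "f \<in> borel_measurable M" "\<And>x. \<bar>f x\<bar> \<le> K"
  shows "\<bar>\<integral>x. f x \<partial>M\<bar> \<le> K"
proof -
  interpret prob_space M by fact
  have "\<bar>\<integral>x. f x \<partial>M\<bar> \<le> (\<integral>x. K \<partial>M)"
    using assms(3) integrable_bounded[OF assms] by (intro order.trans[OF integral_abs_bound] integral_mono) auto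
  thus ?thesis by (simp add: prob_space)
qed

section \<open>Quantitative gain per application and merging of orbits\<close>

text \<open>
  The correlation \<open>t\<close> is parametrised by \<open>v = t\<^sup>2 / (1 - t\<^sup>2)\<close>: in this scale one application of the BP
  operator gains at least a constant times \<open>(1 + v) powr (-3)\<close>.
\<close>

definition corr :: "real \<Rightarrow> real" where
  "corr v = sqrt (v / (1 + v))"

lemma corr:
  assumes "0 \<le> v"
  shows "0 \<le> corr v" "corr v < 1" "1 - (corr v)\<^sup>2 = 1 / (1 + v)"
proof -
  show "0 \<le> corr v" "corr v < 1" using assms by (simp_all add: corr_def)
  show "1 - (corr v)\<^sup>2 = 1 / (1 + v)" using assms by (simp add: corr_def field_simps)
qed

text \<open>With t = \<open>corr v\<close> and t' = \<open>corr v'\<close>, t'^2 - t^2 equals (v' -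
  v) / ((1 + v) (1 + v')), and the two denominators in \<open>gker_diff\<close> are at least 1 - t^2
  = 1 / (1 + v) and 1 - t'^2 = 1 / (1 + v'). These factors cancel and leave a bound free of
  q.\<close>

lemma gker_corr_diff:
  assumes v: "0 \<le> v" "v \<le> v'" and q: "\<bar>q\<bar> < 1" and x: "\<bar>x\<bar> \<le> 1"
  shows "gker q (corr v' * x) \<le> gker q (corr v * x) + (v' - v)"
proof -
  define t where "t = corr v"
  define t' where "t' = corr v'"
  have v': "0 \<le> v'" using v by simp
  note t = corr[OF v(1), folded t_def] and t' = corr[OF v', folded t'_def]
  have b: "\<bar>t * x\<bar> \<le> 1" "\<bar>t' * x\<bar> \<le> 1" using t t' x by (auto simp: abs_mult mult_le_one)
  have d: "t'\<^sup>2 - t\<^sup>2 = (v' - v) / ((1 + v') * (1 + v))"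
  proof -
    have "t'\<^sup>2 - t\<^sup>2 = 1 / (1 + v) - 1 / (1 + v')" using t t' by linarith
    thus ?thesis using v v' by (simp add: field_simps)
  qed
  have m: "1 / (1 + v) \<le> 1 - q\<^sup>2 * (t * x)\<^sup>2" "1 / (1 + v') \<le> 1 - q\<^sup>2 * (t' * x)\<^sup>2"
  proof -
    have *: "q\<^sup>2 * (s * x)\<^sup>2 \<le> s\<^sup>2" for s
    proof -
      have "q\<^sup>2 * x\<^sup>2 \<le> 1" using mult_sq_less_one(1)[OF q x] by simp
      from mult_left_le[OF this, of "s\<^sup>2"] show ?thesis by (simp add: power_mult_distrib mult_ac)
    qed
    show "1 / (1 + v) \<le> 1 - q\<^sup>2 * (t * x)\<^sup>2" "1 / (1 + v') \<le> 1 - q\<^sup>2 * (t' * x)\<^sup>2"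
      using *[of t] *[of t'] t t' by linarith+
  qed
  have "gker q (t' * x) - gker q (t * x) = (t'\<^sup>2 - t\<^sup>2) * x\<^sup>2 / ((1 - q\<^sup>2 * (t' * x)\<^sup>2) * (1 - q\<^sup>2 * (t * x)\<^sup>2))"
    by (simp add: gker_diff[OF q b(2,1)] power_mult_distrib left_diff_distrib)
  also have "\<dots> \<le> (v' - v) / ((1 + v') * (1 + v)) / (1 / (1 + v') * (1 / (1 + v)))"
  proof (rule frac_le)
    show *: "0 \<le> (v' - v) / ((1 + v') * (1 + v))" using v v' by simp
    have "x\<^sup>2 \<le> 1" using x by (simp add: abs_square_le_1)
    thus "(t'\<^sup>2 - t\<^sup>2) * x\<^sup>2 \<le> (v' - v) / ((1 + v') * (1 + v))"
      unfolding d by (rule mult_left_le[OF _ *])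
    show "0 < 1 / (1 + v') * (1 / (1 + v))" using v v' by simp
    show "1 / (1 + v') * (1 / (1 + v)) \<le> (1 - q\<^sup>2 * (t' * x)\<^sup>2) * (1 - q\<^sup>2 * (t * x)\<^sup>2)"
    proof -
      have "0 \<le> 1 / (1 + v)" "0 \<le> 1 / (1 + v')" using v v' by auto
      moreover from this m have "0 \<le> 1 - q\<^sup>2 * (t' * x)\<^sup>2" by linarith
      ultimately show ?thesis using m by (intro mult_mono)
    qed
  qed
  also have "\<dots> = v' - v" using v v' by simp
  finally show ?thesis by (simp add: t_def t'_def)
qed

context
  fixes \<delta> :: real and P :: "nat pmf" and \<mu>s :: "ereal measure"
  assumes \<delta>: "0 \<le> \<delta>" "\<delta> \<le> 1" and \<mu>s: "symmetric_dist \<mu>s"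
begin

abbreviation (input) "BP \<equiv> BP_operator P \<delta> \<mu>s"

lemma symmetric_node: "symmetric_dist \<mu> \<Longrightarrow> symmetric_dist (conv (branches (message \<delta> \<mu>) k) \<mu>s)"
  by (simp add: symmetric_conv symmetric_branches symmetric_message \<delta> \<mu>s)

lemma symmetric_BP:
  assumes \<mu>: "symmetric_dist \<mu>"
  shows "symmetric_dist (BP \<mu>)"
proof (rule symmetric_distI)
  show "prob_space (BP \<mu>)"
    using symmetric_distD[OF \<mu>] symmetric_distD[OF \<mu>s] by (simp add: prob_space_BP)
  fix u :: "real \<Rightarrow> real" assume u [measurable]: "u \<in> borel_measurable borel"
    and odd: "\<And>x. u (- x) = - u x" and bd: "\<And>x. \<bar>u x\<bar> \<le> 1"
  have bk: "\<bar>(1 - tau r) * u (tau r)\<bar> \<le> 2 * 1" for r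
    unfolding abs_mult using tau_bounds[of r] bd[of "tau r"] by (intro mult_mono) auto
  have "(\<integral>r. (1 - tau r) * u (tau r) \<partial>BP \<mu>) =
      (\<integral>k. (\<integral>r. (1 - tau r) * u (tau r) \<partial>conv (branches (message \<delta> \<mu>) k) \<mu>s) \<partial>measure_pmf P)"
    using bk symmetric_distD[OF \<mu>] symmetric_distD[OF \<mu>s] by (intro integral_BP) auto
  also have "\<dots> = (\<integral>k. 0 \<partial>measure_pmf P)"
    using bd by (intro Bochner_Integration.integral_cong refl symmetric_dist_odd[OF symmetric_node[OF \<mu>], of u 1]) (auto simp: odd)
  finally show "(\<integral>r. (1 - tau r) * u (tau r) \<partial>BP \<mu>) = 0" by simp
qed simp

lemma integral_BP_gker:
  assumes \<mu>: "symmetric_dist \<mu>" and q: "\<bar>q\<bar> < 1" and t: "0 \<le> t" "t \<le> 1"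
  shows "(\<integral>r. gker q (t * tau r) \<partial>BP \<mu>) =
      (\<integral>k. (\<integral>r. gker q (t * tau r) \<partial>conv (branches (message \<delta> \<mu>) k) \<mu>s) \<partial>measure_pmf P)"
    and "integrable (measure_pmf P) (\<lambda>k. \<integral>r. gker q (t * tau r) \<partial>conv (branches (message \<delta> \<mu>) k) \<mu>s)"
proof -
  have b: "\<bar>gker q (t * tau r)\<bar> \<le> 1 / (1 - q\<^sup>2)" for r
    using t q by (intro abs_gker_le abs_scaled_tau_le)
  show "(\<integral>r. gker q (t * tau r) \<partial>BP \<mu>) =
      (\<integral>k. (\<integral>r. gker q (t * tau r) \<partial>conv (branches (message \<delta> \<mu>) k) \<mu>s) \<partial>measure_pmf P)"
    using b symmetric_distD[OF \<mu>] symmetric_distD[OF \<mu>s] by (intro integral_BP) auto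
  show "integrable (measure_pmf P) (\<lambda>k. \<integral>r. gker q (t * tau r) \<partial>conv (branches (message \<delta> \<mu>) k) \<mu>s)"
    using b symmetric_distD(1)[OF symmetric_node[OF \<mu>]]
    by (intro integrable_bounded[of _ _ "1 / (1 - q\<^sup>2)"] abs_integral_le) (auto simp: prob_space_measure_pmf)
qed

text \<open>The survey is compared only with its own degraded version, where the tests are smaller
  because kernels increase in the modulus. At t = 1 this is monotonicity of the BP operator.\<close>

lemma degraded_BP:
  assumes \<mu>: "symmetric_dist \<mu>" and \<nu>: "symmetric_dist \<nu>" and t: "0 \<le> t" "t \<le> 1" and deg: "degraded t \<mu> \<nu>"
  shows "degraded t (BP \<mu>) (BP \<nu>)"
  unfolding degraded_def
proof safe
  fix q :: real assume q: "\<bar>q\<bar> < 1"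
  have "degraded t \<mu>s \<mu>s"
    unfolding degraded_def
  proof safe
    fix q :: real assume q: "\<bar>q\<bar> < 1"
    note s = symmetric_distD[OF \<mu>s]
    have "gker q (t * tau r) \<le> gker q (tau r)" for r
    proof -
      have "(t * tau r)\<^sup>2 \<le> (tau r)\<^sup>2"
        using t by (simp add: power_mult_distrib mult_left_le_one_le power_le_one)
      hence "0 \<le> gker q (tau r) - gker q (t * tau r)"
        unfolding gker_diff[OF q abs_tau_le abs_scaled_tau_le[OF t]]
        using mult_sq_less_one(1)[OF q abs_tau_le, of r] mult_sq_less_one(1)[OF q abs_scaled_tau_le[OF t], of r]
        by (intro divide_nonneg_nonneg mult_nonneg_nonneg) simp_all
      thus ?thesis by simp
    qed
    thus "(\<integral>r. gker q (t * tau r) \<partial>\<mu>s) \<le> (\<integral>r. gker q (tau r) \<partial>\<mu>s)"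
      using integrable_gker[OF s(1,2) q t] integrable_gker[OF s(1,2) q, of 1]
      by (intro integral_mono) auto
  qed
  hence "degraded t (conv (branches (message \<delta> \<mu>) k) \<mu>s) (conv (branches (message \<delta> \<nu>) k) \<mu>s)" for k
    by (intro degraded_conv symmetric_branches symmetric_message degraded_branches degraded_message \<mu> \<nu> t deg \<delta> \<mu>s)
  hence "(\<integral>r. gker q (t * tau r) \<partial>BP \<mu>) \<le>
      (\<integral>k. (\<integral>r. gker q (tau r) \<partial>conv (branches (message \<delta> \<nu>) k) \<mu>s) \<partial>measure_pmf P)"
    using integral_BP_gker[OF \<mu> q t] integral_BP_gker[OF \<nu> q, of 1] q
    by (simp add: integral_mono degraded_def)
  thus "(\<integral>r. gker q (t * tau r) \<partial>BP \<mu>) \<le> (\<integral>r. gker q (tau r) \<partial>BP \<nu>)"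
    using integral_BP_gker(1)[OF \<nu> q, of 1] by simp
qed

definition survey_power :: real where
  "survey_power = (\<integral>r. (tau r)\<^sup>2 \<partial>\<mu>s)"

text \<open>The survey enters exactly once at each node, whatever the degree, so the surplus is the
  same for all k, including k = 0, and survives the average over the degree.\<close>

lemma degraded_BP_gain:
  assumes \<mu>: "symmetric_dist \<mu>" and \<nu>: "symmetric_dist \<nu>" and t: "0 \<le> t" "t < 1" and deg: "degraded t \<mu> \<nu>"
    and q: "\<bar>q\<bar> < 1"
  shows "(\<integral>r. gker q (t * tau r) \<partial>BP \<mu>) + (1 - t\<^sup>2) ^ 3 / 8 * survey_power \<le> (\<integral>r. gker q (tau r) \<partial>BP \<nu>)"
proof -
  have t1: "t \<le> 1" using t by simp
  let ?c = "(1 - t\<^sup>2) ^ 3 / 8 * survey_power"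
  have *: "(\<integral>r. gker q (t * tau r) \<partial>conv (branches (message \<delta> \<mu>) k) \<mu>s) + ?c \<le>
      (\<integral>r. gker q (tau r) \<partial>conv (branches (message \<delta> \<nu>) k) \<mu>s)" for k
    unfolding survey_power_def
    by (intro degraded_conv_gain symmetric_branches symmetric_message degraded_branches degraded_message \<mu> \<nu> t t1 deg \<delta> \<mu>s q)
  have "(\<integral>r. gker q (t * tau r) \<partial>BP \<mu>) + ?c =
      (\<integral>k. (\<integral>r. gker q (t * tau r) \<partial>conv (branches (message \<delta> \<mu>) k) \<mu>s) + ?c \<partial>measure_pmf P)"
    using integral_BP_gker[OF \<mu> q t(1) t1] by simp
  also have "\<dots> \<le> (\<integral>k. (\<integral>r. gker q (tau r) \<partial>conv (branches (message \<delta> \<nu>) k) \<mu>s) \<partial>measure_pmf P)"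
    using integral_BP_gker(2)[OF \<mu> q t(1) t1] integral_BP_gker(2)[OF \<nu> q, of 1] *
    by (intro integral_mono) auto
  finally show ?thesis
    using integral_BP_gker(1)[OF \<nu> q, of 1] by simp
qed

lemma survey_power_pos:
  assumes "\<mu>s \<noteq> trivial_dist"
  shows "0 < survey_power"
proof (rule ccontr)
  note s = symmetric_distD[OF \<mu>s]
  note [measurable_cong] = s(2)
  interpret prob_space \<mu>s by (rule s)
  assume "\<not> 0 < survey_power"
  moreover have "0 \<le> survey_power" unfolding survey_power_def by (intro integral_nonneg_AE) auto
  ultimately have "(\<integral>r. (tau r)\<^sup>2 \<partial>\<mu>s) = 0" unfolding survey_power_def by linarith
  moreover have "integrable \<mu>s (\<lambda>r. (tau r)\<^sup>2)"
    using abs_tau_le by (intro integrable_bounded[OF s(1), of _ 1]) (auto simp: abs_square_le_1)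
  ultimately have "AE r in \<mu>s. (tau r)\<^sup>2 = 0"
    by (subst (asm) integral_nonneg_eq_0_iff_AE) auto
  hence ae: "AE r in \<mu>s. r = 0"
  proof eventually_elim
    case (elim r)
    hence "llr (tau r) = llr 0" by simp
    thus ?case using llr_tau[of 0] by simp
  qed
  have "\<mu>s = trivial_dist"
  proof (rule measure_eqI)
    show "sets \<mu>s = sets trivial_dist" by (simp add: trivial_dist_def s)
    fix A assume "A \<in> sets \<mu>s"
    hence A [measurable]: "A \<in> sets borel" by (simp add: s)
    have "emeasure \<mu>s A = (\<integral>\<^sup>+r. indicator A r \<partial>\<mu>s)" by (simp add: s)
    also have "\<dots> = (\<integral>\<^sup>+r. indicator A 0 \<partial>\<mu>s)"
      using ae by (intro nn_integral_cong_AE) auto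
    also have "\<dots> = indicator A 0" by (simp add: emeasure_space_1)
    finally show "emeasure \<mu>s A = emeasure trivial_dist A" by (simp add: trivial_dist_def)
  qed
  thus False using assms by contradiction
qed

text \<open>Values of v along the iteration: each increment is the surplus (1 - t^2)^3 / 8 times the
  survey power, rewritten with 1 - t^2 = 1 / (1 + v).\<close>

primrec gain :: "nat \<Rightarrow> real" where
  "gain 0 = 0"
| "gain (Suc n) = gain n + survey_power / (8 * (1 + gain n) ^ 3)"

lemma survey_power_nonneg: "0 \<le> survey_power"
  unfolding survey_power_def by (intro integral_nonneg_AE) auto

lemma gain_nonneg: "0 \<le> gain n"
  by (induction n) (simp_all add: survey_power_nonneg)

text \<open>Since increments decay like the inverse cube, the fourth power grows linearly: in (a +
  e)^4 \<ge> a^4 + 4 a^3 e the term 4 a^3 e is the constant \<open>survey_power / 2\<close>.\<close>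

lemma gain_growth: "real n * survey_power / 2 \<le> (1 + gain n) ^ 4"
proof (induction n)
  case (Suc n)
  define a where "a = 1 + gain n"
  define e where "e = survey_power / (8 * a ^ 3)"
  have a: "1 \<le> a" using gain_nonneg by (simp add: a_def)
  have e: "0 \<le> e" using a survey_power_nonneg by (simp add: e_def)
  have "a ^ 4 + 4 * a ^ 3 * e \<le> (a + e) ^ 4"
  proof -
    have "(a + e) ^ 4 - (a ^ 4 + 4 * a ^ 3 * e) = e\<^sup>2 * (6 * a\<^sup>2 + 4 * a * e + e\<^sup>2)"
      by (simp add: algebra_simps power2_eq_square power4_eq_xxxx power3_eq_cube)
    moreover have "0 \<le> e\<^sup>2 * (6 * a\<^sup>2 + 4 * a * e + e\<^sup>2)" using a e by simp
    ultimately show ?thesis by linarith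
  qed
  moreover have "4 * a ^ 3 * e = survey_power / 2" using a by (simp add: e_def)
  moreover have "1 + gain (Suc n) = a + e" by (simp add: a_def e_def)
  ultimately show ?case using Suc.IH by (simp add: a_def[symmetric] field_simps)
qed simp

lemma gain_at_top:
  assumes "0 < survey_power"
  shows "filterlim gain at_top sequentially"
  unfolding filterlim_at_top
proof
  fix K :: real
  have "eventually (\<lambda>n. 2 * (1 + \<bar>K\<bar>) ^ 4 / survey_power \<le> real n) sequentially"
    using filterlim_real_sequentially unfolding filterlim_at_top by blast
  thus "eventually (\<lambda>n. K \<le> gain n) sequentially"
  proof eventually_elim
    case (elim n)
    hence "(1 + \<bar>K\<bar>) ^ 4 \<le> real n * survey_power / 2" using assms by (simp add: field_simps)
    also note gain_growth
    finally have "1 + \<bar>K\<bar> \<le> 1 + gain n"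
      by (rule power_le_imp_le_base[of _ 3, simplified]) (use gain_nonneg[of n] in simp)
    thus ?case by linarith
  qed
qed

text \<open>The surplus of one application pays exactly for raising v from \<open>gain n\<close> to
  \<open>gain (Suc n)\<close>. The starting points \<mu> and \<nu> are arbitrary, so their roles can
  be exchanged.\<close>

lemma degraded_iterates:
  assumes \<mu>: "symmetric_dist \<mu>" and \<nu>: "symmetric_dist \<nu>"
  shows "symmetric_dist ((BP ^^ n) \<mu>) \<and> symmetric_dist ((BP ^^ n) \<nu>) \<and>
    degraded (corr (gain n)) ((BP ^^ n) \<mu>) ((BP ^^ n) \<nu>)"
proof (induction n)
  case 0
  \<comment> \<open>At correlation 0 every test on the left is \<open>gker q 0 = 0\<close>, so any
    two distributions are comparable at the start.\<close>
  have "corr 0 = 0" by (simp add: corr_def)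
  thus ?case
    using \<mu> \<nu> by (auto simp: degraded_def gker_nonneg abs_tau_le intro!: integral_nonneg_AE)
next
  case (Suc n)
  let ?\<mu> = "(BP ^^ n) \<mu>" and ?\<nu> = "(BP ^^ n) \<nu>"
  have sym: "symmetric_dist ?\<mu>" "symmetric_dist ?\<nu>" and deg: "degraded (corr (gain n)) ?\<mu> ?\<nu>"
    using Suc.IH by auto
  note t = corr[OF gain_nonneg[of n]]
  have t': "0 \<le> corr (gain (Suc n))" "corr (gain (Suc n)) \<le> 1"
    using corr[OF gain_nonneg[of "Suc n"]] by auto
  have "degraded (corr (gain (Suc n))) (BP ?\<mu>) (BP ?\<nu>)"
    unfolding degraded_def
  proof safe
    fix q :: real assume q: "\<bar>q\<bar> < 1"
    let ?e = "gain (Suc n) - gain n"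
    note s = symmetric_distD[OF symmetric_BP[OF sym(1)]]
    interpret prob_space "BP ?\<mu>" by (rule s)
    have i: "integrable (BP ?\<mu>) (\<lambda>r. gker q (corr (gain n) * tau r))"
      using t by (intro integrable_gker s q) auto
    have "(\<integral>r. gker q (corr (gain (Suc n)) * tau r) \<partial>BP ?\<mu>) \<le>
        (\<integral>r. gker q (corr (gain n) * tau r) + ?e \<partial>BP ?\<mu>)"
    proof (intro integral_mono)
      show "integrable (BP ?\<mu>) (\<lambda>r. gker q (corr (gain (Suc n)) * tau r))"
        using t' by (intro integrable_gker s q)
      show "gker q (corr (gain (Suc n)) * tau r) \<le> gker q (corr (gain n) * tau r) + ?e" for r
        using gain_nonneg survey_power_nonneg by (intro gker_corr_diff q abs_tau_le) auto
    qed (use i in simp)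
    also have "\<dots> = (\<integral>r. gker q (corr (gain n) * tau r) \<partial>BP ?\<mu>) + ?e"
      using i by (simp add: prob_space)
    also have "?e = (1 - (corr (gain n))\<^sup>2) ^ 3 / 8 * survey_power"
      using gain_nonneg[of n] by (simp add: t(3) power_divide)
    also have "(\<integral>r. gker q (corr (gain n) * tau r) \<partial>BP ?\<mu>) + \<dots> \<le> (\<integral>r. gker q (tau r) \<partial>BP ?\<nu>)"
      by (rule degraded_BP_gain[OF sym t(1,2) deg q])
    finally show "(\<integral>r. gker q (corr (gain (Suc n)) * tau r) \<partial>BP ?\<mu>) \<le> (\<integral>r. gker q (tau r) \<partial>BP ?\<nu>)" .
  qed
  thus ?case using symmetric_BP sym by simp
qed

lemma symmetric_iterates: "symmetric_dist \<mu> \<Longrightarrow> symmetric_dist ((BP ^^ n) \<mu>)"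
  by (induction n) (simp_all add: symmetric_BP)

text \<open>Degraded and undegraded tests differ by at most (1 - t^2) / (1 - q^2)^2, with 1 - t^2 =
  1 / (1 + gain n). A dependence on q is acceptable at this point, as q is fixed while n
  grows.\<close>

lemma iterates_gap:
  assumes \<mu>: "symmetric_dist \<mu>" and \<nu>: "symmetric_dist \<nu>" and q: "\<bar>q\<bar> < 1"
  shows "(\<integral>r. gker q (tau r) \<partial>(BP ^^ n) \<mu>) - (\<integral>r. gker q (tau r) \<partial>(BP ^^ n) \<nu>) \<le> 1 / (1 + gain n) / (1 - q\<^sup>2)\<^sup>2"
proof -
  let ?\<mu> = "(BP ^^ n) \<mu>" and ?\<nu> = "(BP ^^ n) \<nu>"
  let ?t = "corr (gain n)"
  let ?c = "1 / (1 + gain n) / (1 - q\<^sup>2)\<^sup>2"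
  note t = corr[OF gain_nonneg[of n]]
  have t1: "?t \<le> 1" using t by simp
  have q2: "0 < 1 - q\<^sup>2" using q by (simp add: abs_square_less_1)
  note s = symmetric_distD[OF symmetric_iterates[OF \<mu>, of n]]
  interpret prob_space ?\<mu> by (rule s)
  have i: "integrable ?\<mu> (\<lambda>r. gker q (?t * tau r))" "integrable ?\<mu> (\<lambda>r. gker q (tau r))"
    using integrable_gker[OF s(1,2) q t(1) t1] integrable_gker[OF s(1,2) q, of 1] by auto
  have p: "gker q (tau r) \<le> gker q (?t * tau r) + ?c" for r
  proof -
    note b = abs_tau_le[of r] abs_scaled_tau_le[OF t(1) t1, of r]
    have "gker q (tau r) - gker q (?t * tau r) =
        (1 - ?t\<^sup>2) * (tau r)\<^sup>2 / ((1 - q\<^sup>2 * (tau r)\<^sup>2) * (1 - q\<^sup>2 * (?t * tau r)\<^sup>2))"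
      by (simp add: gker_diff[OF q b] power_mult_distrib left_diff_distrib)
    also have "\<dots> \<le> 1 / (1 + gain n) / ((1 - q\<^sup>2) * (1 - q\<^sup>2))"
    proof (rule frac_le)
      show "(1 - ?t\<^sup>2) * (tau r)\<^sup>2 \<le> 1 / (1 + gain n)"
        unfolding t(3) using gain_nonneg[of n] b by (intro mult_left_le) (auto simp: abs_square_le_1)
      show "(1 - q\<^sup>2) * (1 - q\<^sup>2) \<le> (1 - q\<^sup>2 * (tau r)\<^sup>2) * (1 - q\<^sup>2 * (?t * tau r)\<^sup>2)"
        using mult_sq_less_one(2)[OF q b(1)] mult_sq_less_one(2)[OF q b(2)] q2 by (intro mult_mono) auto
    qed (use q2 gain_nonneg[of n] in auto)
    finally show ?thesis by (simp add: power2_eq_square)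
  qed
  have "(\<integral>r. gker q (tau r) \<partial>?\<mu>) \<le> (\<integral>r. gker q (?t * tau r) + ?c \<partial>?\<mu>)"
    using i p by (intro integral_mono) auto
  also have "\<dots> = (\<integral>r. gker q (?t * tau r) \<partial>?\<mu>) + ?c"
    using i by (simp add: prob_space)
  also have "(\<integral>r. gker q (?t * tau r) \<partial>?\<mu>) \<le> (\<integral>r. gker q (tau r) \<partial>?\<nu>)"
    using degraded_iterates[OF \<mu> \<nu>, of n] q by (auto simp: degraded_def)
  finally show ?thesis by simp
qed

lemma iterates_merge:
  assumes \<mu>: "symmetric_dist \<mu>" and \<nu>: "symmetric_dist \<nu>" and q: "\<bar>q\<bar> < 1" and pos: "0 < survey_power"
  shows "(\<lambda>n. (\<integral>r. gker q (tau r) \<partial>(BP ^^ n) \<mu>) - (\<integral>r. gker q (tau r) \<partial>(BP ^^ n) \<nu>)) \<longlonglongrightarrow> 0"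
proof (rule Lim_null_comparison)
  show "eventually (\<lambda>n. norm ((\<integral>r. gker q (tau r) \<partial>(BP ^^ n) \<mu>) - (\<integral>r. gker q (tau r) \<partial>(BP ^^ n) \<nu>)) \<le>
      1 / (1 + gain n) / (1 - q\<^sup>2)\<^sup>2) sequentially"
    using iterates_gap[OF \<mu> \<nu> q] iterates_gap[OF \<nu> \<mu> q] by (intro always_eventually allI) (auto simp: abs_le_iff)
  have "filterlim (\<lambda>n. 1 + gain n) at_top sequentially"
    by (rule filterlim_tendsto_add_at_top[OF tendsto_const gain_at_top[OF pos]])
  hence "(\<lambda>n. 1 / (1 + gain n)) \<longlonglongrightarrow> 0"
    using tendsto_inverse_0_at_top by (simp add: inverse_eq_divide)
  thus "(\<lambda>n. 1 / (1 + gain n) / (1 - q\<^sup>2)\<^sup>2) \<longlonglongrightarrow> 0"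
    by (rule tendsto_divide_zero)
qed

end

section \<open>Weak limits of symmetric distributions\<close>

context
  fixes M :: "nat \<Rightarrow> ereal measure" and \<mu> :: "ereal measure"
  assumes symM: "\<And>n. symmetric_dist (M n)" and sym: "symmetric_dist \<mu>"
begin

lemma tau_limit_approx:
  fixes f :: "real \<Rightarrow> real"
  assumes f [measurable]: "f \<in> borel_measurable borel" and bf: "\<And>x. \<bar>x\<bar> \<le> 1 \<Longrightarrow> \<bar>f x\<bar> \<le> K"
    and approx: "\<And>e. 0 < e \<Longrightarrow> \<exists>g \<in> borel_measurable borel. (\<forall>x. \<bar>x\<bar> \<le> 1 \<longrightarrow> \<bar>f x - g x\<bar> \<le> e) \<and>
      (\<lambda>n. \<integral>r. g (tau r) \<partial>M n) \<longlonglongrightarrow> (\<integral>r. g (tau r) \<partial>\<mu>)"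
  shows "(\<lambda>n. \<integral>r. f (tau r) \<partial>M n) \<longlonglongrightarrow> (\<integral>r. f (tau r) \<partial>\<mu>)"
proof (rule tendstoI)
  fix e :: real assume e: "0 < e"
  then obtain g where g [measurable]: "g \<in> borel_measurable borel"
    and fg: "\<And>x. \<bar>x\<bar> \<le> 1 \<Longrightarrow> \<bar>f x - g x\<bar> \<le> e / 4"
    and lim: "(\<lambda>n. \<integral>r. g (tau r) \<partial>M n) \<longlonglongrightarrow> (\<integral>r. g (tau r) \<partial>\<mu>)"
    using approx[of "e / 4"] by auto
  have bg: "\<bar>g x\<bar> \<le> K + e / 4" if "\<bar>x\<bar> \<le> 1" for x using fg[OF that] bf[OF that] by linarith
  have *: "\<bar>(\<integral>r. f (tau r) \<partial>\<nu>) - (\<integral>r. g (tau r) \<partial>\<nu>)\<bar> \<le> e / 4" if "symmetric_dist \<nu>" for \<nu>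
  proof -
    note s = symmetric_distD[OF that]
    note [measurable_cong] = s(2)
    have "integrable \<nu> (\<lambda>r. f (tau r))" "integrable \<nu> (\<lambda>r. g (tau r))"
      using bf bg abs_tau_le by (auto intro!: integrable_bounded[OF s(1)])
    hence "(\<integral>r. f (tau r) \<partial>\<nu>) - (\<integral>r. g (tau r) \<partial>\<nu>) = (\<integral>r. f (tau r) - g (tau r) \<partial>\<nu>)" by simp
    also have "\<bar>\<dots>\<bar> \<le> e / 4"
      using fg abs_tau_le by (intro abs_integral_le s) auto
    finally show ?thesis .
  qed
  have "eventually (\<lambda>n. dist (\<integral>r. g (tau r) \<partial>M n) (\<integral>r. g (tau r) \<partial>\<mu>) < e / 4) sequentially"
    using lim e by (intro tendstoD) auto
  thus "eventually (\<lambda>n. dist (\<integral>r. f (tau r) \<partial>M n) (\<integral>r. f (tau r) \<partial>\<mu>) < e) sequentially"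
  proof eventually_elim
    case (elim n)
    thus ?case
      using *[OF symM, of n] *[OF sym] unfolding dist_real_def by linarith
  qed
qed

context
  assumes lim: "\<And>q. \<bar>q\<bar> < 1 \<Longrightarrow> (\<lambda>n. \<integral>r. gker q (tau r) \<partial>M n) \<longlonglongrightarrow> (\<integral>r. gker q (tau r) \<partial>\<mu>)"
begin

text \<open>For q \<noteq> 0 a further factor x^2 is a difference quotient: x^2 g_q = (g_q - g_0) /
  q^2. At q = 0 there is nothing to divide by, and the kernel is approximated uniformly by kernels
  of small nonzero parameter.\<close>

lemma limit_power_gker:
  "\<bar>q\<bar> < 1 \<Longrightarrow> (\<lambda>n. \<integral>r. tau r ^ (2 * k) * gker q (tau r) \<partial>M n) \<longlonglongrightarrow> (\<integral>r. tau r ^ (2 * k) * gker q (tau r) \<partial>\<mu>)"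
proof (induction k arbitrary: q)
  case 0
  thus ?case using lim by simp
next
  case (Suc k)
  have rec: "gker q x = x\<^sup>2 + q\<^sup>2 * (x\<^sup>2 * gker q x)" if "\<bar>q\<bar> < 1" "\<bar>x\<bar> \<le> 1" for q x :: real
    using mult_sq_less_one(1)[OF that] by (simp add: gker_def field_simps)
  have pw: "\<bar>x ^ j\<bar> \<le> 1" if "\<bar>x\<bar> \<le> 1" for x :: real and j
    using that by (simp add: power_abs power_le_one)
  have bd: "\<bar>x ^ j * gker q x\<bar> \<le> 1 * (1 / (1 - q\<^sup>2))" if "\<bar>q\<bar> < 1" "\<bar>x\<bar> \<le> 1" for q x :: real and j
    unfolding abs_mult using that by (intro mult_mono pw abs_gker_le) auto
  have nz: "(\<lambda>n. \<integral>r. tau r ^ (2 * Suc k) * gker q (tau r) \<partial>M n) \<longlonglongrightarrow> (\<integral>r. tau r ^ (2 * Suc k) * gker q (tau r) \<partial>\<mu>)"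
    if q: "\<bar>q\<bar> < 1" "q \<noteq> 0" for q
  proof -
    have eq: "(\<integral>r. tau r ^ (2 * Suc k) * gker q (tau r) \<partial>\<nu>) =
        ((\<integral>r. tau r ^ (2 * k) * gker q (tau r) \<partial>\<nu>) - (\<integral>r. tau r ^ (2 * k) * gker 0 (tau r) \<partial>\<nu>)) / q\<^sup>2"
      if "symmetric_dist \<nu>" for \<nu>
    proof -
      note s = symmetric_distD[OF that]
      note [measurable_cong] = s(2)
      have i: "integrable \<nu> (\<lambda>r. tau r ^ (2 * k) * gker q (tau r))" if "\<bar>q\<bar> < 1" for q
        using bd[OF that abs_tau_le] by (intro integrable_bounded[OF s(1)]) auto
      have "tau r ^ (2 * Suc k) * gker q (tau r) = (tau r ^ (2 * k) * gker q (tau r) - tau r ^ (2 * k) * gker 0 (tau r)) / q\<^sup>2" for r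
      proof -
        have "gker q (tau r) - gker 0 (tau r) = q\<^sup>2 * ((tau r)\<^sup>2 * gker q (tau r))"
          using rec[OF q(1) abs_tau_le[of r]] by (simp add: gker_def[of 0])
        hence "(tau r ^ (2 * k) * gker q (tau r) - tau r ^ (2 * k) * gker 0 (tau r)) =
            tau r ^ (2 * k) * (q\<^sup>2 * ((tau r)\<^sup>2 * gker q (tau r)))"
          by (simp flip: right_diff_distrib)
        thus ?thesis using q(2) by (simp add: power2_eq_square)
      qed
      thus ?thesis using i[OF q(1)] i[of 0] by simp
    qed
    show ?thesis
      unfolding eq[OF symM] eq[OF sym] using q(2) Suc.IH[OF q(1)] Suc.IH[of 0]
      by (intro tendsto_intros) auto
  qed
  show ?case
  proof (cases "q = 0")
    case True
    show ?thesis
      unfolding True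
    proof (rule tau_limit_approx[where f = "\<lambda>x. x ^ (2 * Suc k) * gker 0 x" and K = "1 * (1 / (1 - 0\<^sup>2))"])
      show "\<bar>x ^ (2 * Suc k) * gker 0 x\<bar> \<le> 1 * (1 / (1 - 0\<^sup>2))" if "\<bar>x\<bar> \<le> 1" for x
        using that by (intro bd) auto
      \<comment> \<open>The witness is the kernel whose parameter p satisfies p^2 / (1 - p^2) = e,
        which bounds g_p - g_0 = p^2 x^2 g_p on [-1, 1].\<close>
      fix e :: real assume e: "0 < e"
      define p where "p = sqrt (e / (1 + e))"
      have p: "p \<noteq> 0" "\<bar>p\<bar> < 1" "p\<^sup>2 = e / (1 + e)" using e by (auto simp: p_def)
      have "1 - p\<^sup>2 = 1 / (1 + e)" using e p(3) by (simp add: field_simps)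
      hence pe: "p\<^sup>2 * (1 / (1 - p\<^sup>2)) = e" using e p(3) by simp
      have "\<bar>x ^ (2 * Suc k) * gker 0 x - x ^ (2 * Suc k) * gker p x\<bar> \<le> e" if x: "\<bar>x\<bar> \<le> 1" for x
      proof -
        have "gker 0 x - gker p x = - (p\<^sup>2 * (x\<^sup>2 * gker p x))"
          using rec[OF p(2) x] by (simp add: gker_def[of 0])
        hence "x ^ (2 * Suc k) * gker 0 x - x ^ (2 * Suc k) * gker p x = - (x ^ (2 * Suc k) * (p\<^sup>2 * (x\<^sup>2 * gker p x)))"
          by (simp flip: right_diff_distrib)
        also have "\<bar>\<dots>\<bar> = \<bar>x ^ (2 * Suc k)\<bar> * (p\<^sup>2 * \<bar>x\<^sup>2 * gker p x\<bar>)"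
          by (simp add: abs_mult)
        also have "\<dots> \<le> 1 * (p\<^sup>2 * (1 * (1 / (1 - p\<^sup>2))))"
          by (intro mult_mono[OF pw[OF x]] mult_left_mono bd[OF p(2) x]) auto
        finally show ?thesis using pe by simp
      qed
      thus "\<exists>g \<in> borel_measurable borel. (\<forall>x. \<bar>x\<bar> \<le> 1 \<longrightarrow> \<bar>x ^ (2 * Suc k) * gker 0 x - g x\<bar> \<le> e) \<and>
        (\<lambda>n. \<integral>r. g (tau r) \<partial>M n) \<longlonglongrightarrow> (\<integral>r. g (tau r) \<partial>\<mu>)"
        using nz[OF p(2,1)] by (intro bexI[of _ "\<lambda>x. x ^ (2 * Suc k) * gker p x"]) auto
    qed simp
  qed (use nz Suc.prems in auto)
qed

lemma limit_moments: "(\<lambda>n. \<integral>r. (tau r)\<^sup>2 ^ k \<partial>M n) \<longlonglongrightarrow> (\<integral>r. (tau r)\<^sup>2 ^ k \<partial>\<mu>)"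
proof (cases k)
  case 0
  thus ?thesis
    using prob_space.prob_space[OF symmetric_distD(1)[OF symM]] prob_space.prob_space[OF symmetric_distD(1)[OF sym]]
    by simp
next
  case (Suc j)
  have "x\<^sup>2 ^ k = x ^ (2 * j) * gker 0 x" for x :: real
    by (simp add: Suc gker_def power_mult)
  thus ?thesis using limit_power_gker[of 0 j] by simp
qed

lemma limit_even:
  fixes e :: "real \<Rightarrow> real"
  assumes e: "continuous_on {0..1} e"
  shows "(\<lambda>n. \<integral>r. e ((tau r)\<^sup>2) \<partial>M n) \<longlonglongrightarrow> (\<integral>r. e ((tau r)\<^sup>2) \<partial>\<mu>)"
proof -
  \<comment> \<open>The cap at 1 gives a function continuous on the whole line, hence Borel, that
    agrees with e (x^2) on the range of \<open>tau\<close>.\<close>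
  define f where "f x = e (min 1 (x\<^sup>2))" for x :: real
  have f_tau: "f x = e (x\<^sup>2)" if "\<bar>x\<bar> \<le> 1" for x
    using that by (simp add: f_def abs_square_le_1 min_absorb2)
  have "continuous_on UNIV f"
    unfolding f_def by (intro continuous_on_compose2[OF e] continuous_intros) auto
  hence fm: "f \<in> borel_measurable borel" by (rule borel_measurable_continuous_onI)
  have "bounded (e ` {0..1})"
    using e by (intro compact_imp_bounded compact_continuous_image) auto
  then obtain K where "\<forall>z\<in>e ` {0..1}. norm z \<le> K"
    unfolding bounded_iff by blast
  hence K: "\<And>y. y \<in> {0..1} \<Longrightarrow> \<bar>e y\<bar> \<le> K" by simp
  have "(\<lambda>n. \<integral>r. f (tau r) \<partial>M n) \<longlonglongrightarrow> (\<integral>r. f (tau r) \<partial>\<mu>)"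
  proof (rule tau_limit_approx[OF fm, of K])
    show "\<bar>f x\<bar> \<le> K" for x unfolding f_def by (rule K) auto
    fix d :: real assume d: "0 < d"
    obtain g where g: "real_polynomial_function g" "\<And>x. x \<in> {0..1} \<Longrightarrow> \<bar>e x - g x\<bar> < d"
      using Stone_Weierstrass_real_polynomial_function[OF _ e d] by auto
    then obtain a and m :: nat where a: "g = (\<lambda>x. \<Sum>i\<le>m. a i * x ^ i)"
      using real_polynomial_function_iff_sum by blast
    have eq: "(\<integral>r. g ((tau r)\<^sup>2) \<partial>\<nu>) = (\<Sum>i\<le>m. a i * (\<integral>r. (tau r)\<^sup>2 ^ i \<partial>\<nu>))" if "symmetric_dist \<nu>" for \<nu>
    proof -
      note s = symmetric_distD[OF that]
      note [measurable_cong] = s(2)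
      have "\<bar>(tau r)\<^sup>2 ^ i\<bar> \<le> 1" for r i
        using abs_tau_le[of r] by (simp add: abs_square_le_1 power_le_one)
      hence "integrable \<nu> (\<lambda>r. (tau r)\<^sup>2 ^ i)" for i
        by (intro integrable_bounded[OF s(1), of _ 1]) auto
      thus ?thesis by (simp add: a)
    qed
    have "(\<lambda>n. \<integral>r. g ((tau r)\<^sup>2) \<partial>M n) \<longlonglongrightarrow> (\<integral>r. g ((tau r)\<^sup>2) \<partial>\<mu>)"
      unfolding eq[OF symM] eq[OF sym] by (intro tendsto_intros limit_moments)
    moreover have "(\<lambda>x. g (x\<^sup>2)) \<in> borel_measurable borel"
      unfolding a by measurable
    moreover have "\<bar>f x - g (x\<^sup>2)\<bar> \<le> d" if "\<bar>x\<bar> \<le> 1" for x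
      using g(2)[of "x\<^sup>2"] f_tau[OF that] that by (simp add: abs_square_le_1 less_imp_le)
    ultimately show "\<exists>g \<in> borel_measurable borel. (\<forall>x. \<bar>x\<bar> \<le> 1 \<longrightarrow> \<bar>f x - g x\<bar> \<le> d) \<and>
        (\<lambda>n. \<integral>r. g (tau r) \<partial>M n) \<longlonglongrightarrow> (\<integral>r. g (tau r) \<partial>\<mu>)"
      by (intro bexI[of _ "\<lambda>x. g (x\<^sup>2)"]) auto
  qed
  thus ?thesis by (simp add: f_tau abs_tau_le)
qed

text \<open>By \<open>symmetric_expand\<close> only the symmetrised test matters, and being even it
  is a continuous function of x^2. Continuity is asked of the symmetrisation alone, so a bounded k
  may be discontinuous at -1: there it is multiplied by 1 - x at the mirror point x = 1.\<close>

lemma limit_tau: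
  fixes k :: "real \<Rightarrow> real"
  assumes k: "k \<in> borel_measurable borel" and bd: "\<And>x. \<bar>x\<bar> \<le> 1 \<Longrightarrow> \<bar>k x\<bar> \<le> K"
    and cont: "continuous_on {0..1} (\<lambda>x. ((1 + x) * k x + (1 - x) * k (- x)) / 2)"
  shows "(\<lambda>n. \<integral>r. k (tau r) \<partial>M n) \<longlonglongrightarrow> (\<integral>r. k (tau r) \<partial>\<mu>)"
proof -
  define s where "s x = ((1 + x) * k x + (1 - x) * k (- x)) / 2" for x
  have s_abs: "s \<bar>x\<bar> = s x" for x by (simp add: s_def abs_if add.commute)
  have cs: "continuous_on {0..1} s" unfolding s_def by (rule cont)
  have "continuous_on {0..1} (\<lambda>y. s (sqrt y))"
    by (rule continuous_on_compose2[OF cs]) (auto intro!: continuous_intros)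
  from limit_even[OF this]
  have "(\<lambda>n. \<integral>r. s (tau r) \<partial>M n) \<longlonglongrightarrow> (\<integral>r. s (tau r) \<partial>\<mu>)" by (simp add: s_abs)
  thus ?thesis
    unfolding s_def by (simp only: symmetric_expand[OF symM k bd] symmetric_expand[OF sym k bd])
qed

end

end

section \<open>From tests in \<open>tau\<close> to weak convergence and equality of laws\<close>

lemma llr_mono:
  assumes "x \<le> y"
  shows "llr x \<le> llr y"
proof -
  have "artanh x \<le> artanh y" if "-1 < x" "y < 1"
  proof -
    have "tanh (artanh x) \<le> tanh (artanh y)" using that assms by (simp add: tanh_artanh_real)
    thus ?thesis by simp
  qed
  thus ?thesis using assms by (auto simp: llr_def)
qed

text \<open>A monotone surjection onto an order topology is continuous; this covers the infinite end
  points as well.\<close>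

lemma continuous_on_llr: "continuous_on A llr"
proof -
  have "range llr = UNIV" by (metis llr_tau surjI)
  hence "continuous_on UNIV llr" by (intro continuous_onI_mono llr_mono) auto
  thus ?thesis by (rule continuous_on_subset) auto
qed

text \<open>A test function may oscillate near -infinity. In the symmetrised test its value at -r
  carries the weight \<open>1 - tau r\<close>, which tends to 0 as r tends to +infinity, so
  boundedness replaces continuity there.\<close>

lemma weakly_convergesI:
  assumes symM: "\<And>n. symmetric_dist (M n)" and sym: "symmetric_dist \<mu>"
    and lim: "\<And>q. \<bar>q\<bar> < 1 \<Longrightarrow> (\<lambda>n. \<integral>r. gker q (tau r) \<partial>M n) \<longlonglongrightarrow> (\<integral>r. gker q (tau r) \<partial>\<mu>)"
  shows "weakly_converges M \<mu>"
  unfolding weakly_converges_def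
proof safe
  fix f :: "ereal \<Rightarrow> real" assume cont: "continuous_on {-\<infinity><..} f" and bd: "bounded (f ` {-\<infinity><..})"
  define f' where "f' r = indicator {-\<infinity><..} r *\<^sub>R f r" for r
  have f'm [measurable]: "f' \<in> borel_measurable borel"
    unfolding f'_def by (intro borel_measurable_continuous_on_indicator cont) auto
  obtain K where K: "\<And>r. r \<in> {-\<infinity><..} \<Longrightarrow> \<bar>f r\<bar> \<le> K"
    using bd by (auto simp: bounded_iff)
  have K0: "0 \<le> K" using K[of 0] by simp
  have bf': "\<bar>f' r\<bar> \<le> K" for r
    using K[of r] K0 by (auto simp: f'_def indicator_def)
  have cf': "continuous_on {-\<infinity><..} f'"
    using cont by (rule continuous_on_eq) (auto simp: f'_def)
  have fin: "llr x \<in> {-\<infinity><..}" if "-1 < x" for x using that by (auto simp: llr_def)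
  have f'_llr: "continuous_on {-1<..} (\<lambda>x. f' (llr x))"
    using fin by (intro continuous_on_compose2[OF cf'] continuous_on_llr) auto
  have c1: "continuous_on {0..1} (\<lambda>x. (1 + x) * f' (llr x))"
    by (intro continuous_intros continuous_on_subset[OF f'_llr]) auto
  have c2: "continuous_on {0..1} (\<lambda>x. (1 - x) * f' (llr (- x)))"
    unfolding continuous_on_def
  proof safe
    fix x :: real assume x: "x \<in> {0..1}"
    show "((\<lambda>x. (1 - x) * f' (llr (- x))) \<longlongrightarrow> (1 - x) * f' (llr (- x))) (at x within {0..1})"
    proof (cases "x = 1")
      case True
      have "((\<lambda>y. (1 - y) * f' (llr (- y))) \<longlongrightarrow> 0) (at x within {0..1})"
      proof (rule Lim_null_comparison)
        show "eventually (\<lambda>y. norm ((1 - y) * f' (llr (- y))) \<le> \<bar>1 - y\<bar> * K) (at x within {0..1})"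
          using bf' by (intro always_eventually) (auto simp: abs_mult intro: mult_left_mono)
        have "((\<lambda>y. \<bar>1 - y\<bar> * K) \<longlongrightarrow> \<bar>1 - x\<bar> * K) (at x within {0..1})"
          by (intro tendsto_intros)
        thus "((\<lambda>y. \<bar>1 - y\<bar> * K) \<longlongrightarrow> 0) (at x within {0..1})" using True by simp
      qed
      thus ?thesis using True by simp
    next
      case False
      have "continuous_on {..<1} (\<lambda>x. (1 - x) * f' (llr (- x)))"
        by (intro continuous_intros continuous_on_compose2[OF f'_llr]) auto
      hence "isCont (\<lambda>x. (1 - x) * f' (llr (- x))) x"
        using x False by (simp add: continuous_on_eq_continuous_at)
      thus ?thesis unfolding isCont_def by (rule tendsto_within_subset) simp
    qed
  qed
  have "(\<lambda>n. \<integral>r. f' (llr (tau r)) \<partial>M n) \<longlonglongrightarrow> (\<integral>r. f' (llr (tau r)) \<partial>\<mu>)"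
  proof (rule limit_tau[OF symM sym lim, where k = "\<lambda>x. f' (llr x)" and K = K])
    show "continuous_on {0..1} (\<lambda>x. ((1 + x) * f' (llr x) + (1 - x) * f' (llr (- x))) / 2)"
      by (intro continuous_intros c1 c2) auto
  qed (use bf' in auto)
  moreover have "(\<integral>r. f' (llr (tau r)) \<partial>\<nu>) = (\<integral>r. f r \<partial>\<nu>)" if "symmetric_dist \<nu>" for \<nu>
  proof -
    note s = symmetric_distD[OF that]
    have ae: "AE r in \<nu>. f' r = f r" using s(3) by eventually_elim (auto simp: f'_def)
    have "(\<integral>r. f' r \<partial>\<nu>) = (\<integral>r. f r \<partial>\<nu>)"
    proof (rule integral_cong_AE[OF _ _ ae])
      show "f' \<in> borel_measurable \<nu>" using f'm by (simp add: measurable_cong_sets[OF s(2) refl])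
      \<comment> \<open>f differs from its cut-off f' at most at the point -infinity, so it is Borel
        whatever its value there.\<close>
      have "(\<lambda>r. if r = -\<infinity> then f (-\<infinity>) else f' r) \<in> borel_measurable \<nu>"
        unfolding measurable_cong_sets[OF s(2) refl] by measurable
      also have "(\<lambda>r. if r = -\<infinity> then f (-\<infinity>) else f' r) = f" by (auto simp: f'_def fun_eq_iff)
      finally show "f \<in> borel_measurable \<nu>" .
    qed
    thus ?thesis by simp
  qed
  ultimately show "(\<lambda>n. \<integral>r. f r \<partial>M n) \<longlonglongrightarrow> (\<integral>r. f r \<partial>\<mu>)"
    using symM sym by simp
qed

text \<open>The limit result applied to a constant sequence shows that bounded continuous functions
  of \<open>tau\<close> have equal integrals; sine and cosine give equal characteristic functions,
  and \<open>llr\<close> recovers the law of r from that of \<open>tau r\<close>.\<close>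

lemma symmetric_dist_eqI:
  assumes \<mu>: "symmetric_dist \<mu>" and \<nu>: "symmetric_dist \<nu>"
    and eq: "\<And>q. \<bar>q\<bar> < 1 \<Longrightarrow> (\<integral>r. gker q (tau r) \<partial>\<mu>) = (\<integral>r. gker q (tau r) \<partial>\<nu>)"
  shows "\<mu> = \<nu>"
proof -
  have k: "(\<integral>r. k (tau r) \<partial>\<mu>) = (\<integral>r. k (tau r) \<partial>\<nu>)"
    if cont: "continuous_on UNIV k" and bd: "\<And>x. \<bar>k x\<bar> \<le> 1" for k :: "real \<Rightarrow> real"
  proof -
    have km: "k \<in> borel_measurable borel" using cont by (rule borel_measurable_continuous_onI)
    have "continuous_on {0..1} (\<lambda>x. ((1 + x) * k x + (1 - x) * k (- x)) / 2)"
      by (intro continuous_intros continuous_on_compose2[OF cont]) auto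
    with \<mu> \<nu> eq km bd have "(\<lambda>n::nat. \<integral>r. k (tau r) \<partial>\<mu>) \<longlonglongrightarrow> (\<integral>r. k (tau r) \<partial>\<nu>)"
      by (intro limit_tau[of "\<lambda>_. \<mu>" \<nu> k 1]) auto
    thus ?thesis using LIMSEQ_unique[OF tendsto_const] by blast
  qed
  have char: "char (distr \<kappa> borel tau) t = Complex (\<integral>r. cos (t * tau r) \<partial>\<kappa>) (\<integral>r. sin (t * tau r) \<partial>\<kappa>)"
    if "symmetric_dist \<kappa>" for \<kappa> t
  proof -
    note s = symmetric_distD[OF that]
    note [measurable_cong] = s(2)
    interpret prob_space \<kappa> by (rule s)
    have i: "integrable \<kappa> (\<lambda>r. iexp (t * tau r))"
      by (intro integrable_const_bound[of _ 1]) auto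
    have "char (distr \<kappa> borel tau) t = (\<integral>r. iexp (t * tau r) \<partial>\<kappa>)"
      unfolding char_def by (subst integral_distr) auto
    also have "\<dots> = Complex (\<integral>r. cos (t * tau r) \<partial>\<kappa>) (\<integral>r. sin (t * tau r) \<partial>\<kappa>)"
      using integral_Re[OF i] integral_Im[OF i] by (intro complex_eqI) (simp_all add: Re_exp Im_exp)
    finally show ?thesis .
  qed
  have "char (distr \<mu> borel tau) = char (distr \<nu> borel tau)"
  proof
    fix t
    have "(\<integral>r. cos (t * tau r) \<partial>\<mu>) = (\<integral>r. cos (t * tau r) \<partial>\<nu>)"
      "(\<integral>r. sin (t * tau r) \<partial>\<mu>) = (\<integral>r. sin (t * tau r) \<partial>\<nu>)"
      by (intro k[of "\<lambda>x. cos (t * x)"] k[of "\<lambda>x. sin (t * x)"] continuous_intros; simp)+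
    thus "char (distr \<mu> borel tau) t = char (distr \<nu> borel tau) t"
      by (simp add: char[OF \<mu>] char[OF \<nu>])
  qed
  moreover have "real_distribution (distr \<kappa> borel tau)" if "symmetric_dist \<kappa>" for \<kappa>
  proof -
    note s = symmetric_distD[OF that]
    note [measurable_cong] = s(2)
    interpret prob_space \<kappa> by (rule s)
    show ?thesis by (intro real_distribution_distr) measurable
  qed
  ultimately have "distr \<mu> borel tau = distr \<nu> borel tau"
    using \<mu> \<nu> by (intro Levy_uniqueness) auto
  hence "distr (distr \<mu> borel tau) borel llr = distr (distr \<nu> borel tau) borel llr" by simp
  moreover have "distr (distr \<kappa> borel tau) borel llr = \<kappa>" if "symmetric_dist \<kappa>" for \<kappa>
  proof -
    note s = symmetric_distD[OF that]
    note [measurable_cong] = s(2)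
    have "distr (distr \<kappa> borel tau) borel llr = distr \<kappa> borel (\<lambda>r. r)"
      by (subst distr_distr) (auto simp: comp_def)
    also have "\<dots> = \<kappa>" by (rule distr_id2[OF s(2)[symmetric]])
    finally show ?thesis .
  qed
  ultimately show ?thesis using \<mu> \<nu> by simp
qed

section \<open>Existence of a symmetric limit\<close>

definition clamp :: "real \<Rightarrow> real" where
  "clamp x = max 0 (min 1 x)"

lemma clamp_bounds: "0 \<le> clamp x" "clamp x \<le> 1" "\<bar>clamp x\<bar> \<le> 1"
  by (auto simp: clamp_def)

lemma measurable_clamp [measurable]: "clamp \<in> borel_measurable borel"
  unfolding clamp_def[abs_def] by measurable

text \<open>The modulus of \<open>tau r\<close> may have any law on [0, 1], and symmetry then fixes
  the sign: the density 1 + c or 1 - c with respect to a fair sign makes it positive with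
  probability (1 + c) / 2. The clamp takes the place of a statement about the support of N.\<close>

lemma symmetrize:
  assumes N: "prob_space N" "sets N = sets (borel :: real measure)"
  obtains \<mu> where "symmetric_dist \<mu>"
    and "\<And>(k :: real \<Rightarrow> real) K. k \<in> borel_measurable borel \<Longrightarrow> (\<And>x. k (- x) = k x) \<Longrightarrow> (\<And>x. \<bar>x\<bar> \<le> 1 \<Longrightarrow> \<bar>k x\<bar> \<le> K) \<Longrightarrow>
      (\<integral>r. k (tau r) \<partial>\<mu>) = (\<integral>x. k (clamp x) \<partial>N)"
proof
  note [measurable_cong] = N(2)
  interpret N: prob_space N by fact
  let ?B = "measure_pmf (bernoulli_pmf (1 / 2))"
  interpret NB: pair_prob_space N ?B ..
  define sg where "sg b = (if b then 1 else - 1 :: real)" for b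
  define w where "w z = 1 + sg (snd z) * clamp (fst z)" for z :: "real \<times> bool"
  define T where "T z = llr (sg (snd z) * clamp (fst z))" for z :: "real \<times> bool"
  have [measurable]: "(\<lambda>z. sg (snd z)) \<in> borel_measurable (N \<Otimes>\<^sub>M ?B)"
    by (rule measurable_compose[OF measurable_snd]) simp
  have wm [measurable]: "w \<in> borel_measurable (N \<Otimes>\<^sub>M ?B)" unfolding w_def by measurable
  have [measurable]: "T \<in> borel_measurable (N \<Otimes>\<^sub>M ?B)" unfolding T_def by measurable
  have w0: "0 \<le> w z" and w2: "w z \<le> 2" for z
    using clamp_bounds[of "fst z"] by (auto simp: w_def sg_def)
  have pair: "(\<integral>z. h z \<partial>(N \<Otimes>\<^sub>M ?B)) = (\<integral>x. (h (x, True) + h (x, False)) / 2 \<partial>N)"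
    if [measurable]: "h \<in> borel_measurable (N \<Otimes>\<^sub>M ?B)" and bd: "\<And>z. \<bar>h z\<bar> \<le> C" for h :: "real \<times> bool \<Rightarrow> real" and C
  proof -
    have "(\<integral>z. h z \<partial>(N \<Otimes>\<^sub>M ?B)) = (\<integral>x. (\<integral>b. h (x, b) \<partial>?B) \<partial>N)"
      using bd by (intro NB.integral_fst'[symmetric] integrable_bounded[of _ _ C] NB.prob_space_axioms) auto
    thus ?thesis by (simp add: integral_bernoulli_pmf add_divide_distrib mult.commute)
  qed
  define \<mu> where "\<mu> = distr (density (N \<Otimes>\<^sub>M ?B) (\<lambda>z. ennreal (w z))) borel T"
  have sets: "sets \<mu> = sets borel" by (simp add: \<mu>_def)
  have int: "(\<integral>r. h (tau r) \<partial>\<mu>) = (\<integral>x. ((1 + clamp x) * h (clamp x) + (1 - clamp x) * h (- clamp x)) / 2 \<partial>N)"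
    if [measurable]: "h \<in> borel_measurable borel" and bd: "\<And>x. \<bar>x\<bar> \<le> 1 \<Longrightarrow> \<bar>h x\<bar> \<le> C" for h :: "real \<Rightarrow> real" and C
  proof -
    have tT: "tau (T z) = sg (snd z) * clamp (fst z)" for z
      unfolding T_def using clamp_bounds[of "fst z"] by (intro tau_llr) (auto simp: sg_def)
    have "(\<integral>r. h (tau r) \<partial>\<mu>) = (\<integral>z. w z * h (tau (T z)) \<partial>(N \<Otimes>\<^sub>M ?B))"
      unfolding \<mu>_def using w0 by (subst integral_distr, simp, simp, subst integral_density) auto
    also have "\<dots> = (\<integral>x. (w (x, True) * h (tau (T (x, True))) + w (x, False) * h (tau (T (x, False)))) / 2 \<partial>N)"
    proof (rule pair)
      show "\<bar>w z * h (tau (T z))\<bar> \<le> 2 * C" for z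
        unfolding abs_mult using w0[of z] w2[of z] bd[OF abs_tau_le] by (intro mult_mono) auto
    qed measurable
    finally show ?thesis by (simp add: tT) (simp add: w_def sg_def)
  qed
  have "prob_space \<mu>"
  proof -
    have "(\<integral>\<^sup>+z. ennreal (w z) \<partial>(N \<Otimes>\<^sub>M ?B)) = ennreal (\<integral>z. w z \<partial>(N \<Otimes>\<^sub>M ?B))"
      using w0 w2 by (intro nn_integral_eq_integral integrable_bounded[of _ _ 2] NB.prob_space_axioms) auto
    also have "(\<integral>z. w z \<partial>(N \<Otimes>\<^sub>M ?B)) = (\<integral>x. (w (x, True) + w (x, False)) / 2 \<partial>N)"
      using w0 w2 by (intro pair[of _ 2]) auto
    also have "\<dots> = 1" by (simp add: w_def sg_def N.prob_space)
    finally have "prob_space (density (N \<Otimes>\<^sub>M ?B) (\<lambda>z. ennreal (w z)))"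
      by (intro prob_spaceI) (simp add: emeasure_density cong: nn_integral_cong)
    thus ?thesis
      unfolding \<mu>_def by (rule prob_space.prob_space_distr) simp
  qed
  show "symmetric_dist \<mu>"
  proof (rule symmetric_distI[OF \<open>prob_space \<mu>\<close> sets])
    fix u :: "real \<Rightarrow> real" assume [measurable]: "u \<in> borel_measurable borel"
      and odd: "\<And>x. u (- x) = - u x" and bd: "\<And>x. \<bar>u x\<bar> \<le> 1"
    have bk: "\<bar>(1 - x) * u x\<bar> \<le> 2 * 1" if "\<bar>x\<bar> \<le> 1" for x
      unfolding abs_mult using that bd[of x] by (intro mult_mono) auto
    have "(\<integral>r. (1 - tau r) * u (tau r) \<partial>\<mu>) =
        (\<integral>x. ((1 + clamp x) * ((1 - clamp x) * u (clamp x)) + (1 - clamp x) * ((1 - - clamp x) * u (- clamp x))) / 2 \<partial>N)"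
      using bk by (intro int[of "\<lambda>x. (1 - x) * u x" "2 * 1"]) auto
    also have "\<dots> = 0" by (simp add: odd mult_ac)
    finally show "(\<integral>r. (1 - tau r) * u (tau r) \<partial>\<mu>) = 0" .
  qed
  show "(\<integral>r. k (tau r) \<partial>\<mu>) = (\<integral>x. k (clamp x) \<partial>N)"
    if "k \<in> borel_measurable borel" "\<And>x. k (- x) = k x" "\<And>x. \<bar>x\<bar> \<le> 1 \<Longrightarrow> \<bar>k x\<bar> \<le> K" for k :: "real \<Rightarrow> real" and K
  proof -
    have "((1 + c) * a + (1 - c) * a) / 2 = a" for a c :: real by (simp add: algebra_simps)
    thus ?thesis using int[OF that(1,3)] that(2) by simp
  qed
qed

text \<open>The moduli of \<open>tau\<close> lie in [0, 1], so their laws are tight and have a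
  weakly convergent subsequence. Kernels are even and see the modulus only, hence their integrals
  pass to the symmetrised limit; along the subsequence their limits are still L.\<close>

lemma symmetric_limit_exists:
  assumes sym: "\<And>n. symmetric_dist (M n)"
    and lim: "\<And>q. \<bar>q\<bar> < 1 \<Longrightarrow> (\<lambda>n. \<integral>r. gker q (tau r) \<partial>M n) \<longlonglongrightarrow> L q"
  obtains \<mu> where "symmetric_dist \<mu>" "\<And>q. \<bar>q\<bar> < 1 \<Longrightarrow> (\<integral>r. gker q (tau r) \<partial>\<mu>) = L q"
proof -
  define N where "N n = distr (M n) borel (\<lambda>r. \<bar>tau r\<bar>)" for n
  have rd: "real_distribution (N n)" for n
  proof -
    note s = symmetric_distD[OF sym[of n]]
    note [measurable_cong] = s(2)
    interpret prob_space "M n" by (rule s)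
    show ?thesis unfolding N_def by (intro real_distribution_distr) measurable
  qed
  \<comment> \<open>The interval is open on the left and a modulus can be 0, so it starts at -1
    instead of 0.\<close>
  have "measure (N n) {-1<..1} = 1" for n
  proof -
    note s = symmetric_distD[OF sym[of n]]
    note [measurable_cong] = s(2)
    interpret prob_space "M n" by (rule s)
    have "(\<lambda>r. \<bar>tau r\<bar>) -` {-1<..1} \<inter> space (M n) = space (M n)"
      using abs_tau_le by (auto intro: less_le_trans[of _ 0])
    thus ?thesis unfolding N_def by (subst measure_distr) (auto simp: prob_space)
  qed
  hence "\<exists>a b. a < b \<and> (\<forall>n. measure (N n) {a<..b} > 1 - \<epsilon>)" if "0 < \<epsilon>" for \<epsilon> :: real
    using that by (intro exI[of _ "-1::real"] exI[of _ "1::real"]) simp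
  hence "tight N"
    unfolding tight_def using rd by blast
  then obtain r N' where r: "strict_mono (r :: nat \<Rightarrow> nat)" and N': "real_distribution N'"
    and weak: "weak_conv_m (N \<circ> id \<circ> r) N'"
    using tight_imp_convergent_subsubsequence[of N id] by (auto simp: strict_mono_id)
  interpret N': real_distribution N' by fact
  show ?thesis
  proof (rule symmetrize[OF N'.prob_space_axioms N'.events_eq_borel])
    fix \<mu> assume \<mu>: "symmetric_dist \<mu>"
    assume int: "\<And>(k :: real \<Rightarrow> real) K. k \<in> borel_measurable borel \<Longrightarrow> (\<And>x. k (- x) = k x) \<Longrightarrow> (\<And>x. \<bar>x\<bar> \<le> 1 \<Longrightarrow> \<bar>k x\<bar> \<le> K) \<Longrightarrow>
      (\<integral>r. k (tau r) \<partial>\<mu>) = (\<integral>x. k (clamp x) \<partial>N')"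
    have "(\<integral>r. gker q (tau r) \<partial>\<mu>) = L q" if q: "\<bar>q\<bar> < 1" for q
    proof -
      \<comment> \<open>The unclamped kernel is unbounded on the line; the clamp makes it bounded
        and continuous, as a test for weak convergence must be.\<close>
      have cont: "isCont (\<lambda>x. gker q (clamp x)) x" for x
        unfolding gker_def clamp_def using mult_sq_less_one(1)[OF q, of "max 0 (min 1 x)"]
        by (intro continuous_intros) auto
      have conv: "(\<lambda>n. \<integral>x. gker q (clamp x) \<partial>(N \<circ> id \<circ> r) n) \<longlonglongrightarrow> (\<integral>x. gker q (clamp x) \<partial>N')"
        using rd N' weak cont abs_gker_le[OF q clamp_bounds(3)]
        by (intro weak_conv_imp_integral_bdd_continuous_conv[where B = "1 / (1 - q\<^sup>2)"]) (auto simp: comp_def)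
      have eq: "(\<integral>x. gker q (clamp x) \<partial>(N \<circ> id \<circ> r) n) = (\<integral>s. gker q (tau s) \<partial>M (r n))" for n
      proof -
        note s = symmetric_distD[OF sym[of "r n"]]
        note [measurable_cong] = s(2)
        have "gker q (clamp \<bar>tau s\<bar>) = gker q (tau s)" for s
          using abs_tau_le[of s] by (simp add: clamp_def gker_def)
        thus ?thesis unfolding N_def comp_def by (subst integral_distr) auto
      qed
      have "(\<lambda>n. \<integral>s. gker q (tau s) \<partial>M (r n)) \<longlonglongrightarrow> (\<integral>x. gker q (clamp x) \<partial>N')"
        using conv unfolding eq .
      moreover have "(\<lambda>n. \<integral>s. gker q (tau s) \<partial>M (r n)) \<longlonglongrightarrow> L q"
        using LIMSEQ_subseq_LIMSEQ[OF lim[OF q] r] by (simp add: comp_def)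
      ultimately have "(\<integral>x. gker q (clamp x) \<partial>N') = L q" by (rule LIMSEQ_unique)
      thus ?thesis using int[of "gker q" "1 / (1 - q\<^sup>2)"] abs_gker_le[OF q] by simp
    qed
    thus thesis using that \<mu> by blast
  qed
qed

section \<open>Existence, uniqueness and attraction of the fixed point\<close>

theorem theorem15:
  fixes \<delta> :: real and P :: "nat pmf" and \<mu>s :: "ereal measure"
  assumes "0 \<le> \<delta>" and "\<delta> \<le> 1"
    and "symmetric_dist \<mu>s" and "\<mu>s \<noteq> trivial_dist"
  shows "\<exists>\<mu>star.
    (BP_fixed_point P \<delta> \<mu>s \<mu>star \<and> \<mu>star \<noteq> trivial_dist) \<and>
    (\<forall>\<nu>. BP_fixed_point P \<delta> \<mu>s \<nu> \<and> \<nu> \<noteq> trivial_dist \<longrightarrow> \<nu> = \<mu>star) \<and>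
    (\<forall>\<mu>. symmetric_dist \<mu> \<longrightarrow>
       weakly_converges (\<lambda>h. (BP_operator P \<delta> \<mu>s ^^ h) \<mu>) \<mu>star)"
proof -
  note hyp = assms(1-3)
  define Q where "Q = BP_operator P \<delta> \<mu>s"
  define G where "G \<mu> q = (\<integral>r. gker q (tau r) \<partial>\<mu>)" for \<mu> q
  note pos = survey_power_pos[OF assms]
  note symQ = symmetric_BP[OF hyp, of _ P, folded Q_def]
  note iter = symmetric_iterates[OF hyp, of _ _ P, folded Q_def]
  note merge = iterates_merge[OF hyp _ _ _ pos, of _ _ _ P, folded Q_def G_def]
  have deg1: "degraded 1 \<mu> \<nu> \<longleftrightarrow> (\<forall>q. \<bar>q\<bar> < 1 \<longrightarrow> G \<mu> q \<le> G \<nu> q)" for \<mu> \<nu>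
    by (simp add: degraded_def G_def)
  have mono: "degraded 1 (Q \<mu>) (Q \<nu>)" if "symmetric_dist \<mu>" "symmetric_dist \<nu>" "degraded 1 \<mu> \<nu>" for \<mu> \<nu>
    using degraded_BP[OF hyp that(1,2) _ _ that(3)] by (simp add: Q_def)
  define T where "T n = (Q ^^ n) trivial_dist" for n
  have symT: "symmetric_dist (T n)" for n
    unfolding T_def by (intro iter symmetric_trivial)
  \<comment> \<open>The trivial distribution is least for the order, and monotonicity propagates
    this first comparison.\<close>
  have incT: "degraded 1 (T n) (T (Suc n))" for n
  proof (induction n)
    case 0
    have "T 0 = trivial_dist" by (simp add: T_def)
    thus ?case using degraded_trivial[OF symmetric_distD(1)[OF symT]] by simp
  next
    case (Suc n)
    thus ?case using mono[OF symT symT Suc.IH] by (simp add: T_def)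
  qed
  have incGT: "incseq (\<lambda>n. G (T n) q)" if "\<bar>q\<bar> < 1" for q
    using incT that by (intro incseq_SucI) (simp add: deg1)
  have conv: "convergent (\<lambda>n. G (T n) q)" if q: "\<bar>q\<bar> < 1" for q
  proof (rule Bseq_mono_convergent)
    show "Bseq (\<lambda>n. G (T n) q)"
    proof (rule BseqI')
      fix n
      note s = symmetric_distD[OF symT[of n]]
      note [measurable_cong] = s(2)
      have "(\<lambda>r. gker q (tau r)) \<in> borel_measurable (T n)" by measurable
      thus "norm (G (T n) q) \<le> 1 / (1 - q\<^sup>2)"
        unfolding G_def real_norm_def by (rule abs_integral_le[OF s(1)]) (rule abs_gker_le[OF q abs_tau_le])
    qed
    show "\<forall>m n. m \<le> n \<longrightarrow> G (T m) q \<le> G (T n) q"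
      using incGT[OF q] by (simp add: incseq_def)
  qed
  define L where "L q = lim (\<lambda>n. G (T n) q)" for q
  have limT: "(\<lambda>n. G (T n) q) \<longlonglongrightarrow> L q" if "\<bar>q\<bar> < 1" for q
    unfolding L_def using conv[OF that] by (simp add: convergent_LIMSEQ_iff)
  obtain \<mu>star where sym: "symmetric_dist \<mu>star" and star: "\<And>q. \<bar>q\<bar> < 1 \<Longrightarrow> G \<mu>star q = L q"
    using symmetric_limit_exists[OF symT limT[unfolded G_def]] unfolding G_def by blast
  have lim: "(\<lambda>n. G ((Q ^^ n) \<mu>) q) \<longlonglongrightarrow> G \<mu>star q" if "symmetric_dist \<mu>" "\<bar>q\<bar> < 1" for \<mu> q
  proof -
    have "(\<lambda>n. G ((Q ^^ n) \<mu>) q - G (T n) q) \<longlonglongrightarrow> 0"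
      unfolding T_def by (intro merge that symmetric_trivial)
    from tendsto_add[OF this limT[OF that(2)]] show ?thesis by (simp add: star that(2))
  qed
  have T_le: "degraded 1 (T n) \<mu>star" for n
    unfolding deg1
  proof safe
    fix q :: real assume q: "\<bar>q\<bar> < 1"
    show "G (T n) q \<le> G \<mu>star q"
      unfolding star[OF q]
      by (rule incseq_le[OF incGT[OF q] limT[OF q]])
  qed
  \<comment> \<open>From T n below \<mu>star monotonicity gives T (Suc n) below Q \<mu>star; the
    limit in n is one half of the fixed point equation.\<close>
  have up: "degraded 1 \<mu>star (Q \<mu>star)"
    unfolding deg1
  proof safe
    fix q :: real assume q: "\<bar>q\<bar> < 1"
    have "G (T (Suc n)) q \<le> G (Q \<mu>star) q" for n
      using mono[OF symT sym T_le[of n]] q by (simp add: T_def deg1)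
    thus "G \<mu>star q \<le> G (Q \<mu>star) q"
      unfolding star[OF q] by (intro LIMSEQ_le_const2[OF LIMSEQ_Suc[OF limT[OF q]]]) blast
  qed
  have inc: "degraded 1 ((Q ^^ n) \<mu>star) ((Q ^^ Suc n) \<mu>star)" for n
  proof (induction n)
    case (Suc n)
    thus ?case using mono[OF iter[OF sym] iter[OF sym] Suc.IH] by simp
  qed (use up in simp)
  have fixed: "Q \<mu>star = \<mu>star"
  proof (rule symmetric_dist_eqI[OF symQ[OF sym] sym])
    fix q :: real assume q: "\<bar>q\<bar> < 1"
    have "incseq (\<lambda>n. G ((Q ^^ n) \<mu>star) q)"
      using inc q by (intro incseq_SucI) (simp add: deg1)
    \<comment> \<open>Other half: the orbit of \<mu>star increases and by merging converges to
      \<mu>star itself, so its first iterate cannot exceed the limit. Monotonicity and merging stand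
      in for continuity of Q.\<close>
    hence "G ((Q ^^ 1) \<mu>star) q \<le> G \<mu>star q"
      by (rule incseq_le[OF _ lim[OF sym q]])
    thus "(\<integral>r. gker q (tau r) \<partial>Q \<mu>star) = (\<integral>r. gker q (tau r) \<partial>\<mu>star)"
      using up q by (auto simp: deg1 G_def intro: antisym)
  qed
  have nontriv: "\<mu>star \<noteq> trivial_dist"
  proof
    assume "\<mu>star = trivial_dist"
    hence "G (Q \<mu>star) 0 = 0" using fixed by (simp add: G_def)
    \<comment> \<open>With t = 0 and q = 0 the surplus is one eighth of the survey power, a positive
      lower bound for the second moment of \<open>tau\<close> under Q \<mu>star.\<close>
    moreover have "(1 - 0\<^sup>2) ^ 3 / 8 * survey_power \<mu>s \<le> G (Q \<mu>star) 0"
      using degraded_BP_gain[OF hyp sym sym, of 0 0 P] unfolding G_def Q_def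
      by (auto simp: degraded_def gker_nonneg abs_tau_le intro!: integral_nonneg_AE)
    ultimately show False using pos by simp
  qed
  have unique: "\<nu> = \<mu>star" if "symmetric_dist \<nu>" "Q \<nu> = \<nu>" for \<nu>
  proof (rule symmetric_dist_eqI[OF that(1) sym])
    fix q :: real assume q: "\<bar>q\<bar> < 1"
    have "(Q ^^ n) \<nu> = \<nu>" for n using that(2) by (induction n) auto
    hence "(\<lambda>n. G \<nu> q) \<longlonglongrightarrow> G \<mu>star q" using lim[OF that(1) q] by simp
    thus "(\<integral>r. gker q (tau r) \<partial>\<nu>) = (\<integral>r. gker q (tau r) \<partial>\<mu>star)"
      using LIMSEQ_unique[OF tendsto_const] by (auto simp: G_def)
  qed
  have "weakly_converges (\<lambda>h. (Q ^^ h) \<mu>) \<mu>star" if "symmetric_dist \<mu>" for \<mu>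
    using iter[OF that] sym lim[OF that] by (intro weakly_convergesI) (auto simp: G_def)
  thus ?thesis
    using sym fixed nontriv unique unfolding BP_fixed_point_def Q_def by blast
qed

end
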